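(* Let $K$ be an algebraically closed field and let $X\subset\mathbb{P}^2_K$ be a reduced curve of degree $d$, where the characteristic of $K$ is not a divisor of $d$. Write $S=K[x_0,x_1,x_2]$ for the homogeneous coordinate ring of $\mathbb{P}^2_K$. Assume that $F(x_0,x_1,x_2)=0$ is the defining equation of $X$ and that $X$ has only ordinary nodes as singularities. If $$\sum_{i=0}^{2}G_i\,\frac{\partial F}{\partial x_i}=0$$ is a homogeneous relation in $S$, then $\deg G_i\ge d-2$ whenever $G_i\ne 0$, and equality is possible if and only if $X$ is reducible.
   Context: An ordinary node is a singular point at which $X$ has local analytic equation $xy=0$, i.e. the completed local ring is isomorphic to $K[[x,y]]/(xy)$. A homogeneous relation means that $G_0,G_1,G_2\in S$ are homogeneous of the same degree (zero entries allowed). "Equality is possible" means that there exists such a relation with some $G_i\neq 0$ of degree $d-2$. *)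

theory Defs
  imports
    "HOL-Library.Poly_Mapping"
    "HOL-Library.Numeral_Type"
    "HOL-Computational_Algebra.Computational_Algebra"
    "HOL-Algebra.QuotRing"
    "HOL-Algebra.Ideal_Product"
    "HOL-Algebra.Algebraic_Closure_Type"
begin

section \<open>Ternary forms\<close>

text \<open>
  The ring \<open>K[x\<^sub>0, x\<^sub>1, x\<^sub>2]\<close>: finitely supported coefficient functions on exponent vectors.
  The elements of the index type \<^typ>\<open>3\<close> are \<open>0\<close>, \<open>1\<close>, \<open>2\<close>.
\<close>

type_synonym 'k ternary = "(3 \<Rightarrow>\<^sub>0 nat) \<Rightarrow>\<^sub>0 'k"

text \<open>The zero polynomial is homogeneous of every degree.\<close>

definition homogeneous :: "nat \<Rightarrow> 'k::zero ternary \<Rightarrow> bool" where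
  "homogeneous n H \<longleftrightarrow> (\<forall>m \<in> Poly_Mapping.keys H. (\<Sum>i\<in>UNIV. Poly_Mapping.lookup m i) = n)"

definition eval_at :: "'k::comm_semiring_1 ternary \<Rightarrow> (3 \<Rightarrow> 'k) \<Rightarrow> 'k" where
  "eval_at H p =
     (\<Sum>m\<in>Poly_Mapping.keys H. Poly_Mapping.lookup H m * (\<Prod>i\<in>UNIV. p i ^ Poly_Mapping.lookup m i))"

text \<open>
  If \<open>x\<^sub>i\<close> does not occur in the monomial \<open>m\<close>, the subtraction of exponents truncates, but the
  coefficient is \<open>0\<close>.
\<close>

definition partial_deriv :: "3 \<Rightarrow> 'k::comm_semiring_1 ternary \<Rightarrow> 'k ternary" where
  "partial_deriv i H =
     (\<Sum>m\<in>Poly_Mapping.keys H. Poly_Mapping.single (m - Poly_Mapping.single i 1)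
        (of_nat (Poly_Mapping.lookup m i) * Poly_Mapping.lookup H m))"

definition homogeneous_relation ::
    "'k::comm_semiring_1 ternary \<Rightarrow> nat \<Rightarrow> (3 \<Rightarrow> 'k ternary) \<Rightarrow> bool" where
  "homogeneous_relation F e G \<longleftrightarrow>
     (\<forall>i. homogeneous e (G i)) \<and> (\<Sum>i\<in>UNIV. G i * partial_deriv i F) = 0"


section \<open>Closed subsets of the projective plane\<close>

text \<open>
  A point of the projective plane is represented by any of its vectors of homogeneous coordinates,
  so a subset of the plane is represented by the corresponding cone with the origin removed.
\<close>

definition proj_zeros :: "'k::comm_semiring_1 ternary set \<Rightarrow> (3 \<Rightarrow> 'k) set" where
  "proj_zeros T = {p. p \<noteq> (\<lambda>_. 0) \<and> (\<forall>H\<in>T. eval_at H p = 0)}"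

definition proj_closed :: "(3 \<Rightarrow> 'k::comm_semiring_1) set \<Rightarrow> bool" where
  "proj_closed Z \<longleftrightarrow> (\<exists>T. (\<forall>H\<in>T. \<exists>n. homogeneous n H) \<and> Z = proj_zeros T)"

abbreviation curve_points :: "'k::comm_semiring_1 ternary \<Rightarrow> (3 \<Rightarrow> 'k) set" where
  "curve_points F \<equiv> proj_zeros {F}"

definition reducible_curve :: "'k::comm_semiring_1 ternary \<Rightarrow> bool" where
  "reducible_curve F \<longleftrightarrow>
     (\<exists>Z\<^sub>1 Z\<^sub>2. proj_closed Z\<^sub>1 \<and> proj_closed Z\<^sub>2 \<and> curve_points F = Z\<^sub>1 \<union> Z\<^sub>2 \<and>
        Z\<^sub>1 \<noteq> curve_points F \<and> Z\<^sub>2 \<noteq> curve_points F)"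


section \<open>Local rings of a plane curve\<close>

text \<open>
  The local ring at \<open>p\<close> of the scheme \<open>Proj K[x\<^sub>0, x\<^sub>1, x\<^sub>2]/(F)\<close> is the homogeneous localization:
  fractions \<open>A/B\<close> of forms of the same degree with \<open>B(p) \<noteq> 0\<close>, where \<open>A/B = C/D\<close> iff
  \<open>E (A D - C B) \<in> (F)\<close> for some form \<open>E\<close> with \<open>E(p) \<noteq> 0\<close>.
\<close>

definition fractions_at :: "(3 \<Rightarrow> 'k::comm_ring_1) \<Rightarrow> ('k ternary \<times> 'k ternary) set" where
  "fractions_at p = {(A, B). (\<exists>n. homogeneous n A \<and> homogeneous n B) \<and> eval_at B p \<noteq> 0}"

definition fraction_rel ::
    "'k::comm_ring_1 ternary \<Rightarrow> (3 \<Rightarrow> 'k) \<Rightarrow> (('k ternary \<times> 'k ternary) \<times> ('k ternary \<times> 'k ternary)) set" where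
  "fraction_rel F p =
     {((A, B), (C, D)). (A, B) \<in> fractions_at p \<and> (C, D) \<in> fractions_at p \<and>
        (\<exists>E n. homogeneous n E \<and> eval_at E p \<noteq> 0 \<and> F dvd E * (A * D - C * B))}"

definition fraction_class ::
    "'k::comm_ring_1 ternary \<Rightarrow> (3 \<Rightarrow> 'k) \<Rightarrow> 'k ternary \<Rightarrow> 'k ternary \<Rightarrow> ('k ternary \<times> 'k ternary) set" where
  "fraction_class F p A B = fraction_rel F p `` {(A, B)}"

definition local_ring ::
    "'k::comm_ring_1 ternary \<Rightarrow> (3 \<Rightarrow> 'k) \<Rightarrow> ('k ternary \<times> 'k ternary) set ring" where
  "local_ring F p =
     \<lparr>carrier = fractions_at p // fraction_rel F p,
      monoid.mult = (\<lambda>U V. \<Union>x\<in>U. \<Union>y\<in>V. fraction_class F p (fst x * fst y) (snd x * snd y)),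
      one = fraction_class F p 1 1,
      ring.zero = fraction_class F p 0 1,
      add = (\<lambda>U V. \<Union>x\<in>U. \<Union>y\<in>V.
         fraction_class F p (fst x * snd y + fst y * snd x) (snd x * snd y))\<rparr>"

definition local_max_ideal ::
    "'k::comm_ring_1 ternary \<Rightarrow> (3 \<Rightarrow> 'k) \<Rightarrow> ('k ternary \<times> 'k ternary) set set" where
  "local_max_ideal F p = {fraction_class F p A B |A B. (A, B) \<in> fractions_at p \<and> eval_at A p = 0}"

text \<open>
  The inverse limit of the rings \<open>R/I\<^sup>n\<close>.  Elements of \<open>R/I\<^sup>n\<close> are cosets, and \<open>a + I\<^sup>n\<^sup>+\<^sup>1\<close> maps to
  \<open>b + I\<^sup>n\<close> iff the first coset is contained in the second.  The power of \<open>I\<close> is taken in the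
  monoid of ideals.
\<close>

definition adic_completion :: "('a, 'b) ring_scheme \<Rightarrow> 'a set \<Rightarrow> (nat \<Rightarrow> 'a set) ring" where
  "adic_completion R I =
     (let Q = (\<lambda>n::nat. R Quot (I [^]\<^bsub>ideals_set R\<^esub> n)) in
      \<lparr>carrier = {s. \<forall>n. s n \<in> carrier (Q n) \<and> s (Suc n) \<subseteq> s n},
       monoid.mult = (\<lambda>s t n. s n \<otimes>\<^bsub>Q n\<^esub> t n),
       one = (\<lambda>n. \<one>\<^bsub>Q n\<^esub>),
       ring.zero = (\<lambda>n. \<zero>\<^bsub>Q n\<^esub>),
       add = (\<lambda>s t n. s n \<oplus>\<^bsub>Q n\<^esub> t n)\<rparr>)"

definition completed_local_ring ::
    "'k::comm_ring_1 ternary \<Rightarrow> (3 \<Rightarrow> 'k) \<Rightarrow> (nat \<Rightarrow> ('k ternary \<times> 'k ternary) set set) ring" where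
  "completed_local_ring F p = adic_completion (local_ring F p) (local_max_ideal F p)"


section \<open>Reduced curves and ordinary nodes\<close>

text \<open>It suffices to look at closed points, since the other stalks are localizations of theirs.\<close>

definition reduced_curve :: "'k::comm_ring_1 ternary \<Rightarrow> bool" where
  "reduced_curve F \<longleftrightarrow>
     (\<forall>p \<in> curve_points F. \<forall>x \<in> carrier (local_ring F p). \<forall>n::nat.
        x [^]\<^bsub>local_ring F p\<^esub> n = \<zero>\<^bsub>local_ring F p\<^esub> \<longrightarrow> x = \<zero>\<^bsub>local_ring F p\<^esub>)"

definition singular_point :: "'k::comm_ring_1 ternary \<Rightarrow> (3 \<Rightarrow> 'k) \<Rightarrow> bool" where
  "singular_point F p \<longleftrightarrow> p \<in> curve_points F \<and> (\<forall>i. eval_at (partial_deriv i F) p = 0)"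

text \<open>
  \<open>K[[x, y]]/(x y)\<close>, with \<open>K[[x, y]]\<close> rendered as \<open>K[[x]][[y]]\<close>.
\<close>

definition node_ring :: "'k::comm_ring_1 fps fps set ring" where
  "node_ring =
     (ring_of_type_algebra :: 'k fps fps ring) Quot
       (PIdl\<^bsub>ring_of_type_algebra\<^esub> (fps_const fps_X * fps_X))"

definition ordinary_node :: "'k::comm_ring_1 ternary \<Rightarrow> (3 \<Rightarrow> 'k) \<Rightarrow> bool" where
  "ordinary_node F p \<longleftrightarrow>
     singular_point F p \<and> completed_local_ring F p \<simeq> (node_ring :: 'k fps fps set ring)"

end

theory Submission
  imports Defs "Berlekamp_Zassenhaus.Unique_Factorization_Poly"
begin

text \<open>
  Write \<open>F\<^sub>i\<close> for the partial derivatives of \<open>F\<close>.  A relation \<open>\<Sum> G\<^sub>i F\<^sub>i = 0\<close> of degree \<open>e\<close> is a vector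
  field tangent to the curve, and \<open>\<omega> = x \<times> G\<close> is a 1-form of degree \<open>e + 1\<close> for which \<open>\<omega>/F\<close> has
  logarithmic poles: by Euler's formula \<open>\<nabla>F \<times> \<omega> = - d F G\<close> (\<open>moment_cross\<close>), so modulo \<open>F\<close> the
  vectors \<open>\<omega>\<close> and \<open>\<nabla>F\<close> are parallel.  Their ratio \<open>\<rho> = \<omega>\<^sub>i/F\<^sub>i\<close>, the residue, is a rational function
  of degree \<open>e + 2 - d\<close> on every component of the curve.  It is regular at smooth points.  At a node
  the logarithmic condition makes it regular on both branches, that is, integral.  A function of
  degree 0 that is integral everywhere is constant, and one of negative degree is zero.

  Hence for \<open>e < d - 2\<close> the residue vanishes, \<open>F\<close> divides \<open>\<omega>\<close>, and \<open>\<omega> = 0\<close> because its degree is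
  too small; but \<open>\<omega>\<close> determines \<open>G\<close>.  For \<open>e = d - 2\<close> and irreducible \<open>F\<close> one gets \<open>\<omega> = c \<nabla>F\<close>, and
  the scalar product with \<open>x\<close> gives \<open>0 = c d F\<close>, so \<open>c = 0\<close> and \<open>G = 0\<close>.  If \<open>F = F\<^sub>1 F\<^sub>2\<close> is
  reducible, then \<open>G = \<nabla>F\<^sub>1 \<times> \<nabla>F\<^sub>2\<close> is a relation of degree \<open>d - 2\<close>.

  The constancy of the residue (\<open>residue_constant\<close>) is proved without normalizing the curve.
  Let \<open>J\<close> be the ideal of the \<open>F\<^sub>i\<close>.  At a node the Hessian has rank 2, so \<open>J\<close> is locally the ideal of the
  point \<open>p\<close>, and the kernel of the Hessian is spanned by \<open>p\<close> and contains \<open>G(p)\<close>, so \<open>\<omega>(p) = 0\<close>.  Hence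
  \<open>\<omega>\<close> lies in \<open>J\<close> locally, and by the projective Nullstellensatz all forms of some degree \<open>n\<close> multiply \<open>\<omega>\<close>
  into \<open>J\<close> (\<open>moment_in_jacobian_ideal\<close>).  Since \<open>\<rho> F\<^sub>i = \<omega>\<^sub>i\<close>, multiplication by \<open>\<rho>\<close> preserves a
  finite-dimensional space of combinations \<open>\<Sum> M\<^sub>i F\<^sub>i\<close> modulo each prime factor of \<open>F\<close>, and so it has
  an eigenvalue there; as the quotient is a domain, \<open>\<rho>\<close> equals that eigenvalue.

  The hypothesis on the nodes is a ring isomorphism of the completed local ring, which need not be
  \<open>K\<close>-linear.  It enters only through two elements of the maximal ideal that generate it modulo its
  cube and whose product lies in the cube (\<open>completion_node_elements\<close>); differentiating these
  conditions gives the rank of the Hessian in every characteristic (\<open>ordinary_node_hessian\<close>).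
  The Nullstellensatz for plane curves (\<open>curve_nullstellensatz\<close>) translates reducibility as a
  topological space into reducibility of \<open>F\<close>.
\<close>


section \<open>Polynomials in three variables\<close>

abbreviation "lookup \<equiv> Poly_Mapping.lookup"
abbreviation "single \<equiv> Poly_Mapping.single"

abbreviation monomial_degree :: "(3 \<Rightarrow>\<^sub>0 nat) \<Rightarrow> nat" where
  "monomial_degree m \<equiv> \<Sum>i\<in>UNIV. lookup m i"

abbreviation scalar :: "'k::comm_ring_1 \<Rightarrow> 'k ternary" where
  "scalar c \<equiv> single 0 c"

definition variable :: "3 \<Rightarrow> 'k::comm_ring_1 ternary" where
  "variable i = single (single i 1) 1"

lemma exhaust_3: "(i::3) = a \<or> i = a + 1 \<or> i = a + 2"
proof -
  have c: "x = 0 \<or> x = 1 \<or> x = (2::3)" for x :: 3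
  proof (cases x)
    case (of_int z)
    then have "z \<in> {0, 1, 2}" by auto
    with of_int show ?thesis by auto
  qed
  have e: "(3::3) = 0" by simp
  show ?thesis using c[of i] c[of a] e by auto
qed

lemma distinct_3: "(a::3) \<noteq> a + 1" "a \<noteq> a + 2" "a + 1 \<noteq> a + 2"
  by auto

lemma UNIV_3: "(UNIV :: 3 set) = {a, a + 1, a + 2}"
  using exhaust_3 by blast

lemma sum_3: "(\<Sum>i\<in>UNIV. f i) = f a + f (a + 1) + f (a + 2 :: 3)"
  unfolding UNIV_3[of a] using distinct_3[of a] by (simp add: add.assoc)

lemma ternary_as_sum:
  fixes H :: "'k::comm_ring_1 ternary"
  shows "H = (\<Sum>m\<in>Poly_Mapping.keys H. single m (lookup H m))"
  by (rule poly_mapping_eqI)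
     (auto simp: lookup_sum lookup_single when_def in_keys_iff)

lemma ternary_induct [case_names monomial add]:
  fixes H :: "'k::comm_ring_1 ternary"
  assumes "\<And>m c. P (single m c)"
    and "\<And>A B. P A \<Longrightarrow> P B \<Longrightarrow> P (A + B)"
  shows "P H"
proof -
  have "P (\<Sum>m\<in>A. single m (g m))" if "finite A" for A and g :: "_ \<Rightarrow> 'k"
    using that
  proof (induction A)
    case empty
    then show ?case using assms(1)[of 0 0] by simp
  next
    case (insert x F)
    then show ?case using assms by simp
  qed
  then show ?thesis using ternary_as_sum[of H] by (metis finite_keys)
qed


subsection \<open>Evaluation\<close>

definition ternary_eval ::
    "('a::comm_ring_1 \<Rightarrow> 'b::comm_ring_1) \<Rightarrow> (3 \<Rightarrow> 'b) \<Rightarrow> 'a ternary \<Rightarrow> 'b" where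
  "ternary_eval h p H = (\<Sum>m\<in>Poly_Mapping.keys H.
     h (lookup H m) * (\<Prod>i\<in>UNIV. p i ^ lookup m i))"

lemma ternary_eval_single:
  assumes "h 0 = 0"
  shows "ternary_eval h p (single m c) =
    h c * (\<Prod>i\<in>UNIV. p i ^ lookup m i)"
  using assms by (cases "c = 0") (simp_all add: ternary_eval_def)

lemma ternary_eval_hom:
  fixes h :: "'a::comm_ring_1 \<Rightarrow> 'b::comm_ring_1"
  assumes "comm_ring_hom h"
  shows "comm_ring_hom (ternary_eval h p)"
proof -
  interpret h: comm_ring_hom h by fact
  have add: "ternary_eval h p (A + B) = ternary_eval h p A + ternary_eval h p B" for A B
    unfolding ternary_eval_def
    by (rule setsum_keys_plus_distrib) (simp_all add: h.hom_add algebra_simps)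
  have mult_monomials: "ternary_eval h p (single m c * single m' c') =
      ternary_eval h p (single m c) * ternary_eval h p (single m' c')"
    for m c m' c'
    by (simp add: mult_single ternary_eval_single h.hom_mult lookup_add power_add prod.distrib
        mult_ac)
  have mult: "ternary_eval h p (A * B) = ternary_eval h p A * ternary_eval h p B" for A B
  proof (induction A rule: ternary_induct)
    case (monomial m c)
    show ?case
      by (induction B rule: ternary_induct) (simp_all add: mult_monomials add algebra_simps)
  next
    case (add A B)
    then show ?case by (simp add: \<open>\<And>B A. ternary_eval h p (A + B) = _\<close> algebra_simps)
  qed
  have "ternary_eval h p 0 = 0" by (simp add: ternary_eval_def)
  moreover have "ternary_eval h p 1 = 1" by (simp add: ternary_eval_def)
  ultimately show ?thesis using add mult by unfold_locales
qed

lemma eval_at_conv: "eval_at H p = ternary_eval (\<lambda>c. c) p H"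
  by (simp add: eval_at_def ternary_eval_def)

interpretation eval_at: comm_ring_hom "\<lambda>H :: 'k::comm_ring_1 ternary. eval_at H p" for p
  unfolding eval_at_conv by (rule ternary_eval_hom, unfold_locales) simp_all

declare eval_at.hom_dvd [simp del, rule del] eval_at.hom_dvd_1 [simp del]

lemma eval_at_single:
  "eval_at (single m c) p = c * (\<Prod>i\<in>UNIV. p i ^ lookup m i)"
  for c :: "'k::comm_ring_1"
  by (simp add: eval_at_conv ternary_eval_single)

lemma eval_at_scalar [simp]: "eval_at (scalar c) p = c"
  by (simp add: eval_at_single)

lemma eval_at_variable [simp]: "eval_at (variable i) p = p i"
  for p :: "3 \<Rightarrow> 'k::comm_ring_1"
proof -
  have "(\<Prod>j\<in>UNIV. p j ^ lookup (single i (1::nat)) j) =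
      (\<Prod>j\<in>UNIV. if i = j then p j else 1)"
    by (intro prod.cong) (auto simp: lookup_single when_def)
  then show ?thesis by (simp add: eval_at_single variable_def)
qed


subsection \<open>Partial derivatives\<close>

lemma partial_deriv_single:
  fixes c :: "'k::comm_ring_1"
  shows "partial_deriv i (single m c) = single
    (m - single i 1) (of_nat (lookup m i) * c)"
  by (cases "c = 0") (simp_all add: partial_deriv_def)

lemma partial_deriv_add:
  fixes A B :: "'k::comm_ring_1 ternary"
  shows "partial_deriv i (A + B) = partial_deriv i A + partial_deriv i B"
  unfolding partial_deriv_def
  by (rule setsum_keys_plus_distrib) (simp_all add: single_add[symmetric] algebra_simps)

lemma partial_deriv_zero [simp]: "partial_deriv i (0 :: 'k::comm_ring_1 ternary) = 0"
  by (simp add: partial_deriv_def)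

lemma partial_deriv_scalar [simp]: "partial_deriv i (scalar c :: 'k::comm_ring_1 ternary) = 0"
  by (simp add: partial_deriv_single)

lemma partial_deriv_uminus:
  "partial_deriv i (- A) = - partial_deriv i (A :: 'k::comm_ring_1 ternary)"
  using partial_deriv_add[of i A "- A"] by (simp add: eq_neg_iff_add_eq_0 add.commute)

lemma partial_deriv_diff:
  fixes A B :: "'k::comm_ring_1 ternary"
  shows "partial_deriv i (A - B) = partial_deriv i A - partial_deriv i B"
  using partial_deriv_add[of i A "- B"] by (simp add: partial_deriv_uminus)

lemma partial_deriv_variable:
  "partial_deriv i (variable j :: 'k::comm_ring_1 ternary) = (if i = j then 1 else 0)"
  by (simp add: partial_deriv_single variable_def lookup_single when_def)

lemma partial_deriv_mult:
  fixes A B :: "'k::comm_ring_1 ternary"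
  shows "partial_deriv i (A * B) = partial_deriv i A * B + A * partial_deriv i B"
proof -
  let ?e = "single i (1::nat)"
  have left: "m + m' - ?e = (m - ?e) + m'" if "lookup m i \<noteq> 0" for m m'
    using that by (intro poly_mapping_eqI) (auto simp: lookup_add lookup_minus lookup_single when_def)
  have single: "partial_deriv i (single m c * single m' c') =
      partial_deriv i (single m c) * single m' c' +
      single m c * partial_deriv i (single m' c')" for m m' and c c' :: 'k
  proof -
    have 1: "partial_deriv i (single m c) * single m' c' =
        single (m + m' - ?e) (of_nat (lookup m i) * c * c')"
      for m m' and c c' :: 'k
    proof (cases "lookup m i = 0")
      case False
      show ?thesis unfolding partial_deriv_single mult_single left[OF False] ..
    qed (simp add: partial_deriv_single)
    show ?thesis
      using 1[of m c m' c'] 1[of m' c' m c]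
      by (simp add: mult.commute[of "single m c"] add.commute[of m' m])
         (simp add: mult_single partial_deriv_single single_add[symmetric] lookup_add algebra_simps)
  qed
  show ?thesis
  proof (induction A rule: ternary_induct)
    case (monomial m c)
    show ?case
      by (induction B rule: ternary_induct) (simp_all add: single partial_deriv_add algebra_simps)
  next
    case (add A B)
    then show ?case by (simp add: partial_deriv_add algebra_simps)
  qed
qed

lemma partial_deriv_sum:
  fixes f :: "'a \<Rightarrow> 'k::comm_ring_1 ternary"
  shows "partial_deriv i (\<Sum>x\<in>Y. f x) = (\<Sum>x\<in>Y. partial_deriv i (f x))"
  by (induction Y rule: infinite_finite_induct) (simp_all add: partial_deriv_add)

lemma partial_deriv_commute:
  fixes H :: "'k::comm_ring_1 ternary"
  shows "partial_deriv i (partial_deriv j H) = partial_deriv j (partial_deriv i H)"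
proof (induction H rule: ternary_induct)
  case (monomial m c)
  show ?case
    by (cases "i = j")
       (simp_all add: partial_deriv_single lookup_minus lookup_single when_def mult_ac
         diff_diff_add add.commute)
next
  case (add A B)
  then show ?case by (simp add: partial_deriv_add)
qed


subsection \<open>Homogeneous components\<close>

definition component :: "nat \<Rightarrow> 'k::comm_ring_1 ternary \<Rightarrow> 'k ternary" where
  "component n H = (\<Sum>m\<in>Poly_Mapping.keys H.
     single m (lookup H m when monomial_degree m = n))"

lemma component_single:
  "component n (single m c) = (if monomial_degree m = n then single m c else 0)"
  by (cases "c = 0") (simp_all add: component_def)

lemma component_add: "component n (A + B) = component n A + component n B"
  unfolding component_def
  by (rule setsum_keys_plus_distrib) (auto simp add: single_add[symmetric] when_def)

lemma component_zero [simp]: "component n 0 = 0"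
  by (simp add: component_def)

lemma component_sum: "component n (\<Sum>x\<in>Y. f x) = (\<Sum>x\<in>Y. component n (f x))"
  by (induction Y rule: infinite_finite_induct) (simp_all add: component_add)

lemma lookup_component:
  "lookup (component n H) m = (lookup H m when monomial_degree m = n)"
  by (induction H rule: ternary_induct)
     (auto simp: component_single component_add lookup_add lookup_single when_def)

lemma homogeneous_iff_lookup:
  "homogeneous n H \<longleftrightarrow> (\<forall>m. lookup H m \<noteq> 0 \<longrightarrow> monomial_degree m = n)"
  by (auto simp: homogeneous_def in_keys_iff)

lemma homogeneous_component: "homogeneous n (component n H)"
  by (auto simp: homogeneous_iff_lookup lookup_component when_def)

lemma component_homogeneous:
  "homogeneous n H \<Longrightarrow> component k H = (if k = n then H else 0)"
  by (auto intro!: poly_mapping_eqI simp: lookup_component homogeneous_iff_lookup when_def)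

lemma homogeneous_iff_component: "homogeneous n H \<longleftrightarrow> component n H = H"
  by (metis component_homogeneous homogeneous_component)

lemma homogeneous_single: "monomial_degree m = n \<Longrightarrow> homogeneous n (single m c)"
  by (auto simp: homogeneous_iff_lookup lookup_single when_def)

lemma homogeneous_zero [simp]: "homogeneous n (0 :: 'k::zero ternary)"
  by (simp add: homogeneous_def)

lemma homogeneous_scalar [simp]: "homogeneous 0 (scalar c)"
  by (simp add: homogeneous_single)

lemma homogeneous_one [simp]: "homogeneous 0 (1 :: 'k::comm_ring_1 ternary)"
  using homogeneous_scalar[of 1] by simp

lemma monomial_degree_unit: "monomial_degree (single i 1) = 1"
  by (simp add: lookup_single when_def)

lemma homogeneous_variable [simp]: "homogeneous 1 (variable i)" "homogeneous (Suc 0) (variable i)"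
  using homogeneous_single[OF monomial_degree_unit] by (simp_all add: variable_def)

lemma homogeneous_add: "homogeneous n A \<Longrightarrow> homogeneous n B \<Longrightarrow> homogeneous n (A + B)"
  for A B :: "'k::comm_ring_1 ternary"
  by (simp add: homogeneous_iff_component component_add)

lemma homogeneous_uminus: "homogeneous n A \<Longrightarrow> homogeneous n (- A)"
  for A :: "'k::comm_ring_1 ternary"
  by (simp add: homogeneous_iff_lookup)

lemma homogeneous_diff: "homogeneous n A \<Longrightarrow> homogeneous n B \<Longrightarrow> homogeneous n (A - B)"
  for A B :: "'k::comm_ring_1 ternary"
  using homogeneous_add[of n A "- B"] homogeneous_uminus[of n B] by simp

lemma homogeneous_sum: "(\<And>x. x \<in> Y \<Longrightarrow> homogeneous n (f x)) \<Longrightarrow> homogeneous n (\<Sum>x\<in>Y. f x)"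
  for f :: "'a \<Rightarrow> 'k::comm_ring_1 ternary"
  by (induction Y rule: infinite_finite_induct) (simp_all add: homogeneous_add)

lemma homogeneous_mult:
  fixes A B :: "'k::comm_ring_1 ternary"
  assumes "homogeneous n A" "homogeneous k B"
  shows "homogeneous (n + k) (A * B)"
proof -
  have "homogeneous (n + k) (component n A * component k B)"
  proof (induction A rule: ternary_induct)
    case (monomial m c)
    show ?case
      by (induction B rule: ternary_induct)
         (auto simp: component_add component_single algebra_simps mult_single homogeneous_add
            lookup_add sum.distrib intro!: homogeneous_single)
  next
    case (add A B)
    then show ?case by (simp add: component_add algebra_simps homogeneous_add)
  qed
  then show ?thesis using assms by (simp add: homogeneous_iff_component)
qed

lemma homogeneous_scalar_mult: "homogeneous n A \<Longrightarrow> homogeneous n (scalar c * A)"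
  using homogeneous_mult[OF homogeneous_scalar, of n A c] by simp

lemma homogeneous_power: "homogeneous n A \<Longrightarrow> homogeneous (k * n) (A ^ k)"
  for A :: "'k::comm_ring_1 ternary"
  by (induction k) (auto intro: homogeneous_mult)

lemma component_mult:
  assumes "homogeneous k B"
  shows "component n (A * B) = (if k \<le> n then component (n - k) A * B else 0)"
proof (induction A rule: ternary_induct)
  case (monomial m c)
  have "homogeneous (monomial_degree m + k) (single m c * B)"
    by (intro homogeneous_mult homogeneous_single assms refl)
  from component_homogeneous[OF this, of n] show ?case
    by (auto simp: component_single)
next
  case (add A B)
  then show ?case by (simp add: component_add algebra_simps)
qed

lemma sum_components:
  "H = (\<Sum>n\<in>monomial_degree ` Poly_Mapping.keys H. component n H)"
proof (rule poly_mapping_eqI)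
  fix m
  show "lookup H m =
      lookup (\<Sum>n\<in>monomial_degree ` Poly_Mapping.keys H. component n H) m"
    by (cases "m \<in> Poly_Mapping.keys H")
       (auto simp: lookup_sum lookup_component when_def in_keys_iff)
qed

lemma homogeneous_partial_deriv:
  fixes H :: "'k::comm_ring_1 ternary"
  assumes "homogeneous n H"
  shows "homogeneous (n - 1) (partial_deriv i H)"
proof -
  have "homogeneous (n - 1) (partial_deriv i (component n H))"
  proof (induction H rule: ternary_induct)
    case (monomial m c)
    have "monomial_degree (m - single i 1) = monomial_degree m - 1"
      if "lookup m i \<noteq> 0"
    proof -
      have "m = (m - single i 1) + single i 1"
        using that by (intro poly_mapping_eqI) (auto simp: lookup_add lookup_minus lookup_single when_def)
      then have "monomial_degree m = monomial_degree (m - single i 1) + 1"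
        using monomial_degree_unit[of i]
        by (metis (mono_tags, lifting) lookup_add sum.cong sum.distrib)
      then show ?thesis by simp
    qed
    then show ?case
      by (cases "lookup m i = 0")
         (auto simp: component_single partial_deriv_single intro!: homogeneous_single)
  next
    case (add A B)
    then show ?case by (simp add: component_add partial_deriv_add homogeneous_add)
  qed
  then show ?thesis using assms by (simp add: homogeneous_iff_component)
qed

lemma euler_formula:
  fixes H :: "'k::comm_ring_1 ternary"
  assumes "homogeneous n H"
  shows "(\<Sum>i\<in>UNIV. variable i * partial_deriv i H) = of_nat n * H"
proof -
  have "(\<Sum>i\<in>UNIV. variable i * partial_deriv i (component n H)) = of_nat n * component n H"
  proof (induction H rule: ternary_induct)
    case (monomial m c)
    have "variable i * partial_deriv i (single m c) =
        single m (of_nat (lookup m i) * c)" for i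
    proof (cases "lookup m i = 0")
      case False
      then have "single i 1 + (m - single i 1) = m"
        by (intro poly_mapping_eqI) (auto simp: lookup_add lookup_minus lookup_single when_def)
      then show ?thesis unfolding variable_def partial_deriv_single mult_single by simp
    qed (simp add: partial_deriv_single)
    moreover have "(\<Sum>i\<in>UNIV. single m (of_nat (lookup m i) * c)) =
        of_nat (monomial_degree m) * single m c"
    proof -
      have "(\<Sum>i\<in>UNIV. single m (of_nat (lookup m i) * c)) =
         single m (of_nat (monomial_degree m) * c)"
        by (simp add: sum_3[of _ 0] single_add[symmetric] algebra_simps)
      also have "\<dots> = single 0 (of_nat (monomial_degree m)) * single m c"
        by (simp add: mult_single)
      finally show ?thesis by (simp only: single_of_nat)
    qed
    ultimately show ?case by (auto simp add: component_single)
  next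
    case (add A B)
    then show ?case by (simp add: component_add partial_deriv_add algebra_simps sum.distrib)
  qed
  then show ?thesis using assms by (simp add: homogeneous_iff_component)
qed


subsection \<open>Factors of forms\<close>

lemma monom_factor_is_monom:
  fixes p q :: "'a::idom poly"
  assumes "p * q = monom c n" "c \<noteq> 0"
  shows "\<exists>k a. p = monom a k"
  using assms
proof (induction n arbitrary: p q)
  case 0
  then have "degree (p * q) = 0" by (simp add: degree_monom_eq)
  moreover have "p \<noteq> 0" "q \<noteq> 0" using 0 by auto
  ultimately have "degree p = 0" by (simp add: degree_mult_eq)
  then have "p = monom (coeff p 0) 0" by (simp add: monom_0 degree_0_id)
  then show ?case by blast
next
  case (Suc n)
  have "coeff p 0 * coeff q 0 = 0"
    using arg_cong[OF Suc.prems(1), of "\<lambda>f. coeff f 0"] by (simp add: coeff_mult)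
  then consider "coeff p 0 = 0" | "coeff q 0 = 0" by auto
  then show ?case
  proof cases
    case 1
    then obtain p' where p: "p = pCons 0 p'" by (cases p) auto
    with Suc.prems have "p' * q = monom c n" by (simp add: monom_Suc)
    then obtain k a where "p' = monom a k" using Suc.IH Suc.prems by blast
    then show ?thesis using p by (metis monom_Suc)
  next
    case 2
    then obtain q' where "q = pCons 0 q'" by (cases q) auto
    with Suc.prems have "p * q' = monom c n" by (simp add: monom_Suc)
    then show ?thesis using Suc.IH Suc.prems by blast
  qed
qed

text \<open>
  The substitution \<open>x\<^sub>i \<mapsto> t x\<^sub>i\<close> turns a polynomial into the generating polynomial of its components,
  so a form becomes a monomial in \<open>t\<close>; and factors of a monomial over a domain are monomials.
\<close>

lemma homogeneous_factor:
  fixes A B :: "'k::idom ternary"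
  assumes "homogeneous n (A * B)" "A * B \<noteq> 0"
  shows "\<exists>k. homogeneous k A"
proof -
  define h where "h = ternary_eval (\<lambda>c :: 'k. [:scalar c:]) (\<lambda>i. monom (variable i) 1)"
  interpret h: comm_ring_hom h
    unfolding h_def
    by (rule ternary_eval_hom, unfold_locales) (simp_all add: single_add mult_single ac_simps)
  have h_single: "h (single m c) = monom (single m c) (monomial_degree m)"
    for m c
  proof -
    have v: "(monom (variable i :: 'k ternary) 1) ^ k = monom (single (single i k) 1) k"
      for i k
    proof (induction k)
      case (Suc k)
      have "single i 1 + single i k = single i (Suc k)"
        by (simp flip: single_add)
      then show ?case
        unfolding power_Suc Suc.IH unfolding mult_monom variable_def mult_single by simp
    qed (simp add: monom_0)
    have m: "single 0 (lookup m 0) + single (0 + 1) (lookup m (0 + 1)) +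
        single (0 + 2) (lookup m (0 + 2)) = m"
      by (rule poly_mapping_eqI) (use exhaust_3[of _ 0] in \<open>auto simp: lookup_add lookup_single when_def\<close>)
    have "h (single m c) =
        [:scalar c:] * (\<Prod>i\<in>UNIV. monom (variable i) 1 ^ lookup m i)"
      unfolding h_def by (rule ternary_eval_single) simp
    also have "\<dots> = monom (single m c) (monomial_degree m)"
      unfolding UNIV_3[of 0] v using m
      by (simp add: mult_monom mult_single smult_monom add.assoc)
    finally show ?thesis .
  qed
  have coeff_h: "coeff (h H) j = component j H" for H j
    by (induction H rule: ternary_induct) (simp_all add: h_single component_single h.hom_add component_add)
  have "h (A * B) = monom (A * B) n"
    by (rule poly_eqI) (simp add: coeff_h component_homogeneous[OF assms(1)])
  then have "h A * h B = monom (A * B) n" by (simp add: h.hom_mult)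
  from monom_factor_is_monom[OF this assms(2)] obtain k a where "h A = monom a k" by blast
  then have "component j A = 0" if "j \<noteq> k" for j
    using that by (simp flip: coeff_h)
  then have "lookup A m = 0" if "monomial_degree m \<noteq> k" for m
    using that lookup_component[of "monomial_degree m" A m] by simp
  then show ?thesis by (auto simp: homogeneous_iff_lookup)
qed

lemma homogeneous_degree_unique:
  "homogeneous n H \<Longrightarrow> homogeneous k H \<Longrightarrow> H \<noteq> 0 \<Longrightarrow> n = k"
  for H :: "'k::comm_ring_1 ternary"
  by (metis component_homogeneous)

lemma homogeneous_dvd:
  fixes A H :: "'k::idom ternary"
  assumes "A dvd H" "homogeneous n H" "H \<noteq> 0"
  obtains k B where "k \<le> n" "homogeneous k A" "homogeneous (n - k) B" "H = A * B"
proof -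
  obtain B where B: "H = A * B" using assms(1) by blast
  obtain k where k: "homogeneous k A" using homogeneous_factor assms B by metis
  obtain l where l: "homogeneous l B" using homogeneous_factor[of n B A] assms B by (metis mult.commute)
  have "n = k + l"
    using homogeneous_degree_unique[of n H "k + l"] homogeneous_mult[OF k l] assms B by simp
  show ?thesis
    by (rule that[of k B]) (use B k l \<open>n = k + l\<close> in simp_all)
qed

lemma homogeneous_dvd_small_degree:
  fixes A H :: "'k::idom ternary"
  assumes "A dvd H" "homogeneous n H" "homogeneous k A" "n < k"
  shows "H = 0"
proof (rule ccontr)
  assume "H \<noteq> 0"
  then obtain j where j: "j \<le> n" "homogeneous j A" using homogeneous_dvd assms by metis
  moreover have "A \<noteq> 0" using \<open>H \<noteq> 0\<close> assms(1) by auto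
  ultimately have "k = j" using homogeneous_degree_unique assms(3) by blast
  then show False using j assms(4) by simp
qed

lemma homogeneous_0_scalar:
  assumes "homogeneous 0 H"
  shows "H = scalar (lookup H 0)"
proof (rule poly_mapping_eqI)
  fix m
  have "m = 0" if "monomial_degree m = 0" using that by (intro poly_mapping_eqI) simp
  then show "lookup H m = lookup (scalar (lookup H 0)) m"
    using assms by (auto simp: homogeneous_iff_lookup lookup_single when_def)
qed

lemma scalar_unit: "c \<noteq> 0 \<Longrightarrow> scalar (c :: 'k::field) dvd 1"
  by (rule dvdI[of _ _ "scalar (inverse c)"]) (simp add: mult_single)

lemma form_unit_iff:
  fixes A :: "'k::field ternary"
  assumes "homogeneous n A" "A \<noteq> 0"
  shows "A dvd 1 \<longleftrightarrow> n = 0"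
proof
  assume "A dvd 1"
  then obtain k where k: "k \<le> 0" "homogeneous k A" by (rule homogeneous_dvd[where n = 0]) simp_all
  then have "n = k" using homogeneous_degree_unique assms by blast
  then show "n = 0" using k by simp
next
  assume "n = 0"
  then have "A = scalar (lookup A 0)" using homogeneous_0_scalar assms by blast
  moreover have "lookup A 0 \<noteq> 0"
  proof
    assume "lookup A 0 = 0"
    with calculation have "A = scalar 0" by metis
    then show False using assms(2) by simp
  qed
  ultimately show "A dvd 1" using scalar_unit by metis
qed


section \<open>Linear dependence and binary forms\<close>

lemma linear_dependence:
  fixes v :: "'i \<Rightarrow> 'm \<Rightarrow> 'k::field"
  assumes "finite M" "finite I" "card M < card I"
  shows "\<exists>c. (\<exists>i\<in>I. c i \<noteq> 0) \<and> (\<forall>m\<in>M. (\<Sum>i\<in>I. c i * v i m) = 0)"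
  using assms
proof (induction M arbitrary: I v rule: finite_induct)
  case empty
  then obtain i where "i \<in> I" by fastforce
  then show ?case by (intro exI[of _ "\<lambda>_. 1"]) auto
next
  case (insert m M)
  show ?case
  proof (cases "\<forall>i\<in>I. v i m = 0")
    case True
    moreover have "card M < card I" using insert.prems insert.hyps by simp
    then obtain c where "\<exists>i\<in>I. c i \<noteq> 0" "\<forall>m\<in>M. (\<Sum>i\<in>I. c i * v i m) = 0"
      using insert.IH[of I v] insert.prems by blast
    ultimately show ?thesis by (intro exI[of _ c]) simp
  next
    case False
    then obtain j where j: "j \<in> I" "v j m \<noteq> 0" by blast
    define w where "w i n = v i n - v i m / v j m * v j n" for i n
    have "card M < card (I - {j})" using insert.prems insert.hyps j by simp
    then obtain c where c: "\<exists>i\<in>I - {j}. c i \<noteq> 0"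
        "\<forall>n\<in>M. (\<Sum>i\<in>I - {j}. c i * w i n) = 0"
      using insert.IH[of "I - {j}" w] insert.prems by blast
    define s where "s = - (\<Sum>i\<in>I - {j}. c i * (v i m / v j m))"
    define e where "e = c(j := s)"
    have e: "(\<Sum>i\<in>I. e i * v i n) = (\<Sum>i\<in>I - {j}. c i * w i n)" for n
    proof -
      have "(\<Sum>i\<in>I. e i * v i n) = s * v j n + (\<Sum>i\<in>I - {j}. c i * v i n)"
        using j insert.prems by (simp add: sum.remove[of I j] e_def)
      also have "\<dots> = (\<Sum>i\<in>I - {j}. c i * w i n)"
        by (simp add: w_def s_def sum_distrib_right algebra_simps sum_subtractf sum_distrib_left)
      finally show ?thesis .
    qed
    have "(\<Sum>i\<in>I - {j}. c i * w i m) = 0" using j by (simp add: w_def)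
    then have "\<forall>n\<in>insert m M. (\<Sum>i\<in>I. e i * v i n) = 0" using c e by simp
    moreover have "\<exists>i\<in>I. e i \<noteq> 0" using c by (auto simp: e_def)
    ultimately show ?thesis by blast
  qed
qed

lemma monomial_degree_add: "monomial_degree (m + m') = monomial_degree m + monomial_degree m'"
  by (simp add: lookup_add sum.distrib)

lemma finite_monomials: "finite {m :: 3 \<Rightarrow>\<^sub>0 nat. monomial_degree m = n}"
proof (rule finite_subset)
  let ?f = "\<lambda>(a, b, c). single (0::3) a + single 1 b +
    single 2 (c::nat)"
  show "{m. monomial_degree m = n} \<subseteq> ?f ` ({..n} \<times> {..n} \<times> {..n})"
  proof
    fix m :: "3 \<Rightarrow>\<^sub>0 nat" assume "m \<in> {m. monomial_degree m = n}"
    then have "lookup m 0 + lookup m 1 + lookup m 2 = n"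
      by (simp add: sum_3[of _ 0])
    moreover have "m = ?f (lookup m 0, lookup m 1, lookup m 2)"
      by (rule poly_mapping_eqI)
         (use exhaust_3[of _ 0] in \<open>auto simp: lookup_add lookup_single when_def\<close>)
    ultimately show "m \<in> ?f ` ({..n} \<times> {..n} \<times> {..n})"
      by (intro rev_image_eqI[of "(lookup m 0, lookup m 1, lookup m 2)"])
         auto
  qed
qed simp

lemma dependent_forms:
  fixes f :: "'i \<Rightarrow> 'k::field ternary"
  assumes "finite I" "card {m :: 3 \<Rightarrow>\<^sub>0 nat. monomial_degree m = n} < card I"
    and hom: "\<And>i. i \<in> I \<Longrightarrow> homogeneous n (f i)"
  obtains c where "\<exists>i\<in>I. c i \<noteq> 0" "(\<Sum>i\<in>I. scalar (c i) * f i) = 0"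
proof -
  obtain c where c: "\<exists>i\<in>I. c i \<noteq> 0"
      "\<forall>m\<in>{m. monomial_degree m = n}. (\<Sum>i\<in>I. c i * lookup (f i) m) = 0"
    using linear_dependence[OF finite_monomials assms(1,2), of "\<lambda>i. lookup (f i)"]
    by (elim exE conjE)
  have lookup: "lookup (scalar a * A) m = a * lookup A m"
    for a :: 'k and A :: "'k ternary" and m
    by (induction A rule: ternary_induct)
       (auto simp: mult_single lookup_single lookup_add when_def algebra_simps)
  have "(\<Sum>i\<in>I. scalar (c i) * f i) = 0"
  proof (rule poly_mapping_eqI)
    fix m
    have "(\<Sum>i\<in>I. c i * lookup (f i) m) = 0"
    proof (cases "monomial_degree m = n")
      case False
      then show ?thesis using hom by (intro sum.neutral) (auto simp: homogeneous_iff_lookup)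
    qed (use c in simp)
    then show "lookup (\<Sum>i\<in>I. scalar (c i) * f i) m = lookup 0 m"
      by (simp add: lookup_sum lookup)
  qed
  with c that show ?thesis by blast
qed

lemma scalar_mult: "scalar (a * b) = scalar a * scalar b"
  by (simp add: mult_single)

lemma scalar_cancel: "c \<noteq> 0 \<Longrightarrow> scalar (inverse c) * (scalar c * H) = H" for c :: "'k::field"
  by (simp add: mult_single flip: mult.assoc)

text \<open>
  The value at \<open>(u, v)\<close> of the binary form of degree \<open>D\<close> whose dehomogenization is \<open>f\<close>.
\<close>

definition homogenized :: "nat \<Rightarrow> 'k::comm_ring_1 poly \<Rightarrow> 'k ternary \<Rightarrow> 'k ternary \<Rightarrow> 'k ternary" where
  "homogenized D f u v = (\<Sum>n\<le>D. scalar (coeff f n) * u ^ (D - n) * v ^ n)"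

lemma homogenized_mult_linear:
  assumes "degree f \<le> D"
  shows "homogenized (Suc D) ([:- c, 1:] * f) u v = (v - scalar c * u) * homogenized D f u v"
proof -
  have coeff: "coeff ([:- c, 1:] * f) n = (case n of 0 \<Rightarrow> 0 | Suc k \<Rightarrow> coeff f k) - c * coeff f n" for n
    by (cases n) (simp_all)
  have "homogenized (Suc D) ([:- c, 1:] * f) u v =
     (\<Sum>n\<le>Suc D. scalar (case n of 0 \<Rightarrow> 0 | Suc k \<Rightarrow> coeff f k) * u ^ (Suc D - n) * v ^ n) -
     (\<Sum>n\<le>Suc D. scalar (c * coeff f n) * u ^ (Suc D - n) * v ^ n)"
    unfolding homogenized_def coeff by (simp add: single_diff algebra_simps sum_subtractf)
  also have "(\<Sum>n\<le>Suc D. scalar (case n of 0 \<Rightarrow> 0 | Suc k \<Rightarrow> coeff f k) * u ^ (Suc D - n) * v ^ n) =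
      v * homogenized D f u v"
    by (subst sum.atMost_Suc_shift) (simp add: homogenized_def sum_distrib_left algebra_simps)
  also have "(\<Sum>n\<le>Suc D. scalar (c * coeff f n) * u ^ (Suc D - n) * v ^ n) =
      scalar c * u * homogenized D f u v"
  proof -
    have "coeff f (Suc D) = 0" using assms by (simp add: coeff_eq_0)
    then show ?thesis
      by (simp add: homogenized_def sum_distrib_left Suc_diff_le scalar_mult mult_ac)
  qed
  finally show ?thesis by (simp add: algebra_simps)
qed

text \<open>
  Over an algebraically closed field a binary form splits into linear factors.  Hence a prime that
  contains the value of a non-zero binary form at \<open>(u, v)\<close>, but not \<open>u\<close>, contains some \<open>v - c u\<close>.
  Primality is demanded for elements of \<open>G\<close> only, so that \<open>I\<close> may be a graded ideal whose
  primality is known for forms.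
\<close>

lemma binary_form_in_prime:
  fixes u v :: "'k::alg_closed_field ternary"
  assumes ideal: "\<And>x r. x \<in> I \<Longrightarrow> r * x \<in> I"
    and prime: "\<And>x y. G x \<Longrightarrow> G y \<Longrightarrow> x * y \<in> I \<Longrightarrow> x \<in> I \<or> y \<in> I"
    and G: "\<And>D f. G (homogenized D f u v)" "\<And>c. G (v - scalar c * u)" "\<And>n. G (u ^ n)"
    and u: "u \<notin> I"
    and f: "f \<noteq> 0" "degree f \<le> D" "homogenized D f u v \<in> I"
  shows "\<exists>c. v - scalar c * u \<in> I"
  using f
proof (induction D arbitrary: f)
  case 0
  then obtain c where "f = [:c:]" "c \<noteq> 0" by (metis degree_eq_zeroE le_zero_eq pCons_0_0)
  with 0 have "scalar c \<in> I" by (simp add: homogenized_def)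
  then have "u * (scalar (inverse c) * scalar c) \<in> I" by (intro ideal)
  then show ?case using u \<open>c \<noteq> 0\<close> by (simp add: mult_single)
next
  case (Suc D)
  show ?case
  proof (cases "degree f = 0")
    case True
    then obtain c where c: "f = [:c:]" "c \<noteq> 0" using Suc.prems by (metis degree_eq_zeroE pCons_0_0)
    have "homogenized (Suc D) f u v = scalar c * u ^ Suc D"
      unfolding homogenized_def c(1) by (subst sum.atMost_Suc_shift) simp
    then have "scalar (inverse c) * (scalar c * u ^ Suc D) \<in> I"
      using Suc.prems(3) by (metis ideal)
    then have "u ^ Suc D \<in> I" using c by (simp add: mult_single flip: mult.assoc)
    moreover have "u ^ n \<notin> I" for n
    proof (induction n)
      case 0
      then show ?case using ideal[of 1 u] u by auto
    next
      case (Suc n)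
      then show ?case using prime[of u "u ^ n"] G(3)[of 1] G(3)[of n] u by auto
    qed
    ultimately show ?thesis by blast
  next
    case False
    then obtain c where "poly f c = 0" using alg_closed_imp_poly_has_root[of f] by auto
    then obtain g where g: "f = [:- c, 1:] * g" by (metis dvdE poly_eq_0_iff_dvd)
    then have "g \<noteq> 0" using Suc.prems by auto
    then have "degree f = Suc (degree g)" unfolding g by (subst degree_mult_eq) simp_all
    then have "degree g \<le> D" using Suc.prems by simp
    from homogenized_mult_linear[OF this] Suc.prems(3)
    have "(v - scalar c * u) * homogenized D g u v \<in> I" by (simp add: g)
    then have "v - scalar c * u \<in> I \<or> homogenized D g u v \<in> I" by (intro prime G)
    then show ?thesis using Suc.IH[of g] \<open>g \<noteq> 0\<close> \<open>degree g \<le> D\<close> by blast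
  qed
qed


section \<open>The projective Nullstellensatz\<close>

definition homogeneous_ideal :: "'k::comm_ring_1 ternary set \<Rightarrow> bool" where
  "homogeneous_ideal I \<longleftrightarrow> 0 \<in> I \<and> (\<forall>x\<in>I. \<forall>y\<in>I. x + y \<in> I) \<and> (\<forall>x\<in>I. \<forall>r. r * x \<in> I) \<and>
     (\<forall>x\<in>I. \<forall>n. component n x \<in> I)"

lemma homogeneous_idealD:
  assumes "homogeneous_ideal I"
  shows "0 \<in> I" "x \<in> I \<Longrightarrow> y \<in> I \<Longrightarrow> x + y \<in> I" "x \<in> I \<Longrightarrow> r * x \<in> I" "x \<in> I \<Longrightarrow> component n x \<in> I"
    "x \<in> I \<Longrightarrow> y \<in> I \<Longrightarrow> x - y \<in> I"
proof -
  show "0 \<in> I" "x \<in> I \<Longrightarrow> y \<in> I \<Longrightarrow> x + y \<in> I" "x \<in> I \<Longrightarrow> r * x \<in> I" "x \<in> I \<Longrightarrow> component n x \<in> I"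
    for x y r n
    using assms by (auto simp: homogeneous_ideal_def)
  from this(2)[of x "- 1 * y"] this(3)[of y "- 1"]
  show "x \<in> I \<Longrightarrow> y \<in> I \<Longrightarrow> x - y \<in> I" by simp
qed

definition contains_degree :: "nat \<Rightarrow> 'k::comm_ring_1 ternary set \<Rightarrow> bool" where
  "contains_degree n I \<longleftrightarrow> (\<forall>H. homogeneous n H \<longrightarrow> H \<in> I)"

lemma ideal_sum_mem:
  assumes "homogeneous_ideal I" "\<And>x. x \<in> Y \<Longrightarrow> f x \<in> I"
  shows "(\<Sum>x\<in>Y. f x) \<in> I"
  using assms(2)
  by (induction Y rule: infinite_finite_induct) (auto intro: homogeneous_idealD[OF assms(1)])

lemma ternary_as_combination:
  "H = (\<Sum>m\<in>Poly_Mapping.keys H. scalar (lookup H m) * single m 1)"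
  using ternary_as_sum[of H] by (simp add: mult_single)

lemma contains_degree_iff_monomials:
  assumes "homogeneous_ideal I"
  shows "contains_degree n I \<longleftrightarrow> (\<forall>m. monomial_degree m = n \<longrightarrow> single m 1 \<in> I)"
proof
  assume "contains_degree n I"
  then show "\<forall>m. monomial_degree m = n \<longrightarrow> single m 1 \<in> I"
    by (auto simp: contains_degree_def intro: homogeneous_single)
next
  assume *: "\<forall>m. monomial_degree m = n \<longrightarrow> single m 1 \<in> I"
  show "contains_degree n I"
    unfolding contains_degree_def
  proof (intro allI impI)
    fix H :: "'a ternary" assume H: "homogeneous n H"
    have "(\<Sum>m\<in>Poly_Mapping.keys H. scalar (lookup H m) * single m 1) \<in> I"
      by (rule ideal_sum_mem[OF assms])
         (use H * in \<open>auto simp: homogeneous_def intro!: homogeneous_idealD(3)[OF assms]\<close>)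
    also have "(\<Sum>m\<in>Poly_Mapping.keys H. scalar (lookup H m) * single m 1) = H"
      by (rule ternary_as_combination[symmetric])
    finally show "H \<in> I" .
  qed
qed

lemma monomial_split_variable:
  assumes "monomial_degree m = Suc n"
  obtains i m' where "m = single i 1 + m'" "monomial_degree m' = n"
proof -
  obtain i where i: "lookup m i \<noteq> 0"
    using assms by (metis nat.distinct(1) sum.neutral)
  have m: "m = single i 1 + (m - single i 1)"
    using i by (intro poly_mapping_eqI) (auto simp: lookup_add lookup_minus lookup_single when_def)
  then have "monomial_degree m = 1 + monomial_degree (m - single i 1)"
    by (metis monomial_degree_add monomial_degree_unit)
  with that m assms show ?thesis by simp
qed

lemma monomial_split:
  assumes "monomial_degree m = a + b"
  obtains m1 m2 where "m = m1 + m2" "monomial_degree m1 = a" "monomial_degree m2 = b"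
  using assms
proof (induction a arbitrary: m thesis)
  case 0
  then show ?case using "0.prems"(1)[of 0 m] by simp
next
  case (Suc a)
  obtain i m' where m: "m = single i 1 + m'" "monomial_degree m' = a + b"
    using monomial_split_variable[of m "a + b"] Suc.prems by auto
  obtain m1 m2 where "m' = m1 + m2" "monomial_degree m1 = a" "monomial_degree m2 = b"
    using Suc.IH[OF _ m(2)] by blast
  then show ?case
    using Suc.prems(1)[of "single i 1 + m1" m2] m
    by (metis add.assoc monomial_degree_add monomial_degree_unit plus_1_eq_Suc)
qed

lemma contains_degree_add:
  assumes I: "homogeneous_ideal I" and n: "contains_degree n I"
  shows "contains_degree (n + k) I"
  unfolding contains_degree_iff_monomials[OF I]
proof (intro allI impI)
  fix m :: "3 \<Rightarrow>\<^sub>0 nat" assume "monomial_degree m = n + k"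
  then obtain m1 m2 where m: "m = m1 + m2" "monomial_degree m1 = n" "monomial_degree m2 = k"
    by (rule monomial_split)
  then have "single m2 1 * single m1 1 \<in> I"
    using n by (intro homogeneous_idealD(3)[OF I]) (auto simp: contains_degree_iff_monomials[OF I])
  then show "single m 1 \<in> I" by (simp add: m mult_single add.commute)
qed

definition add_generator :: "'k::comm_ring_1 ternary set \<Rightarrow> 'k ternary \<Rightarrow> 'k ternary set" where
  "add_generator I f = {q + h * f |q h. q \<in> I}"

lemma homogeneous_ideal_add_generator:
  assumes I: "homogeneous_ideal I" and f: "homogeneous k f"
  shows "homogeneous_ideal (add_generator I f)" "I \<subseteq> add_generator I f" "f \<in> add_generator I f"
proof -
  note D = homogeneous_idealD[OF I]
  have mem: "q + h * f \<in> add_generator I f" if "q \<in> I" for q h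
    using that by (auto simp: add_generator_def)
  show "I \<subseteq> add_generator I f" using mem[of _ 0] by auto
  show "f \<in> add_generator I f" using mem[of 0 1] D(1) by simp
  show "homogeneous_ideal (add_generator I f)"
    unfolding homogeneous_ideal_def
  proof (intro conjI ballI allI)
    show "0 \<in> add_generator I f" using mem[of 0 0] D(1) by simp
  next
    fix x y assume "x \<in> add_generator I f" "y \<in> add_generator I f"
    then obtain q h q' h' where "x = q + h * f" "y = q' + h' * f" "q \<in> I" "q' \<in> I"
      by (auto simp: add_generator_def)
    then show "x + y \<in> add_generator I f"
      using mem[of "q + q'" "h + h'"] D(2) by (simp add: algebra_simps)
  next
    fix x r assume "x \<in> add_generator I f"
    then obtain q h where "x = q + h * f" "q \<in> I" by (auto simp: add_generator_def)
    then show "r * x \<in> add_generator I f"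
      using mem[of "r * q" "r * h"] D(3) by (simp add: algebra_simps)
  next
    fix x n assume "x \<in> add_generator I f"
    then obtain q h where "x = q + h * f" "q \<in> I" by (auto simp: add_generator_def)
    then show "component n x \<in> add_generator I f"
      using mem[of "component n q" "if k \<le> n then component (n - k) h else 0"] D(4)
      by (simp add: component_add component_mult[OF f] split: if_splits)
  qed
qed

text \<open>
  Replacing each \<open>x\<^sub>i\<close> by \<open>a\<^sub>i l\<close> preserves the class modulo \<open>I\<close>, and turns a form of degree \<open>n\<close> into
  \<open>f(a) l\<^sup>n\<close>.  This serves twice: for the ideal of a zero in the projective Nullstellensatz, and for
  the ideal of a node.
\<close>

lemma form_congruent_value:
  assumes I: "homogeneous_ideal I" and a: "\<And>i. variable i - scalar (a i) * l \<in> I"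
    and f: "homogeneous n f"
  shows "f - scalar (eval_at f a) * l ^ n \<in> I"
proof -
  note D = homogeneous_idealD[OF I]
  have monomial: "single m 1 - scalar (eval_at (single m 1) a) * l ^ n \<in> I"
    if "monomial_degree m = n" for m n
    using that
  proof (induction n arbitrary: m)
    case 0
    then have "m = 0" by (intro poly_mapping_eqI) simp
    then show ?case using D(1) by simp
  next
    case (Suc n)
    then obtain i m' where m: "m = single i 1 + m'" "monomial_degree m' = n"
      using monomial_split_variable by blast
    define M where "M = (single m' 1 :: 'a ternary)"
    have "single m 1 = variable i * M"
      by (simp add: variable_def m M_def mult_single)
    then have "single m 1 - scalar (eval_at (single m 1) a) * l ^ Suc n =
        M * (variable i - scalar (a i) * l) +
        scalar (a i) * l * (M - scalar (eval_at M a) * l ^ n)"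
      by (simp add: eval_at.hom_mult scalar_mult algebra_simps)
    also have "\<dots> \<in> I" by (intro D(2,3) a Suc.IH[OF m(2), folded M_def])
    finally show ?case .
  qed
  let ?c = "lookup f"
  have f_sum: "f = (\<Sum>m\<in>Poly_Mapping.keys f. scalar (?c m) * single m 1)"
    by (rule ternary_as_combination)
  then have "eval_at f a = eval_at (\<Sum>m\<in>Poly_Mapping.keys f. scalar (?c m) * single m 1) a"
    by (rule arg_cong)
  also have "\<dots> = (\<Sum>m\<in>Poly_Mapping.keys f. ?c m * eval_at (single m 1) a)"
    by (simp add: eval_at.hom_sum eval_at.hom_mult)
  finally have val: "eval_at f a = (\<Sum>m\<in>Poly_Mapping.keys f. ?c m * eval_at (single m 1) a)" .
  have scalar_sum: "scalar (\<Sum>m\<in>Y. g m) = (\<Sum>m\<in>Y. scalar (g m))" for Y and g :: "_ \<Rightarrow> 'a"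
    by (induction Y rule: infinite_finite_induct) (simp_all add: single_add)
  have "f - scalar (eval_at f a) * l ^ n = (\<Sum>m\<in>Poly_Mapping.keys f. scalar (?c m) *
      (single m 1 - scalar (eval_at (single m 1) a) * l ^ n))"
    unfolding val scalar_sum
    by (subst (1) f_sum)
       (simp add: sum_distrib_right sum_subtractf right_diff_distrib
         scalar_mult mult.assoc)
  also have "\<dots> \<in> I"
    using f by (intro ideal_sum_mem[OF I] D(3) monomial) (simp add: homogeneous_def)
  finally show ?thesis .
qed

text \<open>
  Among the homogeneous ideals that contain \<open>Q\<close> but no power of the irrelevant ideal, take a
  maximal one, \<open>M\<close>.  It is prime on forms.  For a variable \<open>l \<notin> M\<close>, maximality gives
  \<open>S\<^sub>K\<^sub>+\<^sub>1 \<subseteq> M + l S\<^sub>K\<close> for some \<open>K\<close>, so modulo \<open>M\<close> every \<open>l'\<^sup>K\<^sup>+\<^sup>j\<close> with \<open>l'\<close> linear is \<open>l\<^sup>j\<close> times an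
  element of the finite-dimensional space \<open>S\<^sub>K\<close>.  A linear dependence between these elements is a
  binary form in \<open>l, l'\<close> that lies in \<open>M\<close>, so \<open>l' - c l \<in> M\<close> for some \<open>c\<close>.  The constants \<open>c\<close> for the
  three variables \<open>l'\<close> are the coordinates of a zero of \<open>M\<close>, hence of \<open>Q\<close>.
\<close>

theorem projective_nullstellensatz:
  fixes Q :: "'k::alg_closed_field ternary set"
  assumes Q: "homogeneous_ideal Q"
    and no_zero: "\<And>a. a \<noteq> (\<lambda>_. 0) \<Longrightarrow> \<exists>f\<in>Q. eval_at f a \<noteq> 0"
  shows "\<exists>n. contains_degree n Q"
proof (rule ccontr)
  assume none: "\<nexists>n. contains_degree n Q"
  define A where "A = {I. homogeneous_ideal I \<and> Q \<subseteq> I \<and> (\<forall>n. \<not> contains_degree n I)}"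
  have "\<Union>C \<in> A" if "C \<noteq> {}" "subset.chain A C" for C
  proof -
    have C: "\<And>I. I \<in> C \<Longrightarrow> I \<in> A" using that by (auto simp: subset.chain_def)
    have two: "\<exists>I\<in>C. x \<in> I \<and> y \<in> I" if "x \<in> \<Union>C" "y \<in> \<Union>C" for x y
      using that \<open>subset.chain A C\<close> unfolding subset_chain_def by blast
    have "homogeneous_ideal (\<Union>C)"
      unfolding homogeneous_ideal_def
    proof (intro conjI ballI allI)
      show "0 \<in> \<Union>C" using C \<open>C \<noteq> {}\<close> by (auto simp: A_def homogeneous_ideal_def)
    next
      fix x y assume "x \<in> \<Union>C" "y \<in> \<Union>C"
      then obtain I where I: "I \<in> C" "x \<in> I" "y \<in> I" using two by blast
      then have "x + y \<in> I" using C[OF I(1)] by (auto simp: A_def homogeneous_ideal_def)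
      then show "x + y \<in> \<Union>C" using I(1) by blast
    next
      fix x r assume "x \<in> \<Union>C"
      then obtain I where I: "I \<in> C" "x \<in> I" by blast
      then have "r * x \<in> I" using C[OF I(1)] by (auto simp: A_def homogeneous_ideal_def)
      then show "r * x \<in> \<Union>C" using I(1) by blast
    next
      fix x n assume "x \<in> \<Union>C"
      then obtain I where I: "I \<in> C" "x \<in> I" by blast
      then have "component n x \<in> I" using C[OF I(1)] by (auto simp: A_def homogeneous_ideal_def)
      then show "component n x \<in> \<Union>C" using I(1) by blast
    qed
    moreover have "\<not> contains_degree n (\<Union>C)" for n
    proof
      let ?M = "(\<lambda>m. single m (1::'k)) ` {m. monomial_degree m = n}"
      assume "contains_degree n (\<Union>C)"
      then have sub: "?M \<subseteq> \<Union>C" by (auto simp: contains_degree_def intro!: homogeneous_single)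
      obtain I where "I \<in> C" "?M \<subseteq> I"
        using finite_subset_Union_chain[OF _ sub \<open>C \<noteq> {}\<close> \<open>subset.chain A C\<close>] finite_monomials by blast
      then have "contains_degree n I"
        using C by (subst contains_degree_iff_monomials) (auto simp: A_def)
      then show False using C \<open>I \<in> C\<close> by (auto simp: A_def)
    qed
    moreover have "Q \<subseteq> \<Union>C" using C \<open>C \<noteq> {}\<close> unfolding A_def by blast
    ultimately show ?thesis by (simp add: A_def)
  qed
  moreover have "Q \<in> A" using Q none by (simp add: A_def)
  then have "A \<noteq> {}" by blast
  ultimately obtain M where M: "M \<in> A" and M_max: "\<And>I. I \<in> A \<Longrightarrow> M \<subseteq> I \<Longrightarrow> I = M"
    using subset_Zorn_nonempty[of A] by blast
  have MI: "homogeneous_ideal M" and QM: "Q \<subseteq> M" and M_none: "\<And>n. \<not> contains_degree n M"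
    using M by (auto simp: A_def)
  note D = homogeneous_idealD[OF MI]

  have bigger: "\<exists>n. contains_degree n (add_generator M f)" if "homogeneous k f" "f \<notin> M" for k f
    using homogeneous_ideal_add_generator[OF MI that(1)] that(2) M_max[of "add_generator M f"] QM
    by (auto simp: A_def)
  have prime: "f \<in> M \<or> g \<in> M" if fg: "homogeneous k f" "homogeneous j g" "f * g \<in> M" for k j f g
  proof (rule ccontr)
    assume "\<not> ?thesis"
    then obtain n n' where n: "contains_degree n (add_generator M f)" "contains_degree n' (add_generator M g)"
      using bigger fg by blast
    have "contains_degree (n + n') M"
      unfolding contains_degree_iff_monomials[OF MI]
    proof (intro allI impI)
      fix m :: "3 \<Rightarrow>\<^sub>0 nat" assume "monomial_degree m = n + n'"
      then obtain m1 m2 where m: "m = m1 + m2" "monomial_degree m1 = n" "monomial_degree m2 = n'"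
        by (rule monomial_split)
      then have "single m1 1 \<in> add_generator M f" "single m2 1 \<in> add_generator M g"
        using n by (auto simp: contains_degree_def intro!: homogeneous_single)
      then obtain q h q' h' where *: "single m1 1 = q + h * f" "q \<in> M"
          "single m2 1 = q' + h' * g" "q' \<in> M"
        by (auto simp: add_generator_def)
      have "single m 1 = single m1 1 * single m2 (1::'k)"
        by (simp add: m mult_single)
      also have "\<dots> = single m2 1 * q + h * f * q' + h * h' * (f * g)"
        by (simp add: * algebra_simps)
      also have "\<dots> \<in> M" by (intro D(2,3) * fg)
      finally show "single m 1 \<in> M" .
    qed
    then show False using M_none by blast
  qed
  have power: "l ^ n \<notin> M" if "homogeneous 1 l" "l \<notin> M" for l n
  proof (induction n)
    case 0
    have "1 \<in> M \<Longrightarrow> l \<in> M" using D(3)[of 1 l] by simp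
    then show ?case using that by auto
  next
    case (Suc n)
    then show ?case using prime[OF that(1) homogeneous_power[OF that(1), of n]] that by auto
  qed

  have proportional: "\<exists>c. l' - scalar c * l \<in> M"
    if l: "homogeneous 1 l" "l \<notin> M" and l': "homogeneous 1 l'" for l l'
  proof (cases "l' \<in> M")
    case True
    then show ?thesis by (intro exI[of _ 0]) simp
  next
    case False
    obtain n where "contains_degree n (add_generator M l)" using bigger l by blast
    define K where "K = n"
    have SK: "contains_degree (Suc K) (add_generator M l)"
      using contains_degree_add[OF homogeneous_ideal_add_generator(1)[OF MI l(1)] \<open>contains_degree n _\<close>, of 1]
      by (simp add: K_def)
    have step: "\<exists>y. homogeneous K y \<and> x - l * y \<in> M" if x: "homogeneous (Suc K) x" for x
    proof -
      obtain q h where "x = q + h * l" "q \<in> M"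
        using SK x by (auto simp: contains_degree_def add_generator_def)
      then have "x - l * component K h = component (Suc K) q"
        using component_homogeneous[OF x, of "Suc K"]
        by (simp add: component_add component_mult[OF l(1)] algebra_simps)
      then show ?thesis using D(4)[OF \<open>q \<in> M\<close>] homogeneous_component by metis
    qed
    have "\<exists>y. homogeneous K y \<and> l' ^ (K + j) - l ^ j * y \<in> M" for j
    proof (induction j)
      case 0
      then show ?case using homogeneous_power[OF l', of K] D(1) by (intro exI[of _ "l' ^ K"]) simp
    next
      case (Suc j)
      then obtain y where y: "homogeneous K y" "l' ^ (K + j) - l ^ j * y \<in> M" by blast
      obtain z where z: "homogeneous K z" "l' * y - l * z \<in> M"
        using step[of "l' * y"] homogeneous_mult[OF l' y(1)] by auto
      have "l' ^ (K + Suc j) - l ^ Suc j * z =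
          l' * (l' ^ (K + j) - l ^ j * y) + l ^ j * (l' * y - l * z)"
        by (simp add: algebra_simps)
      also have "\<dots> \<in> M" by (intro D(2,3) y z)
      finally show ?case using z by blast
    qed
    then obtain y where y: "\<And>j. homogeneous K (y j)" "\<And>j. l' ^ (K + j) - l ^ j * y j \<in> M"
      by metis
    define E where "E = card {m :: 3 \<Rightarrow>\<^sub>0 nat. monomial_degree m = K}"
    have "card {m :: 3 \<Rightarrow>\<^sub>0 nat. monomial_degree m = K} < card {..E}" by (simp add: E_def)
    then obtain c where c: "\<exists>j\<in>{..E}. c j \<noteq> 0" "(\<Sum>j\<le>E. scalar (c j) * y j) = 0"
      by (rule dependent_forms[OF finite_atMost _ y(1)])
    define f where "f = (\<Sum>j\<le>E. monom (c j) j)"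
    have coeff_f: "coeff f j = (if j \<le> E then c j else 0)" for j
      by (simp add: f_def coeff_sum)
    have f: "f \<noteq> 0" "degree f \<le> E"
      using c coeff_f by (auto intro!: degree_le) (metis coeff_0)
    have "l' ^ K * homogenized E f l l' =
        (\<Sum>j\<le>E. scalar (c j) * l ^ (E - j) * (l' ^ (K + j) - l ^ j * y j)) +
        l ^ E * (\<Sum>j\<le>E. scalar (c j) * y j)"
    proof -
      have "l ^ E = l ^ (E - j) * l ^ j" if "j \<le> E" for j
        using that by (simp flip: power_add)
      then show ?thesis
        unfolding homogenized_def sum_distrib_left sum.distrib[symmetric]
        by (intro sum.cong) (simp_all add: coeff_f power_add algebra_simps)
    qed
    also have "\<dots> \<in> M" unfolding c(2) by (intro D(2) ideal_sum_mem[OF MI] D(3) y) (simp add: D(1))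
    finally have "l' ^ K * homogenized E f l l' \<in> M" .
    moreover have hom: "homogeneous D (homogenized D g l l')" for D g
    proof -
      have "homogeneous (0 + (D - j) * 1 + j * 1) (scalar (coeff g j) * l ^ (D - j) * l' ^ j)" for j
        by (intro homogeneous_mult homogeneous_power l l' homogeneous_scalar)
      then have "homogeneous D (scalar (coeff g j) * l ^ (D - j) * l' ^ j)" if "j \<le> D" for j
        using that by (metis add.left_neutral le_add_diff_inverse2 mult.right_neutral)
      then show ?thesis unfolding homogenized_def by (intro homogeneous_sum) simp
    qed
    ultimately have "homogenized E f l l' \<in> M"
      using prime[OF homogeneous_power[OF l', of K] hom] power[OF l' False] by blast
    then show ?thesis
    proof (rule binary_form_in_prime[of M "\<lambda>x. \<exists>k. homogeneous k x", rotated -1])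
      show "\<exists>k. homogeneous k (l' - scalar c * l)" for c
        using homogeneous_diff[OF l' homogeneous_scalar_mult[OF l(1)]] by blast
    qed (use D(3) prime hom homogeneous_power l f in blast)+
  qed

  obtain i where i: "variable i \<notin> M"
  proof (rule ccontr)
    assume "\<not> thesis"
    then have "variable i \<in> M" for i using that by blast
    moreover have "\<exists>i. m = single i 1" if m: "monomial_degree m = 1" for m
    proof -
      obtain i m' where "m = single i 1 + m'" "monomial_degree m' = 0"
        using monomial_split_variable[of m 0] m by auto
      moreover from this have "m' = 0" by (intro poly_mapping_eqI) simp
      ultimately show ?thesis by auto
    qed
    ultimately have "contains_degree 1 M"
      unfolding contains_degree_iff_monomials[OF MI] variable_def by metis
    then show False using M_none by blast
  qed
  obtain a where a: "\<And>j. variable j - scalar (a j) * variable i \<in> M"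
    using proportional[OF homogeneous_variable(1) i homogeneous_variable(1)] by metis
  have "a i \<noteq> 0" using a[of i] i by auto
  then have "a \<noteq> (\<lambda>_. 0)" by auto
  then obtain f where f: "f \<in> Q" "eval_at f a \<noteq> 0" using no_zero by blast
  have "eval_at (component n f) a = 0" for n
  proof (rule ccontr)
    assume nz: "eval_at (component n f) a \<noteq> 0"
    define c where "c = eval_at (component n f) a"
    have fM: "component n f \<in> M" using f QM by (intro D(4)) blast
    moreover have "component n f - scalar c * variable i ^ n \<in> M"
      unfolding c_def by (rule form_congruent_value[OF MI a homogeneous_component])
    ultimately have "component n f - (component n f - scalar c * variable i ^ n) \<in> M" by (rule D(5))
    then have "scalar (inverse c) * (scalar c * variable i ^ n) \<in> M" by (simp add: D(3))
    then have "variable i ^ n \<in> M"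
      using nz by (simp only: scalar_cancel c_def not_False_eq_True)
    then show False using power[OF homogeneous_variable(1) i] by blast
  qed
  moreover have "eval_at f a = (\<Sum>n\<in>monomial_degree ` Poly_Mapping.keys f. eval_at (component n f) a)"
    by (subst (1) sum_components) (rule eval_at.hom_sum)
  ultimately show False using f by simp
qed


section \<open>Unique factorization and the Nullstellensatz for plane curves\<close>

text \<open>
  The ring is factorial because it is isomorphic to an iterated univariate polynomial ring.  The
  outermost variable of that ring stands for \<open>x\<^sub>a\<close>, where \<open>a\<close> can be chosen so that a given
  polynomial involves \<open>x\<^sub>a\<close>.
\<close>

definition nested_variable :: "3 \<Rightarrow> 3 \<Rightarrow> 'k::comm_ring_1 poly poly poly" where
  "nested_variable a i =
     (if i = a then [:0, 1:] else if i = a + 1 then [:[:0, 1:]:] else [:[:[:0, 1:]:]:])"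

definition nested :: "3 \<Rightarrow> 'k::comm_ring_1 ternary \<Rightarrow> 'k poly poly poly" where
  "nested a = ternary_eval (\<lambda>c. [:[:[:c:]:]:]) (nested_variable a)"

interpretation nested: comm_ring_hom "nested a :: 'k::comm_ring_1 ternary \<Rightarrow> _" for a
  unfolding nested_def by (rule ternary_eval_hom, unfold_locales) simp_all

declare nested.hom_dvd [simp del, rule del] nested.hom_dvd_1 [simp del]

lemma const_poly_power: "[:c:] ^ n = [:c ^ n:]" for c :: "'a::comm_ring_1"
  by (induction n) simp_all

lemma variable_power_monom: "pCons 0 1 ^ n = monom 1 n"
  by (simp add: monom_altdef)

lemma nested_single:
  "nested a (single m c) = monom (monom (monom c (lookup m (a + 2)))
     (lookup m (a + 1))) (lookup m a)"
proof -
  have "nested a (single m c) =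
      [:[:[:c:]:]:] * (\<Prod>i\<in>UNIV. nested_variable a i ^ lookup m i)"
    unfolding nested_def by (rule ternary_eval_single) simp
  also have "\<dots> = [:[:[:c:]:]:] * (monom 1 (lookup m a) *
      ([:monom 1 (lookup m (a + 1)):] * [:[:monom 1 (lookup m (a + 2)):]:]))"
    unfolding UNIV_3[of a] using distinct_3[of a]
    by (simp add: nested_variable_def const_poly_power variable_power_monom)
  also have "\<dots> = monom (monom (monom c (lookup m (a + 2)))
     (lookup m (a + 1))) (lookup m a)"
    by (simp add: smult_monom mult.commute)
  finally show ?thesis .
qed

lemma coeff_nested:
  "coeff (coeff (coeff (nested a H) (lookup m a)) (lookup m (a + 1)))
     (lookup m (a + 2)) = lookup H m"
proof (induction H rule: ternary_induct)
  case (monomial m' c)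
  have "m' = m" if "lookup m' a = lookup m a"
    "lookup m' (a + 1) = lookup m (a + 1)"
    "lookup m' (a + 2) = lookup m (a + 2)"
  proof (rule poly_mapping_eqI)
    fix i show "lookup m' i = lookup m i"
      using exhaust_3[of i a] that by (elim disjE) simp_all
  qed
  then show ?case by (auto simp: nested_single lookup_single when_def)
next
  case (add A B)
  then show ?case by (simp add: nested.hom_add lookup_add)
qed

lemma nested_inj: "nested a A = nested a B \<longleftrightarrow> A = B"
  by (metis coeff_nested poly_mapping_eqI)

lemma nested_surj: "\<exists>H. nested a H = q"
proof -
  have c: "nested a (scalar c) = [:[:[:c:]:]:]" for c
    by (simp add: nested_single monom_0)
  have v: "nested a (variable i) = nested_variable a i" for i :: 3
    using exhaust_3[of i a] distinct_3[of a]
    by (auto simp: variable_def nested_single nested_variable_def lookup_single monom_Suc monom_0)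
  have 1: "\<exists>H. nested a H = [:[:r:]:]" for r
  proof (induction r)
    case 0
    show ?case by (intro exI[of _ 0]) simp
  next
    case (pCons c r)
    then obtain H where "nested a H = [:[:r:]:]" by blast
    then have "nested a (scalar c + variable (a + 2) * H) = [:[:pCons c r:]:]"
      using distinct_3[of a] by (simp add: nested.hom_add nested.hom_mult c v nested_variable_def)
    then show ?case by blast
  qed
  have 2: "\<exists>H. nested a H = [:s:]" for s
  proof (induction s)
    case 0
    show ?case by (intro exI[of _ 0]) simp
  next
    case (pCons r s)
    then obtain H where "nested a H = [:s:]" by blast
    moreover obtain H' where "nested a H' = [:[:r:]:]" using 1 by blast
    ultimately have "nested a (H' + variable (a + 1) * H) = [:pCons r s:]"
      using distinct_3[of a] by (simp add: nested.hom_add nested.hom_mult v nested_variable_def)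
    then show ?case by blast
  qed
  show ?thesis
  proof (induction q)
    case 0
    show ?case by (intro exI[of _ 0]) simp
  next
    case (pCons s q)
    then obtain H where "nested a H = q" by blast
    moreover obtain H' where "nested a H' = [:s:]" using 2 by blast
    ultimately have "nested a (H' + variable a * H) = pCons s q"
      using distinct_3[of a] by (simp add: nested.hom_add nested.hom_mult v nested_variable_def)
    then show ?case by blast
  qed
qed

lemma nested_dvd_iff: "nested a A dvd nested a B \<longleftrightarrow> A dvd B"
proof
  assume "nested a A dvd nested a B"
  then obtain q where "nested a B = nested a A * q" by blast
  moreover obtain C where "nested a C = q" using nested_surj by blast
  ultimately have "nested a B = nested a (A * C)" by (simp add: nested.hom_mult)
  then show "A dvd B" by (simp add: nested_inj)
qed (rule nested.hom_dvd)

lemma prime_elem_nested_iff: "prime_elem (nested a P) \<longleftrightarrow> prime_elem P"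
proof -
  have "nested a P = 0 \<longleftrightarrow> P = 0" using nested_inj[of a P 0] by (simp only: nested.hom_zero)
  moreover have "nested a P dvd 1 \<longleftrightarrow> P dvd 1"
    using nested_dvd_iff[of a P 1] by (simp only: nested.hom_one)
  moreover have "(\<forall>q q'. nested a P dvd q * q' \<longrightarrow> nested a P dvd q \<or> nested a P dvd q') \<longleftrightarrow>
      (\<forall>A B. P dvd A * B \<longrightarrow> P dvd A \<or> P dvd B)"
  proof (intro iffI allI impI)
    fix A B assume *: "\<forall>q q'. nested a P dvd q * q' \<longrightarrow> nested a P dvd q \<or> nested a P dvd q'"
      and "P dvd A * B"
    from this(2) have "nested a P dvd nested a A * nested a B"
      by (simp only: nested_dvd_iff flip: nested.hom_mult)
    from *[rule_format, OF this] show "P dvd A \<or> P dvd B" by (simp only: nested_dvd_iff)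
  next
    fix q q' assume *: "\<forall>A B. P dvd A * B \<longrightarrow> P dvd A \<or> P dvd B" and "nested a P dvd q * q'"
    moreover obtain A B where AB: "q = nested a A" "q' = nested a B" using nested_surj by metis
    ultimately have "P dvd A * B" by (simp only: nested_dvd_iff flip: nested.hom_mult)
    with * show "nested a P dvd q \<or> nested a P dvd q'" unfolding AB nested_dvd_iff by simp
  qed
  ultimately show ?thesis by (simp only: prime_elem_def)
qed

theorem prime_factorization_ternary:
  fixes H :: "'k::field ternary"
  assumes "H \<noteq> 0" "\<not> H dvd 1"
  obtains Ps where "Ps \<noteq> {#}" "\<And>P. P \<in># Ps \<Longrightarrow> prime_elem P" "prod_mset Ps = H"
proof -
  have nz: "nested 0 H \<noteq> 0" using assms(1) nested_inj[of 0 H 0] unfolding nested.hom_zero by blast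
  have nu: "\<not> nested 0 H dvd 1"
    using assms(2) nested_dvd_iff[of 0 H 1] unfolding nested.hom_one by blast
  obtain Qs where Qs: "mset_factors Qs (nested 0 H)" using mset_factors_exist[OF nz nu] by (rule exE)
  obtain g where g: "nested 0 (g q) = q" for q :: "'k poly poly poly"
    using nested_surj[of 0] by metis
  define Ps where "Ps = image_mset g Qs"
  have "Ps \<noteq> {#}" using mset_factorsD(2)[OF Qs] by (simp add: Ps_def)
  moreover have "prime_elem P" if P: "P \<in># Ps" for P
  proof -
    obtain q where q: "q \<in># Qs" "P = g q" using P by (auto simp: Ps_def)
    then have "prime_elem (nested 0 P)" using mset_factorsD(1)[OF Qs] by (simp add: g)
    then show ?thesis by (simp only: prime_elem_nested_iff)
  qed
  moreover have "prod_mset Ps = H"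
  proof -
    have "nested 0 (prod_mset Ps) = prod_mset (image_mset (nested 0) Ps)" by (rule nested.hom_prod_mset)
    also have "image_mset (nested 0) Ps = Qs"
      by (simp add: Ps_def multiset.map_comp comp_def g)
    also have "prod_mset Qs = nested 0 H" by (rule mset_factorsD(3)[OF Qs])
    finally show ?thesis by (simp add: nested_inj)
  qed
  ultimately show thesis by (rule that)
qed

lemma squarefree_dvdI:
  fixes H :: "'k::field ternary"
  assumes "H \<noteq> 0" and squarefree: "\<And>P. prime_elem P \<Longrightarrow> \<not> P * P dvd H"
    and "\<And>P. prime_elem P \<Longrightarrow> P dvd H \<Longrightarrow> P dvd A"
  shows "H dvd A"
proof (cases "H dvd 1")
  case True
  then show ?thesis using dvd_trans one_dvd by blast
next
  case False
  then obtain Ps where Ps: "\<And>P. P \<in># Ps \<Longrightarrow> prime_elem P" "prod_mset Ps = H"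
    using prime_factorization_ternary assms(1) by metis
  have "prod_mset Qs dvd A" if "Qs \<subseteq># Ps" for Qs
    using that
  proof (induction Qs)
    case (add P Qs)
    then have P: "prime_elem P" using Ps(1) by (metis mset_subset_eqD union_single_eq_member)
    have dvd: "P * prod_mset Qs dvd H"
      using add.prems Ps(2) by (metis prod_mset.add_mset prod_mset_subset_imp_dvd)
    have "prod_mset Qs dvd A" using add subset_mset.dual_order.trans by (metis mset_subset_eq_add_mset_cancel
          mset_subset_eq_insertD subset_mset.less_imp_le)
    then obtain B where B: "A = prod_mset Qs * B" by blast
    have "P dvd prod_mset Qs * B" using assms(3)[OF P] dvd B by (metis dvd_mult_left)
    moreover have "\<not> P dvd prod_mset Qs"
      using squarefree[OF P] dvd by (meson dvd_refl dvd_trans mult_dvd_mono)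
    ultimately have "P dvd B" using prime_elem_dvd_multD[OF P] by metis
    then obtain C where "B = P * C" by blast
    then have "A = prod_mset (add_mset P Qs) * C" using B by (simp add: mult_ac)
    then show ?case by (rule dvdI)
  qed simp
  from this[of Ps] show ?thesis using Ps(2) by simp
qed

text \<open>
  Let \<open>r\<close> be a non-zero element of least degree in the ideal \<open>(p, h)\<close>.  Pseudo-division shows that
  \<open>r\<close> divides multiples \<open>a p\<close> and \<open>b h\<close> with constant \<open>a, b\<close>.  If \<open>r\<close> were not constant, the prime
  \<open>p\<close> would divide \<open>r\<close>, hence \<open>b h\<close>, hence \<open>h\<close>.
\<close>

lemma prime_elimination:
  fixes p h :: "'a::idom poly"
  assumes p: "prime_elem p" "degree p > 0" and h: "\<not> p dvd h"
  obtains r u v where "r \<noteq> 0" "[:r:] = u * p + v * h"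
proof -
  define I where "I = {f. f \<noteq> 0 \<and> (\<exists>u v. f = u * p + v * h)}"
  have "p = 1 * p + 0 * h" by simp
  then have "p \<in> I" using p(2) unfolding I_def by fastforce
  then obtain f where f: "f \<in> I" and min: "\<And>g. g \<in> I \<Longrightarrow> degree f \<le> degree g"
    using ex_has_least_nat[of "\<lambda>f. f \<in> I" p degree] by blast
  then obtain u v where uv: "f = u * p + v * h" and "f \<noteq> 0" by (auto simp: I_def)
  have multiple: "\<exists>a q. a \<noteq> 0 \<and> smult a g = f * q" if "\<exists>u v. g = u * p + v * h" for g
  proof -
    from that obtain u' v' where g: "g = u' * p + v' * h" by blast
    obtain a q where aq: "a \<noteq> 0" "smult a g = f * q + pseudo_mod g f"
      using pseudo_mod(1)[OF \<open>f \<noteq> 0\<close>] by blast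
    have "pseudo_mod g f = smult a g - f * q" using aq by simp
    also have "\<dots> = (smult a u' - u * q) * p + (smult a v' - v * q) * h"
      by (simp add: g uv algebra_simps smult_add_right)
    finally have "pseudo_mod g f = 0"
      using min[of "pseudo_mod g f"] pseudo_mod(2)[OF \<open>f \<noteq> 0\<close>, of g] unfolding I_def by force
    then show ?thesis using aq by auto
  qed
  have const: "\<not> p dvd [:a:]" if "a \<noteq> 0" for a
    using p(2) that dvd_imp_degree_le[of p "[:a:]"] by auto
  have "degree f = 0"
  proof (rule ccontr)
    assume "degree f \<noteq> 0"
    obtain a q where aq: "a \<noteq> 0" "smult a p = f * q"
      using multiple[of p] by (metis add.right_neutral mult_1 mult_zero_left)
    obtain b q' where bq: "b \<noteq> 0" "smult b h = f * q'"
      using multiple[of h] by (metis add.left_neutral mult_1 mult_zero_left)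
    have "p dvd f * q" using aq by (metis dvd_refl dvd_smult)
    moreover have "\<not> p dvd q"
    proof
      assume "p dvd q"
      then obtain q'' where "q = p * q''" by blast
      then have "p * [:a:] = p * (f * q'')" using aq by (simp add: mult_ac)
      then have "[:a:] = f * q''" using p(1) by (metis mult_cancel_left prime_elem_not_zeroI)
      then have "f dvd [:a:]" by simp
      then show False using dvd_imp_degree_le[of f "[:a:]"] aq(1) \<open>degree f \<noteq> 0\<close> by simp
    qed
    ultimately have "p dvd f" using prime_elem_dvd_multD[OF p(1)] by metis
    then have "p dvd f * q'" by (rule dvd_mult2)
    then have "p dvd [:b:] * h" using bq by simp
    then show False using const[OF bq(1)] h prime_elem_dvd_multD[OF p(1)] by metis
  qed
  then obtain r where r: "f = [:r:]" using degree_eq_zeroE by blast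
  then have "r \<noteq> 0" using \<open>f \<noteq> 0\<close> by auto
  then show thesis using that r uv by metis
qed

lemma infinite_alg_closed_field: "infinite (UNIV :: 'k::alg_closed_field set)"
proof
  assume fin: "finite (UNIV :: 'k set)"
  define f where "f = (\<Prod>a\<in>(UNIV::'k set). [:- a, 1:]) + 1"
  have "degree (\<Prod>a\<in>(UNIV::'k set). [:- a, 1:]) = card (UNIV :: 'k set)"
    by (subst degree_prod_sum_eq) auto
  then have "degree f > 0"
    using fin finite_UNIV_card_ge_0 unfolding f_def by (subst degree_add_eq_left) simp_all
  then obtain x where x: "poly f x = 0" using alg_closed_imp_poly_has_root by blast
  have "(\<Prod>a\<in>UNIV. poly [:- a, 1:] x) = 0" by (rule prod_zero[OF fin]) (auto intro: exI[of _ x])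
  then show False using x by (simp add: f_def poly_prod)
qed

lemma nonvanishing_value:
  fixes c :: "'k::alg_closed_field poly poly"
  assumes "c \<noteq> 0"
  obtains s t where "poly (poly c [:t:]) s \<noteq> 0"
proof -
  have "infinite (range (\<lambda>t::'k. [:t:]))"
    using infinite_alg_closed_field by (simp add: finite_image_iff inj_on_def)
  then obtain t where "poly c [:t:] \<noteq> 0"
    using poly_roots_finite[OF assms] by (metis (mono_tags, lifting) finite_subset image_subset_iff mem_Collect_eq)
  moreover from this obtain s where "poly (poly c [:t:]) s \<noteq> 0"
    using poly_roots_finite infinite_alg_closed_field by (metis (mono_tags, lifting) Collect_mono UNIV_def finite_subset poly_all_0_iff_0)
  ultimately show thesis using that by blast
qed

text \<open>
  Choose \<open>a\<close> such that \<open>P\<close> involves \<open>x\<^sub>a\<close>, and eliminate \<open>x\<^sub>a\<close> from \<open>P\<close> and \<open>H\<close>.  Where neither the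
  eliminant nor the leading coefficient of \<open>P\<close> vanishes, \<open>P\<close> still has a root in \<open>x\<^sub>a\<close>, and there
  \<open>H\<close> cannot vanish.
\<close>

theorem curve_nullstellensatz:
  fixes P H :: "'k::alg_closed_field ternary"
  assumes P: "prime_elem P" and H: "\<not> P dvd H"
  obtains q where "q \<noteq> (\<lambda>_. 0)" "eval_at P q = 0" "eval_at H q \<noteq> 0"
proof -
  obtain m where m: "m \<in> Poly_Mapping.keys P" "m \<noteq> 0"
  proof (rule ccontr)
    assume "\<not> thesis"
    then have "P = scalar (lookup P 0)"
      using that by (intro poly_mapping_eqI) (auto simp: lookup_single when_def in_keys_iff)
    then show False using P scalar_unit by (metis prime_elem_not_unit prime_elem_not_zeroI single_zero)
  qed
  then obtain a where a: "lookup m a \<noteq> 0" by (metis lookup_zero poly_mapping_eqI)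
  define p where "p = nested a P"
  define h where "h = nested a H"
  have "coeff p (lookup m a) \<noteq> 0"
    using coeff_nested[of a P m] m(1) by (auto simp: p_def in_keys_iff)
  then have "degree p > 0" using a by (metis gr0I le_degree le_zero_eq)
  moreover have "prime_elem p" using P by (simp only: p_def prime_elem_nested_iff)
  moreover have "\<not> p dvd h" using H by (simp add: p_def h_def nested_dvd_iff)
  ultimately obtain r u v where r: "r \<noteq> 0" "[:r:] = u * p + v * h" by (metis prime_elimination)
  \<comment> \<open>The factor \<open>[:0, 1:]\<close> is \<open>x\<^sub>a\<^sub>+\<^sub>1\<close>, so that the zero found has a non-zero coordinate.\<close>
  have "r * lead_coeff p * [:0, 1:] \<noteq> 0" using r \<open>degree p > 0\<close> by auto
  then obtain s t where st: "poly (poly (r * lead_coeff p * [:0, 1:]) [:t:]) s \<noteq> 0"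
    by (rule nonvanishing_value)
  define e where "e c = poly (poly c [:t:]) s" for c
  interpret e: comm_ring_hom e by unfold_locales (simp_all add: e_def)
  interpret me: map_poly_comm_ring_hom e ..
  have nz: "e r \<noteq> 0" "e (lead_coeff p) \<noteq> 0" "t \<noteq> 0" using st by (auto simp: e_def)
  have "coeff (map_poly e p) (degree p) \<noteq> 0" using nz by (simp add: coeff_map_poly)
  then have "degree (map_poly e p) > 0" using \<open>degree p > 0\<close> by (metis le_degree less_le_trans)
  then obtain z where z: "poly (map_poly e p) z = 0" using alg_closed_imp_poly_has_root by blast
  define q where "q i = (if i = a then z else if i = a + 1 then t else s)" for i
  have eval: "poly (map_poly e (nested a A)) z = eval_at A q" for A
  proof (induction A rule: ternary_induct)
    case (monomial m c)
    have "(\<Prod>i\<in>UNIV. q i ^ lookup m i) = z ^ lookup m a *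
        (t ^ lookup m (a + 1) * s ^ lookup m (a + 2))"
      unfolding UNIV_3[of a] using distinct_3[of a] by (simp add: q_def)
    then show ?case
      by (simp add: nested_single eval_at_single map_poly_monom poly_monom e_def)
  next
    case (add A B)
    then show ?case by (simp add: nested.hom_add me.hom_add eval_at.hom_add)
  qed
  have "e r = poly (map_poly e [:r:]) z" by (simp add: hom_distribs)
  also have "\<dots> = poly (map_poly e u) z * eval_at P q + poly (map_poly e v) z * eval_at H q"
    unfolding r(2) p_def h_def by (simp add: me.hom_add me.hom_mult eval)
  finally have "eval_at H q \<noteq> 0" "eval_at P q = 0" using nz z by (auto simp: p_def eval)
  moreover have "q (a + 1) \<noteq> 0" using nz distinct_3[of a] by (simp add: q_def)
  then have "q \<noteq> (\<lambda>_. 0)" by auto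
  ultimately show thesis using that by blast
qed


section \<open>Rings whose completion is a node\<close>

lemma (in cring) ideal_power_ideal:
  assumes "ideal I R"
  shows "ideal (I [^]\<^bsub>ideals_set R\<^esub> (n::nat)) R"
proof -
  interpret S: comm_monoid "ideals_set R" by (rule ideals_set_is_comm_monoid)
  have "I [^]\<^bsub>ideals_set R\<^esub> n \<in> carrier (ideals_set R)"
    using assms by (intro S.nat_pow_closed) (simp add: ideals_set_def)
  then show ?thesis by (simp add: ideals_set_def)
qed

lemma (in cring) ideal_power_0: "I [^]\<^bsub>ideals_set R\<^esub> (0::nat) = carrier R"
  by (simp add: nat_pow_def ideals_set_def)

lemma (in cring) ideal_power_Suc:
  "I [^]\<^bsub>ideals_set R\<^esub> Suc n = ideal_prod R (I [^]\<^bsub>ideals_set R\<^esub> n) I"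
  by (simp add: nat_pow_def ideals_set_def)

lemma (in cring) ideal_power_Suc_subset:
  assumes "ideal I R"
  shows "I [^]\<^bsub>ideals_set R\<^esub> Suc n \<subseteq> I [^]\<^bsub>ideals_set R\<^esub> n"
    "I [^]\<^bsub>ideals_set R\<^esub> Suc n \<subseteq> I"
  using ideal_prod_inter[OF ideal_power_ideal[OF assms, of n] assms]
  unfolding ideal_power_Suc by auto

lemma rcoset_mult_mono:
  assumes "P' \<subseteq> P" "A' \<subseteq> A" "B' \<subseteq> B"
  shows "rcoset_mult R P' A' B' \<subseteq> rcoset_mult R P A B"
proof -
  have "P' +>\<^bsub>R\<^esub> z \<subseteq> P +>\<^bsub>R\<^esub> z" for z
    using assms(1) by (auto simp: a_r_coset_def r_coset_def)
  then show ?thesis using assms(2,3) unfolding rcoset_mult_def by blast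
qed

lemma set_add_mono: "A' \<subseteq> A \<Longrightarrow> B' \<subseteq> B \<Longrightarrow> A' <+>\<^bsub>R\<^esub> B' \<subseteq> A <+>\<^bsub>R\<^esub> B"
  by (auto simp: set_add_def set_mult_def)

text \<open>
  In \<open>K[[x, y]]/(x y)\<close> the elements \<open>x, y\<close> are non-zero with product \<open>0\<close>, and every non-unit is a
  combination of them.  These properties alone give elements \<open>a, b\<close> of the maximal ideal of \<open>R\<close>
  that generate it modulo its cube and whose product lies in the cube.  If the component of \<open>x\<close> at
  some level were outside \<open>I\<close>, it would be a unit at every level, so that \<open>x y = 0\<close> would give
  \<open>y = 0\<close>.
\<close>

theorem completion_node_elements:
  fixes R :: "('a, 'b) ring_scheme" (structure) and N :: "('c, 'd) ring_scheme"
  assumes R: "cring R" and I: "ideal I R" and one_I: "\<one> \<notin> I"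
    and units: "\<And>u. u \<in> carrier R \<Longrightarrow> u \<notin> I \<Longrightarrow> \<exists>v\<in>carrier R. v \<otimes> u = \<one>"
    and N: "cring N" and iso: "adic_completion R I \<simeq> N"
    and xy: "x \<in> carrier N" "y \<in> carrier N" "x \<otimes>\<^bsub>N\<^esub> y = \<zero>\<^bsub>N\<^esub>" "x \<noteq> \<zero>\<^bsub>N\<^esub>" "y \<noteq> \<zero>\<^bsub>N\<^esub>"
    and nonunits: "\<And>z. z \<in> carrier N \<Longrightarrow> (\<exists>w\<in>carrier N. z \<otimes>\<^bsub>N\<^esub> w = \<one>\<^bsub>N\<^esub>) \<or>
      (\<exists>f\<in>carrier N. \<exists>g\<in>carrier N. z = x \<otimes>\<^bsub>N\<^esub> f \<oplus>\<^bsub>N\<^esub> y \<otimes>\<^bsub>N\<^esub> g)"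
  shows "\<exists>a\<in>I. \<exists>b\<in>I. a \<otimes> b \<in> I [^]\<^bsub>ideals_set R\<^esub> (3::nat) \<and>
    (\<forall>c\<in>I. \<exists>f\<in>carrier R. \<exists>g\<in>carrier R. \<exists>r\<in>I [^]\<^bsub>ideals_set R\<^esub> (3::nat).
       c = (a \<otimes> f \<oplus> b \<otimes> g) \<oplus> r)"
proof -
  interpret R: cring R by fact
  interpret N: cring N by fact
  define P where "P n = I [^]\<^bsub>ideals_set R\<^esub> n" for n :: nat
  define cls where "cls n c = P n +> c" for n c
  define C where "C = adic_completion R I"
  have PI: "ideal (P n) R" for n unfolding P_def by (rule R.ideal_power_ideal[OF I])
  have P0: "P 0 = carrier R" unfolding P_def by (rule R.ideal_power_0)
  have P_Suc: "P (Suc n) \<subseteq> P n" "P (Suc n) \<subseteq> I" for n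
    unfolding P_def by (rule R.ideal_power_Suc_subset[OF I])+
  have carrier_Q: "carrier (R Quot P n) = {cls n c |c. c \<in> carrier R}" for n
    by (auto simp: FactRing_def A_RCOSETS_def' cls_def)
  have carrier_C: "s \<in> carrier C \<longleftrightarrow> (\<forall>n. (\<exists>c\<in>carrier R. s n = cls n c) \<and> s (Suc n) \<subseteq> s n)" for s
    unfolding C_def adic_completion_def Let_def carrier_Q[unfolded P_def] by (simp add: P_def) blast
  have mult_C: "(s \<otimes>\<^bsub>C\<^esub> t) n = rcoset_mult R (P n) (s n) (t n)" for s t n
    by (simp add: C_def adic_completion_def Let_def FactRing_def P_def)
  have add_C: "(s \<oplus>\<^bsub>C\<^esub> t) n = s n <+> t n" for s t n
    by (simp add: C_def adic_completion_def Let_def FactRing_def)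
  have zero_C: "\<zero>\<^bsub>C\<^esub> n = P n" for n
    by (simp add: C_def adic_completion_def Let_def FactRing_def P_def)
  have one_C: "\<one>\<^bsub>C\<^esub> n = cls n \<one>" for n
    by (simp add: C_def adic_completion_def Let_def FactRing_def P_def cls_def)
  have cls_mult: "rcoset_mult R (P n) (cls n a) (cls n b) = cls n (a \<otimes> b)"
    if "a \<in> carrier R" "b \<in> carrier R" for n a b
    unfolding cls_def by (rule ideal.rcoset_mult_add[OF PI that])
  have cls_add: "cls n a <+> cls n b = cls n (a \<oplus> b)"
    if "a \<in> carrier R" "b \<in> carrier R" for n a b
    unfolding cls_def by (rule ideal.a_rcos_sum[OF PI that])
  have cls_eq: "cls n a = cls n b \<longleftrightarrow> a \<ominus> b \<in> P n" if "a \<in> carrier R" "b \<in> carrier R" for n a b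
    unfolding cls_def using R.quotient_eq_iff_same_a_r_cos[OF PI that] by simp
  have cls_zero: "cls n a = P n \<longleftrightarrow> a \<in> P n" if "a \<in> carrier R" for n a
    unfolding cls_def using R.a_rcos_zero[OF PI] ideal.rcos_const_imp_mem[OF PI that] by blast
  have cls_self: "a \<in> cls n a" if "a \<in> carrier R" for n a
    using that additive_subgroup.zero_closed[OF ideal.axioms(1)[OF PI, of n]]
    unfolding cls_def by (force simp: a_r_coset_def')
  have cls_sub: "b \<in> cls n a \<Longrightarrow> cls n b = cls n a" if "a \<in> carrier R" for n a b
  proof -
    assume b: "b \<in> cls n a"
    then obtain i where i: "i \<in> P n" "b = i \<oplus> a" by (auto simp: cls_def a_r_coset_def')
    have ic: "i \<in> carrier R" using i(1) ideal.Icarr[OF PI] by blast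
    have "cls n b = cls n i <+> cls n a" using cls_add[OF ic that] i by simp
    also have "cls n i = cls n \<zero>"
      using cls_zero[OF ic, of n] cls_zero[OF R.zero_closed, of n] i(1)
        additive_subgroup.zero_closed[OF ideal.axioms(1)[OF PI, of n]] by simp
    also have "cls n \<zero> <+> cls n a = cls n a" using cls_add[OF R.zero_closed that] that by simp
    finally show "cls n b = cls n a" .
  qed
  have zero_in_C: "\<zero>\<^bsub>C\<^esub> \<in> carrier C"
    using cls_zero[OF R.zero_closed] additive_subgroup.zero_closed[OF ideal.axioms(1)[OF PI]] P_Suc
    by (auto simp: carrier_C zero_C)
  have mult_in_C: "s \<otimes>\<^bsub>C\<^esub> t \<in> carrier C" if st: "s \<in> carrier C" "t \<in> carrier C" for s t
    unfolding carrier_C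
  proof (intro allI conjI)
    fix n
    obtain a b where "a \<in> carrier R" "b \<in> carrier R" "s n = cls n a" "t n = cls n b"
      using st unfolding carrier_C by metis
    then show "\<exists>c\<in>carrier R. (s \<otimes>\<^bsub>C\<^esub> t) n = cls n c"
      by (intro bexI[of _ "a \<otimes> b"]) (simp_all add: mult_C cls_mult)
    show "(s \<otimes>\<^bsub>C\<^esub> t) (Suc n) \<subseteq> (s \<otimes>\<^bsub>C\<^esub> t) n"
      unfolding mult_C using st P_Suc by (intro rcoset_mult_mono) (auto simp: carrier_C)
  qed
  have add_in_C: "s \<oplus>\<^bsub>C\<^esub> t \<in> carrier C" if st: "s \<in> carrier C" "t \<in> carrier C" for s t
    unfolding carrier_C
  proof (intro allI conjI)
    fix n
    obtain a b where "a \<in> carrier R" "b \<in> carrier R" "s n = cls n a" "t n = cls n b"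
      using st unfolding carrier_C by metis
    then show "\<exists>c\<in>carrier R. (s \<oplus>\<^bsub>C\<^esub> t) n = cls n c"
      by (intro bexI[of _ "a \<oplus> b"]) (simp_all add: add_C cls_add)
    show "(s \<oplus>\<^bsub>C\<^esub> t) (Suc n) \<subseteq> (s \<oplus>\<^bsub>C\<^esub> t) n"
      unfolding add_C using st by (intro set_add_mono) (auto simp: carrier_C)
  qed
  obtain h where h: "h \<in> Ring.ring_hom C N" "bij_betw h (carrier C) (carrier N)"
    using iso by (auto simp: is_ring_iso_def ring_iso_def C_def)
  have h_inj: "s = t" if "s \<in> carrier C" "t \<in> carrier C" "h s = h t" for s t
    using h(2) that by (auto simp: bij_betw_def inj_on_def)
  have h_surj: "\<exists>s\<in>carrier C. h s = z" if "z \<in> carrier N" for z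
    using h(2) that unfolding bij_betw_def by (metis imageE)
  have h_zero: "h \<zero>\<^bsub>C\<^esub> = \<zero>\<^bsub>N\<^esub>"
  proof -
    have "\<zero>\<^bsub>C\<^esub> \<oplus>\<^bsub>C\<^esub> \<zero>\<^bsub>C\<^esub> = \<zero>\<^bsub>C\<^esub>"
    proof
      fix n show "(\<zero>\<^bsub>C\<^esub> \<oplus>\<^bsub>C\<^esub> \<zero>\<^bsub>C\<^esub>) n = \<zero>\<^bsub>C\<^esub> n"
        using cls_add[OF R.zero_closed R.zero_closed, of n] cls_zero[OF R.zero_closed, of n]
          additive_subgroup.zero_closed[OF ideal.axioms(1)[OF PI, of n]]
        by (simp add: add_C zero_C)
    qed
    then have "h \<zero>\<^bsub>C\<^esub> \<oplus>\<^bsub>N\<^esub> h \<zero>\<^bsub>C\<^esub> = h \<zero>\<^bsub>C\<^esub>"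
      using ring_hom_add[OF h(1) zero_in_C zero_in_C] by simp
    then show ?thesis using ring_hom_closed[OF h(1) zero_in_C] N.add.r_cancel_one by blast
  qed

  obtain s t where st: "s \<in> carrier C" "h s = x" "t \<in> carrier C" "h t = y"
    using h_surj xy(1,2) by metis
  have "h (s \<otimes>\<^bsub>C\<^esub> t) = h \<zero>\<^bsub>C\<^esub>"
    using ring_hom_mult[OF h(1) st(1,3)] st xy(3) h_zero by simp
  then have st_zero: "s \<otimes>\<^bsub>C\<^esub> t = \<zero>\<^bsub>C\<^esub>" using h_inj mult_in_C st zero_in_C by blast
  have ts_zero: "t \<otimes>\<^bsub>C\<^esub> s = \<zero>\<^bsub>C\<^esub>"
  proof (rule h_inj[OF mult_in_C[OF st(3,1)] zero_in_C])
    show "h (t \<otimes>\<^bsub>C\<^esub> s) = h \<zero>\<^bsub>C\<^esub>"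
      using ring_hom_mult[OF h(1) st(3,1)] st xy(1-3) h_zero N.m_comm by simp
  qed
  have st_ne: "s \<noteq> \<zero>\<^bsub>C\<^esub>" "t \<noteq> \<zero>\<^bsub>C\<^esub>" using st xy(4,5) h_zero by auto

  have in_I: "c \<in> I" if ss: "s' \<in> carrier C" "t' \<in> carrier C" "s' \<otimes>\<^bsub>C\<^esub> t' = \<zero>\<^bsub>C\<^esub>" "t' \<noteq> \<zero>\<^bsub>C\<^esub>"
      and c: "c \<in> carrier R" "s' (Suc n) = cls (Suc n) c" for s' t' c n
  proof (rule ccontr)
    assume cI: "c \<notin> I"
    have s'_mono: "s' (Suc k) \<subseteq> s' (Suc 0)" for k
      using ss(1) unfolding carrier_C by (induction k) blast+
    have unit: "e \<notin> I" if e: "e \<in> carrier R" "s' (Suc k) = cls (Suc k) e" for e k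
    proof
      assume "e \<in> I"
      have "c \<in> s' (Suc 0)" "e \<in> s' (Suc 0)"
        using s'_mono[of n] s'_mono[of k] cls_self c e by auto
      moreover obtain g where g: "g \<in> carrier R" "s' (Suc 0) = cls (Suc 0) g"
        using ss(1) unfolding carrier_C by blast
      ultimately have "cls (Suc 0) c = cls (Suc 0) e" using cls_sub[OF g(1)] by metis
      then have "c \<ominus> e \<in> I" using cls_eq[OF c(1) e(1), of "Suc 0"] P_Suc(2) by auto
      then have "(c \<ominus> e) \<oplus> e \<in> I"
        using \<open>e \<in> I\<close> additive_subgroup.a_closed[OF ideal.axioms(1)[OF I]] by blast
      moreover have "(c \<ominus> e) \<oplus> e = c" using c(1) e(1) by algebra
      ultimately show False using cI by simp
    qed
    have "t' = \<zero>\<^bsub>C\<^esub>"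
    proof
      fix k
      obtain b where b: "b \<in> carrier R" "t' k = cls k b" using ss(2) unfolding carrier_C by blast
      show "t' k = \<zero>\<^bsub>C\<^esub> k"
      proof (cases k)
        case 0
        then show ?thesis using b cls_zero[of b 0] P0 by (simp add: zero_C)
      next
        case (Suc j)
        obtain e where e: "e \<in> carrier R" "s' k = cls k e" using ss(1) unfolding carrier_C by blast
        obtain v where v: "v \<in> carrier R" "v \<otimes> e = \<one>" 
          using units[OF e(1)] unit[of e j] e Suc by metis
        have "cls k (e \<otimes> b) = P k"
          using fun_cong[OF ss(3), of k] e b by (simp add: mult_C zero_C cls_mult)
        then have "v \<otimes> (e \<otimes> b) \<in> P k"
          using cls_zero[of "e \<otimes> b" k] e b v(1) ideal.I_l_closed[OF PI] by simp
        moreover have "v \<otimes> (e \<otimes> b) = b"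
          using v e b by (simp flip: R.m_assoc)
        ultimately show ?thesis using b cls_zero[of b k] by (simp add: zero_C)
      qed
    qed
    with ss(4) show False by blast
  qed

  \<comment> \<open>Equations at level 3 of the completion hold in \<open>R\<close> modulo the cube of \<open>I\<close>.\<close>
  obtain a where a: "a \<in> carrier R" "s (Suc 2) = cls (Suc 2) a" using st(1) unfolding carrier_C by blast
  obtain b where b: "b \<in> carrier R" "t (Suc 2) = cls (Suc 2) b" using st(3) unfolding carrier_C by blast
  have "a \<in> I" using in_I[OF st(1,3) st_zero st_ne(2) a] .
  moreover have "b \<in> I" using in_I[OF st(3,1) ts_zero st_ne(1) b] .
  moreover have "a \<otimes> b \<in> P (Suc 2)"
    using fun_cong[OF st_zero, of "Suc 2"] a b cls_zero[of "a \<otimes> b" "Suc 2"]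
    by (simp add: mult_C zero_C cls_mult)
  moreover have "\<exists>f\<in>carrier R. \<exists>g\<in>carrier R. \<exists>r\<in>P (Suc 2). c = (a \<otimes> f \<oplus> b \<otimes> g) \<oplus> r"
    if "c \<in> I" for c
  proof -
    have c: "c \<in> carrier R" using that ideal.Icarr[OF I] by blast
    define k where "k n = cls n c" for n
    have k: "k \<in> carrier C"
      unfolding carrier_C k_def
    proof (intro allI conjI bexI[OF _ c] refl)
      fix n show "cls (Suc n) c \<subseteq> cls n c"
        using P_Suc by (auto simp: cls_def a_r_coset_def r_coset_def)
    qed
    have "h k \<in> carrier N" by (rule ring_hom_closed[OF h(1) k])
    then consider (unit) w where "w \<in> carrier N" "h k \<otimes>\<^bsub>N\<^esub> w = \<one>\<^bsub>N\<^esub>"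
      | (comb) f g where "f \<in> carrier N" "g \<in> carrier N" "h k = x \<otimes>\<^bsub>N\<^esub> f \<oplus>\<^bsub>N\<^esub> y \<otimes>\<^bsub>N\<^esub> g"
      using nonunits by blast
    then show ?thesis
    proof cases
      case unit
      obtain l where l: "l \<in> carrier C" "h l = w" using h_surj unit by blast
      have one: "\<one>\<^bsub>C\<^esub> \<in> carrier C"
        unfolding carrier_C one_C
      proof (intro allI conjI bexI[OF _ R.one_closed] refl)
        fix n show "cls (Suc n) \<one> \<subseteq> cls n \<one>"
          using P_Suc by (auto simp: cls_def a_r_coset_def r_coset_def)
      qed
      have "h (k \<otimes>\<^bsub>C\<^esub> l) = h \<one>\<^bsub>C\<^esub>"
        using ring_hom_mult[OF h(1) k l(1)] ring_hom_one[OF h(1)] unit l by simp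
      then have eq: "k \<otimes>\<^bsub>C\<^esub> l = \<one>\<^bsub>C\<^esub>" using h_inj[OF mult_in_C[OF k l(1)] one] by blast
      obtain e where e: "e \<in> carrier R" "l (Suc 0) = cls (Suc 0) e" using l unfolding carrier_C by blast
      have "cls (Suc 0) (c \<otimes> e) = cls (Suc 0) \<one>"
        using fun_cong[OF eq, of "Suc 0"] c e by (simp add: mult_C one_C k_def cls_mult)
      then have "c \<otimes> e \<ominus> \<one> \<in> I"
        using cls_eq[of "c \<otimes> e" "\<one>" "Suc 0"] c e subsetD[OF P_Suc(2)[of 0]] by simp
      moreover have ce: "c \<otimes> e \<in> I" using that e ideal.I_r_closed[OF I] by blast
      ultimately have "c \<otimes> e \<ominus> (c \<otimes> e \<ominus> \<one>) \<in> I"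
        using additive_subgroup.a_closed[OF ideal.axioms(1)[OF I]]
          additive_subgroup.a_inv_closed[OF ideal.axioms(1)[OF I]] unfolding a_minus_def by blast
      moreover have "c \<otimes> e \<ominus> (c \<otimes> e \<ominus> \<one>) = \<one>"
        using c e by algebra
      ultimately show ?thesis using one_I by simp
    next
      case comb
      obtain f' g' where fg: "f' \<in> carrier C" "h f' = f" "g' \<in> carrier C" "h g' = g"
        using h_surj comb by metis
      have "h ((s \<otimes>\<^bsub>C\<^esub> f') \<oplus>\<^bsub>C\<^esub> (t \<otimes>\<^bsub>C\<^esub> g')) = h k"
        using ring_hom_add[OF h(1)] ring_hom_mult[OF h(1)] st fg mult_in_C comb by simp
      then have eq: "(s \<otimes>\<^bsub>C\<^esub> f') \<oplus>\<^bsub>C\<^esub> (t \<otimes>\<^bsub>C\<^esub> g') = k"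
        using h_inj[OF add_in_C[OF mult_in_C[OF st(1) fg(1)] mult_in_C[OF st(3) fg(3)]] k] by blast
      obtain f'' where f: "f'' \<in> carrier R" "f' (Suc 2) = cls (Suc 2) f''"
        using fg unfolding carrier_C by blast
      obtain g'' where g: "g'' \<in> carrier R" "g' (Suc 2) = cls (Suc 2) g''"
        using fg unfolding carrier_C by blast
      have "cls (Suc 2) c = cls (Suc 2) (a \<otimes> f'' \<oplus> b \<otimes> g'')"
        using fun_cong[OF eq, of "Suc 2"] a b f g c
        by (simp add: add_C mult_C k_def cls_mult cls_add)
      then have "c \<ominus> (a \<otimes> f'' \<oplus> b \<otimes> g'') \<in> P (Suc 2)"
        using cls_eq a b f g c by simp
      moreover have "c = (a \<otimes> f'' \<oplus> b \<otimes> g'') \<oplus> (c \<ominus> (a \<otimes> f'' \<oplus> b \<otimes> g''))"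
        using a(1) b(1) f(1) g(1) c by algebra
      ultimately show ?thesis using f(1) g(1) by blast
    qed
  qed
  moreover have "P (Suc 2) = I [^]\<^bsub>ideals_set R\<^esub> (3::nat)"
    unfolding P_def by (simp only: eval_nat_numeral numeral_2_eq_2)
  ultimately show ?thesis by metis
qed

text \<open>
  A power series with non-zero constant term is a unit; any other one splits into its part free of
  \<open>y\<close>, which is divisible by \<open>x\<close>, and a multiple of \<open>y\<close>.
\<close>

lemma node_ring_properties:
  fixes N :: "'k::field fps fps set ring"
  defines "N \<equiv> node_ring"
  shows "cring N"
    and "\<exists>x\<in>carrier N. \<exists>y\<in>carrier N. x \<otimes>\<^bsub>N\<^esub> y = \<zero>\<^bsub>N\<^esub> \<and> x \<noteq> \<zero>\<^bsub>N\<^esub> \<and> y \<noteq> \<zero>\<^bsub>N\<^esub> \<and>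
      (\<forall>z\<in>carrier N. (\<exists>w\<in>carrier N. z \<otimes>\<^bsub>N\<^esub> w = \<one>\<^bsub>N\<^esub>) \<or>
        (\<exists>f\<in>carrier N. \<exists>g\<in>carrier N. z = x \<otimes>\<^bsub>N\<^esub> f \<oplus>\<^bsub>N\<^esub> y \<otimes>\<^bsub>N\<^esub> g))"
proof -
  define T where "T = (ring_of_type_algebra :: 'k fps fps ring)"
  define J where "J = PIdl\<^bsub>T\<^esub> (fps_const fps_X * fps_X)"
  interpret T: cring T unfolding T_def by (rule cring_from_type_algebra)
  have T: "carrier T = UNIV" "f \<otimes>\<^bsub>T\<^esub> g = f * g" "f \<oplus>\<^bsub>T\<^esub> g = f + g" "\<one>\<^bsub>T\<^esub> = 1" "\<zero>\<^bsub>T\<^esub> = 0" for f g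
    by (simp_all add: T_def ring_of_type_algebra_def)
  have J_iff: "f \<in> J \<longleftrightarrow> (\<exists>r. f = r * (fps_const fps_X * fps_X))" for f
    by (auto simp: J_def cgenideal_def T)
  interpret J: ideal J T unfolding J_def by (rule T.cgenideal_ideal) (simp add: T)
  have N: "N = T Quot J" by (simp add: N_def node_ring_def T_def J_def)
  show "cring N" unfolding N by (rule J.quotient_is_cring[OF T.is_cring])
  define cl where "cl f = J +>\<^bsub>T\<^esub> f" for f
  have carrier: "carrier N = range cl"
    by (auto simp: N FactRing_def A_RCOSETS_def' cl_def T)
  have mult: "cl f \<otimes>\<^bsub>N\<^esub> cl g = cl (f * g)" for f g
    using J.rcoset_mult_add[of f g] by (simp add: N FactRing_def cl_def T)
  have add: "cl f \<oplus>\<^bsub>N\<^esub> cl g = cl (f + g)" for f g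
    using J.a_rcos_sum[of f g] by (simp add: N FactRing_def cl_def T)
  have one: "\<one>\<^bsub>N\<^esub> = cl 1" by (simp add: N FactRing_def cl_def T)
  have zero: "cl f = \<zero>\<^bsub>N\<^esub> \<longleftrightarrow> f \<in> J" for f
    using J.rcos_const_imp_mem[of f] T.a_rcos_zero[OF J.is_ideal, of f]
    by (auto simp: N FactRing_def cl_def T)
  let ?x = "fps_const fps_X :: 'k fps fps" and ?y = "fps_X :: 'k fps fps"
  have "?x * ?y \<in> J" unfolding J_iff by (intro exI[of _ 1]) simp
  then have "cl ?x \<otimes>\<^bsub>N\<^esub> cl ?y = \<zero>\<^bsub>N\<^esub>" by (simp add: mult zero)
  moreover have "?x \<notin> J"
  proof
    assume "?x \<in> J"
    then obtain r where "?x = r * ?x * ?y" by (auto simp: J_iff mult.assoc)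
    from arg_cong[OF this, of "\<lambda>f. fps_nth f 0"] show False by simp
  qed
  then have "cl ?x \<noteq> \<zero>\<^bsub>N\<^esub>" by (simp add: zero)
  moreover have "?y \<notin> J"
  proof
    assume "?y \<in> J"
    then obtain r where "?y = r * ?x * ?y" by (auto simp: J_iff mult.assoc)
    from arg_cong[OF this, of "\<lambda>f. fps_nth (fps_nth f 1) 0"] show False by simp
  qed
  then have "cl ?y \<noteq> \<zero>\<^bsub>N\<^esub>" by (simp add: zero)
  moreover have "(\<exists>w\<in>carrier N. z \<otimes>\<^bsub>N\<^esub> w = \<one>\<^bsub>N\<^esub>) \<or>
        (\<exists>f\<in>carrier N. \<exists>g\<in>carrier N. z = cl ?x \<otimes>\<^bsub>N\<^esub> f \<oplus>\<^bsub>N\<^esub> cl ?y \<otimes>\<^bsub>N\<^esub> g)" if "z \<in> carrier N" for z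
  proof -
    obtain f where f: "z = cl f" using \<open>z \<in> carrier N\<close> carrier by auto
    show ?thesis
    proof (cases "fps_nth (fps_nth f 0) 0 = 0")
      case False
      then have "fps_nth f 0 * inverse (fps_nth f 0) = 1" by (simp add: inverse_mult_eq_1')
      then have "f * fps_right_inverse f (inverse (fps_nth f 0)) = 1" by (rule fps_right_inverse)
      then have "z \<otimes>\<^bsub>N\<^esub> cl (fps_right_inverse f (inverse (fps_nth f 0))) = \<one>\<^bsub>N\<^esub>"
        by (simp add: f mult one)
      then show ?thesis using carrier by blast
    next
      case True
      have split: "g = fps_const (fps_nth g 0) + fps_X * fps_shift 1 g" for g :: "'c::comm_ring_1 fps"
        by (rule fps_ext) (simp add: fps_X_mult_nth)
      have "fps_const (fps_nth f 0) = ?x * fps_const (fps_shift 1 (fps_nth f 0))"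
        using split[of "fps_nth f 0"] True by simp
      then have "f = ?x * fps_const (fps_shift 1 (fps_nth f 0)) + ?y * fps_shift 1 f"
        using split[of f] by simp
      then have "z = cl ?x \<otimes>\<^bsub>N\<^esub> cl (fps_const (fps_shift 1 (fps_nth f 0))) \<oplus>\<^bsub>N\<^esub> cl ?y \<otimes>\<^bsub>N\<^esub> cl (fps_shift 1 f)"
        by (simp add: f mult add)
      then show ?thesis using carrier by blast
    qed
  qed
  ultimately show "\<exists>x\<in>carrier N. \<exists>y\<in>carrier N. x \<otimes>\<^bsub>N\<^esub> y = \<zero>\<^bsub>N\<^esub> \<and> x \<noteq> \<zero>\<^bsub>N\<^esub> \<and> y \<noteq> \<zero>\<^bsub>N\<^esub> \<and>
      (\<forall>z\<in>carrier N. (\<exists>w\<in>carrier N. z \<otimes>\<^bsub>N\<^esub> w = \<one>\<^bsub>N\<^esub>) \<or>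
        (\<exists>f\<in>carrier N. \<exists>g\<in>carrier N. z = x \<otimes>\<^bsub>N\<^esub> f \<oplus>\<^bsub>N\<^esub> y \<otimes>\<^bsub>N\<^esub> g))"
    using carrier by blast
qed


section \<open>The local ring at a point of a plane curve\<close>

lemma fractions_atI:
  "homogeneous n A \<Longrightarrow> homogeneous n B \<Longrightarrow> eval_at B p \<noteq> 0 \<Longrightarrow> (A, B) \<in> fractions_at p"
  by (auto simp: fractions_at_def)

lemma fractions_at_mult:
  fixes A B C D :: "'k::idom ternary"
  assumes "(A, B) \<in> fractions_at p" "(C, D) \<in> fractions_at p"
  shows "(A * C, B * D) \<in> fractions_at p"
proof -
  obtain n k where "homogeneous n A" "homogeneous n B" "homogeneous k C" "homogeneous k D"
      "eval_at B p \<noteq> 0" "eval_at D p \<noteq> 0"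
    using assms by (auto simp: fractions_at_def)
  then show ?thesis by (intro fractions_atI[of "n + k"] homogeneous_mult) (simp_all add: eval_at.hom_mult)
qed

lemma fractions_at_add:
  fixes A B C D :: "'k::idom ternary"
  assumes "(A, B) \<in> fractions_at p" "(C, D) \<in> fractions_at p"
  shows "(A * D + C * B, B * D) \<in> fractions_at p"
proof -
  obtain n k where *: "homogeneous n A" "homogeneous n B" "homogeneous k C" "homogeneous k D"
      "eval_at B p \<noteq> 0" "eval_at D p \<noteq> 0"
    using assms by (auto simp: fractions_at_def)
  have "homogeneous (n + k) (C * B)" using homogeneous_mult[OF *(3,2)] by (simp add: add.commute)
  then show ?thesis
    using homogeneous_mult[OF *(1,4)] homogeneous_mult[OF *(2,4)] *(5,6)
    by (intro fractions_atI[of "n + k"] homogeneous_add) (simp_all add: eval_at.hom_mult)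
qed

lemma fractions_at_one: "(1, 1 :: 'k::comm_ring_1 ternary) \<in> fractions_at p"
  by (intro fractions_atI[of 0]) simp_all

lemma fractions_at_zero: "(0, 1 :: 'k::comm_ring_1 ternary) \<in> fractions_at p"
  by (intro fractions_atI[of 0]) simp_all

lemma fractions_at_uminus:
  "(A, B :: 'k::comm_ring_1 ternary) \<in> fractions_at p \<Longrightarrow> (- A, B) \<in> fractions_at p"
  by (auto simp: fractions_at_def intro: homogeneous_uminus)

lemma fraction_relI:
  "(A, B) \<in> fractions_at p \<Longrightarrow> (C, D) \<in> fractions_at p \<Longrightarrow> homogeneous n E \<Longrightarrow> eval_at E p \<noteq> 0 \<Longrightarrow>
    F dvd E * (A * D - C * B) \<Longrightarrow> ((A, B), (C, D)) \<in> fraction_rel F p"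
  unfolding fraction_rel_def by auto

lemma fraction_relE:
  assumes "((A, B), (C, D)) \<in> fraction_rel F p"
  obtains E n where "(A, B) \<in> fractions_at p" "(C, D) \<in> fractions_at p" "homogeneous n E"
    "eval_at E p \<noteq> 0" "F dvd E * (A * D - C * B)"
  using assms unfolding fraction_rel_def by auto

lemma fraction_rel_equiv:
  fixes F :: "'k::idom ternary"
  shows "equiv (fractions_at p) (fraction_rel F p)"
proof (rule equivI)
  show "fraction_rel F p \<subseteq> fractions_at p \<times> fractions_at p" by (auto simp: fraction_rel_def)
  show "refl_on (fractions_at p) (fraction_rel F p)"
    by (auto intro!: refl_onI fraction_relI[of _ _ _ _ _ 0 1] simp: eval_at.hom_one)
  show "sym (fraction_rel F p)"
  proof (rule symI, clarify)
    fix A B C D assume "((A, B), (C, D)) \<in> fraction_rel F p"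
    then obtain E n where *: "(A, B) \<in> fractions_at p" "(C, D) \<in> fractions_at p" "homogeneous n E"
        "eval_at E p \<noteq> 0" "F dvd E * (A * D - C * B)" by (rule fraction_relE)
    have "E * (C * B - A * D) = - (E * (A * D - C * B))" by (simp add: algebra_simps)
    then have "F dvd E * (C * B - A * D)" using *(5) by (simp only: dvd_minus_iff)
    then show "((C, D), (A, B)) \<in> fraction_rel F p" by (rule fraction_relI[OF *(2,1,3,4)])
  qed
  show "trans (fraction_rel F p)"
  proof (rule transI, clarify)
    fix A B C D G H
    assume "((A, B), (C, D)) \<in> fraction_rel F p" "((C, D), (G, H)) \<in> fraction_rel F p"
    then obtain E n E' n' where *: "(A, B) \<in> fractions_at p" "(C, D) \<in> fractions_at p"
        "homogeneous n E" "eval_at E p \<noteq> 0" "F dvd E * (A * D - C * B)"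
        "(G, H) \<in> fractions_at p" "homogeneous n' E'" "eval_at E' p \<noteq> 0" "F dvd E' * (C * H - G * D)"
      by (elim fraction_relE)
    obtain k where D: "homogeneous k D" "eval_at D p \<noteq> 0" using *(2) by (auto simp: fractions_at_def)
    have "(E * E' * D) * (A * H - G * B) = E' * H * (E * (A * D - C * B)) + E * B * (E' * (C * H - G * D))"
      by (simp add: algebra_simps)
    also have "F dvd \<dots>" by (intro dvd_add dvd_mult *)
    finally show "((A, B), (G, H)) \<in> fraction_rel F p"
      by (rule fraction_relI[OF *(1,6) homogeneous_mult[OF homogeneous_mult[OF *(3,7)] D(1)], rotated])
         (simp add: eval_at.hom_mult * D)
  qed
qed

lemma fraction_class_eq_iff:
  fixes F :: "'k::idom ternary"
  assumes "(A, B) \<in> fractions_at p" "(C, D) \<in> fractions_at p"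
  shows "fraction_class F p A B = fraction_class F p C D \<longleftrightarrow> ((A, B), (C, D)) \<in> fraction_rel F p"
  unfolding fraction_class_def using eq_equiv_class_iff[OF fraction_rel_equiv assms] .

lemma fraction_class_eqI:
  fixes F :: "'k::idom ternary"
  assumes "(A, B) \<in> fractions_at p" "(C, D) \<in> fractions_at p" "A * D = C * B"
  shows "fraction_class F p A B = fraction_class F p C D"
  unfolding fraction_class_eq_iff[OF assms(1,2)]
  by (rule fraction_relI[OF assms(1,2), of 0 1]) (simp_all add: eval_at.hom_one assms(3))

lemma local_ring_mult:
  fixes F :: "'k::idom ternary"
  assumes "(A, B) \<in> fractions_at p" "(C, D) \<in> fractions_at p"
  shows "fraction_class F p A B \<otimes>\<^bsub>local_ring F p\<^esub> fraction_class F p C D = fraction_class F p (A * C) (B * D)"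
proof -
  have "fraction_class F p (fst x * fst y) (snd x * snd y) = fraction_class F p (A * C) (B * D)"
    if x: "x \<in> fraction_class F p A B" and y: "y \<in> fraction_class F p C D" for x y
  proof -
    obtain A' B' C' D' where xy: "x = (A', B')" "y = (C', D')" by fastforce
    have "((A, B), (A', B')) \<in> fraction_rel F p" "((C, D), (C', D')) \<in> fraction_rel F p"
      using x y by (auto simp: fraction_class_def xy)
    then obtain E n E' n' where *: "(A', B') \<in> fractions_at p" "(C', D') \<in> fractions_at p"
        "homogeneous n E" "eval_at E p \<noteq> 0" "F dvd E * (A * B' - A' * B)"
        "homogeneous n' E'" "eval_at E' p \<noteq> 0" "F dvd E' * (C * D' - C' * D)"
      by (elim fraction_relE)
    have "(E * E') * (A * C * (B' * D') - A' * C' * (B * D)) =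
        E' * C * D' * (E * (A * B' - A' * B)) + E * A' * B * (E' * (C * D' - C' * D))"
      by (simp add: algebra_simps)
    also have "F dvd \<dots>" by (intro dvd_add dvd_mult *)
    finally have "((A * C, B * D), (A' * C', B' * D')) \<in> fraction_rel F p"
      by (rule fraction_relI[OF fractions_at_mult[OF assms] fractions_at_mult[OF *(1,2)]
            homogeneous_mult[OF *(3,6)], rotated])
         (simp add: eval_at.hom_mult *)
    then show ?thesis
      using fraction_class_eq_iff[OF fractions_at_mult[OF assms] fractions_at_mult[OF *(1,2)], of F]
      by (simp add: xy)
  qed
  moreover have "(A, B) \<in> fraction_class F p A B" "(C, D) \<in> fraction_class F p C D"
    unfolding fraction_class_def using equiv_class_self[OF fraction_rel_equiv] assms by blast+
  ultimately show ?thesis unfolding local_ring_def by (simp, blast)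
qed

lemma local_ring_add:
  fixes F :: "'k::idom ternary"
  assumes "(A, B) \<in> fractions_at p" "(C, D) \<in> fractions_at p"
  shows "fraction_class F p A B \<oplus>\<^bsub>local_ring F p\<^esub> fraction_class F p C D =
    fraction_class F p (A * D + C * B) (B * D)"
proof -
  have "fraction_class F p (fst x * snd y + fst y * snd x) (snd x * snd y) =
      fraction_class F p (A * D + C * B) (B * D)"
    if x: "x \<in> fraction_class F p A B" and y: "y \<in> fraction_class F p C D" for x y
  proof -
    obtain A' B' C' D' where xy: "x = (A', B')" "y = (C', D')" by fastforce
    have "((A, B), (A', B')) \<in> fraction_rel F p" "((C, D), (C', D')) \<in> fraction_rel F p"
      using x y by (auto simp: fraction_class_def xy)
    then obtain E n E' n' where *: "(A', B') \<in> fractions_at p" "(C', D') \<in> fractions_at p"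
        "homogeneous n E" "eval_at E p \<noteq> 0" "F dvd E * (A * B' - A' * B)"
        "homogeneous n' E'" "eval_at E' p \<noteq> 0" "F dvd E' * (C * D' - C' * D)"
      by (elim fraction_relE)
    have "(E * E') * ((A * D + C * B) * (B' * D') - (A' * D' + C' * B') * (B * D)) =
        E' * D * D' * (E * (A * B' - A' * B)) + E * B * B' * (E' * (C * D' - C' * D))"
      by (simp add: algebra_simps)
    also have "F dvd \<dots>" by (intro dvd_add dvd_mult *)
    finally have "((A * D + C * B, B * D), (A' * D' + C' * B', B' * D')) \<in> fraction_rel F p"
      by (rule fraction_relI[OF fractions_at_add[OF assms] fractions_at_add[OF *(1,2)]
            homogeneous_mult[OF *(3,6)], rotated])
         (simp add: eval_at.hom_mult *)
    then show ?thesis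
      using fraction_class_eq_iff[OF fractions_at_add[OF assms] fractions_at_add[OF *(1,2)], of F]
      by (simp add: xy)
  qed
  moreover have "(A, B) \<in> fraction_class F p A B" "(C, D) \<in> fraction_class F p C D"
    unfolding fraction_class_def using equiv_class_self[OF fraction_rel_equiv] assms by blast+
  ultimately show ?thesis unfolding local_ring_def by (simp, blast)
qed

lemma local_ring_carrierE:
  assumes "x \<in> carrier (local_ring F p)"
  obtains A B where "x = fraction_class F p A B" "(A, B) \<in> fractions_at p"
  using assms by (auto simp: local_ring_def fraction_class_def elim!: quotientE)

lemma local_ring_carrierI:
  "(A, B) \<in> fractions_at p \<Longrightarrow> fraction_class F p A B \<in> carrier (local_ring F p)"
  by (auto simp: local_ring_def fraction_class_def intro: quotientI)

lemma local_ring_one: "\<one>\<^bsub>local_ring F p\<^esub> = fraction_class F p 1 1"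
  and local_ring_zero: "\<zero>\<^bsub>local_ring F p\<^esub> = fraction_class F p 0 1"
  by (simp_all add: local_ring_def)

lemma local_ring_cring:
  fixes F :: "'k::idom ternary"
  shows "cring (local_ring F p)"
proof -
  let ?R = "local_ring F p"
  note rules = local_ring_mult local_ring_add fractions_at_mult fractions_at_add
    fractions_at_one fractions_at_zero local_ring_one local_ring_zero
  show ?thesis
  proof (intro cringI abelian_groupI comm_monoidI)
    show "\<one>\<^bsub>?R\<^esub> \<in> carrier ?R" "\<zero>\<^bsub>?R\<^esub> \<in> carrier ?R"
      unfolding local_ring_one local_ring_zero
      by (intro local_ring_carrierI fractions_at_one fractions_at_zero)+
  next
    fix x y assume "x \<in> carrier ?R" "y \<in> carrier ?R"
    then obtain A B C D where x: "x = fraction_class F p A B" "(A, B) \<in> fractions_at p"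
      and y: "y = fraction_class F p C D" "(C, D) \<in> fractions_at p"
      by (metis local_ring_carrierE)
    show "x \<oplus>\<^bsub>?R\<^esub> y \<in> carrier ?R"
      using x(2) y(2) by (simp add: x y rules local_ring_carrierI)
    show "x \<otimes>\<^bsub>?R\<^esub> y \<in> carrier ?R"
      using x(2) y(2) by (simp add: x y rules local_ring_carrierI)
    show "x \<oplus>\<^bsub>?R\<^esub> y = y \<oplus>\<^bsub>?R\<^esub> x"
      using x(2) y(2) by (simp add: x y rules algebra_simps)
    show "x \<otimes>\<^bsub>?R\<^esub> y = y \<otimes>\<^bsub>?R\<^esub> x"
      using x(2) y(2) by (simp add: x y rules algebra_simps)
  next
    fix x y z
    assume "x \<in> carrier ?R" "y \<in> carrier ?R" "z \<in> carrier ?R"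
    then obtain A B C D G H where x: "x = fraction_class F p A B" "(A, B) \<in> fractions_at p"
      and y: "y = fraction_class F p C D" "(C, D) \<in> fractions_at p"
      and z: "z = fraction_class F p G H" "(G, H) \<in> fractions_at p"
      by (metis local_ring_carrierE)
    show "x \<oplus>\<^bsub>?R\<^esub> y \<oplus>\<^bsub>?R\<^esub> z = x \<oplus>\<^bsub>?R\<^esub> (y \<oplus>\<^bsub>?R\<^esub> z)"
      using x(2) y(2) z(2) by (simp add: x y z rules,
        intro fraction_class_eqI fractions_at_add fractions_at_mult) (simp_all add: algebra_simps)
    show "x \<otimes>\<^bsub>?R\<^esub> y \<otimes>\<^bsub>?R\<^esub> z = x \<otimes>\<^bsub>?R\<^esub> (y \<otimes>\<^bsub>?R\<^esub> z)"
      using x(2) y(2) z(2) by (simp add: x y z rules,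
        intro fraction_class_eqI fractions_at_add fractions_at_mult) (simp_all add: algebra_simps)
    show "(x \<oplus>\<^bsub>?R\<^esub> y) \<otimes>\<^bsub>?R\<^esub> z =
        x \<otimes>\<^bsub>?R\<^esub> z \<oplus>\<^bsub>?R\<^esub> y \<otimes>\<^bsub>?R\<^esub> z"
      using x(2) y(2) z(2) by (simp add: x y z rules,
        intro fraction_class_eqI fractions_at_add fractions_at_mult) (simp_all add: algebra_simps)
  next
    fix x assume "x \<in> carrier ?R"
    then obtain A B where x: "x = fraction_class F p A B" "(A, B) \<in> fractions_at p"
      by (metis local_ring_carrierE)
    show "\<zero>\<^bsub>?R\<^esub> \<oplus>\<^bsub>?R\<^esub> x = x"
      using x(2) by (simp add: x rules)
    show "\<one>\<^bsub>?R\<^esub> \<otimes>\<^bsub>?R\<^esub> x = x"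
      using x(2) by (simp add: x rules)
    have m: "(- A, B) \<in> fractions_at p" using x(2) by (rule fractions_at_uminus)
    have "fraction_class F p (- A) B \<oplus>\<^bsub>?R\<^esub> x = \<zero>\<^bsub>?R\<^esub>"
      using x(2) m by (simp add: x rules) (intro fraction_class_eqI; simp add: rules fractions_at_add[OF m x(2), simplified])
    then show "\<exists>y\<in>carrier ?R. y \<oplus>\<^bsub>?R\<^esub> x = \<zero>\<^bsub>?R\<^esub>"
      using local_ring_carrierI[OF m] by blast
  qed
qed

lemma local_max_ideal_iff:
  fixes F :: "'k::idom ternary"
  assumes "eval_at F p = 0" "(A, B) \<in> fractions_at p"
  shows "fraction_class F p A B \<in> local_max_ideal F p \<longleftrightarrow> eval_at A p = 0"
proof
  assume "eval_at A p = 0"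
  then show "fraction_class F p A B \<in> local_max_ideal F p"
    using assms(2) by (auto simp: local_max_ideal_def)
next
  assume "fraction_class F p A B \<in> local_max_ideal F p"
  then obtain C D where CD: "(C, D) \<in> fractions_at p" "eval_at C p = 0"
      "fraction_class F p A B = fraction_class F p C D"
    by (auto simp: local_max_ideal_def)
  then have "((A, B), (C, D)) \<in> fraction_rel F p" using fraction_class_eq_iff assms(2) by blast
  then obtain E W where E: "eval_at E p \<noteq> 0" "E * (A * D - C * B) = F * W"
    by (elim fraction_relE dvdE) blast
  have "eval_at D p \<noteq> 0" using CD(1) by (auto simp: fractions_at_def)
  then show "eval_at A p = 0"
    using arg_cong[OF E(2), of "\<lambda>H. eval_at H p"] E(1) assms(1) CD(2)
    by (simp add: eval_at.hom_mult eval_at.hom_minus)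
qed

lemma local_max_ideal_ideal:
  fixes F :: "'k::idom ternary"
  assumes F: "eval_at F p = 0"
  shows "ideal (local_max_ideal F p) (local_ring F p)"
proof -
  let ?R = "local_ring F p"
  interpret R: cring ?R by (rule local_ring_cring)
  have mult: "x \<otimes>\<^bsub>?R\<^esub> a \<in> local_max_ideal F p"
    if a: "a \<in> local_max_ideal F p" and x: "x \<in> carrier ?R" for a x
  proof -
    obtain A B C D where "a = fraction_class F p A B" "(A, B) \<in> fractions_at p" "eval_at A p = 0"
        "x = fraction_class F p C D" "(C, D) \<in> fractions_at p"
      using a x by (auto simp: local_max_ideal_def elim!: local_ring_carrierE)
    then show ?thesis
      by (simp add: fractions_at_mult local_ring_mult local_max_ideal_iff[OF F] eval_at.hom_mult)
  qed
  have sub: "local_max_ideal F p \<subseteq> carrier ?R"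
    by (auto simp: local_max_ideal_def intro: local_ring_carrierI)
  show ?thesis
  proof (rule idealI[OF R.ring_axioms _ mult])
    show "a \<otimes>\<^bsub>?R\<^esub> x \<in> local_max_ideal F p" if "a \<in> local_max_ideal F p" "x \<in> carrier ?R" for a x
      using mult[OF that] R.m_comm[of a x] subsetD[OF sub] that by simp
    show "subgroup (local_max_ideal F p) (add_monoid ?R)"
    proof (rule R.add.subgroupI)
      have "fraction_class F p 0 1 \<in> local_max_ideal F p"
        using local_max_ideal_iff[OF F fractions_at_zero] by simp
      then show "local_max_ideal F p \<noteq> {}" by blast
      fix a assume a: "a \<in> local_max_ideal F p"
      then have "\<ominus>\<^bsub>?R\<^esub> \<one>\<^bsub>?R\<^esub> \<otimes>\<^bsub>?R\<^esub> a \<in> local_max_ideal F p" by (intro mult) simp_all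
      moreover have "\<ominus>\<^bsub>?R\<^esub> \<one>\<^bsub>?R\<^esub> \<otimes>\<^bsub>?R\<^esub> a = \<ominus>\<^bsub>?R\<^esub> a" using sub a by (simp add: R.l_minus subsetD)
      ultimately show "\<ominus>\<^bsub>?R\<^esub> a \<in> local_max_ideal F p" by simp
      fix b assume b: "b \<in> local_max_ideal F p"
      obtain A B C D where ab: "a = fraction_class F p A B" "(A, B) \<in> fractions_at p" "eval_at A p = 0"
          "b = fraction_class F p C D" "(C, D) \<in> fractions_at p" "eval_at C p = 0"
        using a b by (auto simp: local_max_ideal_def)
      then show "a \<oplus>\<^bsub>?R\<^esub> b \<in> local_max_ideal F p"
        using local_max_ideal_iff[OF F fractions_at_add[OF ab(2,5)]]
        by (simp add: local_ring_add eval_at.hom_add eval_at.hom_mult)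
    qed (use sub in simp_all)
  qed
qed

subsection \<open>Order of vanishing\<close>

text \<open>
  In positive characteristic vanishing derivatives do not characterise the powers of the ideal of
  a point, but elements of its \<open>n\<close>-th power have vanishing derivatives of order below \<open>n\<close>, and this
  is the direction that is needed.
\<close>

fun vanishes_to :: "nat \<Rightarrow> (3 \<Rightarrow> 'k::comm_ring_1) \<Rightarrow> 'k ternary \<Rightarrow> bool" where
  "vanishes_to 0 p H = True"
| "vanishes_to (Suc n) p H = (eval_at H p = 0 \<and> (\<forall>i. vanishes_to n p (partial_deriv i H)))"

lemma vanishes_to_add: "vanishes_to n p A \<Longrightarrow> vanishes_to n p B \<Longrightarrow> vanishes_to n p (A + B)"
  by (induction n arbitrary: A B) (simp_all add: eval_at.hom_add partial_deriv_add)

lemma vanishes_to_Suc: "vanishes_to (Suc n) p H \<Longrightarrow> vanishes_to n p H"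
  by (induction n arbitrary: H) simp_all

lemma vanishes_to_mult:
  "vanishes_to k p A \<Longrightarrow> vanishes_to l p B \<Longrightarrow> vanishes_to (k + l) p (A * B)"
proof (induction "k + l" arbitrary: k l A B)
  case 0
  then show ?case by simp
next
  case (Suc n)
  have "vanishes_to n p (partial_deriv i A * B)" for i
  proof (cases k)
    case 0
    with Suc.prems(2) Suc.hyps(2) have "vanishes_to (Suc n) p B" by simp
    then have "vanishes_to n p B" by (rule vanishes_to_Suc)
    then show ?thesis using Suc.hyps(1)[of 0 n "partial_deriv i A" B] by simp
  next
    case (Suc k')
    then show ?thesis
      using Suc.hyps(1)[of k' l "partial_deriv i A" B] Suc.prems \<open>Suc n = k + l\<close> by simp
  qed
  moreover have "vanishes_to n p (A * partial_deriv i B)" for i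
  proof (cases l)
    case 0
    with Suc.prems(1) Suc.hyps(2) have "vanishes_to (Suc n) p A" by simp
    then have "vanishes_to n p A" by (rule vanishes_to_Suc)
    then show ?thesis using Suc.hyps(1)[of n 0 A "partial_deriv i B"] by simp
  next
    case (Suc l')
    then show ?thesis
      using Suc.hyps(1)[of k l' A "partial_deriv i B"] Suc.prems \<open>Suc n = k + l\<close> by simp
  qed
  moreover have "eval_at (A * B) p = 0"
    using Suc.prems Suc.hyps(2) by (cases k; cases l) (auto simp: eval_at.hom_mult)
  ultimately have "vanishes_to (Suc n) p (A * B)"
    by (simp add: partial_deriv_mult vanishes_to_add)
  then show ?case using Suc.hyps(2) by simp
qed

lemma local_max_ideal_power_vanishes:
  fixes F :: "'k::idom ternary"
  assumes F: "eval_at F p = 0"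
    and x: "x \<in> local_max_ideal F p [^]\<^bsub>ideals_set (local_ring F p)\<^esub> (n::nat)"
  obtains A B where "x = fraction_class F p A B" "(A, B) \<in> fractions_at p" "vanishes_to n p A"
proof -
  let ?R = "local_ring F p"
  interpret R: cring ?R by (rule local_ring_cring)
  have "\<exists>A B. x = fraction_class F p A B \<and> (A, B) \<in> fractions_at p \<and> vanishes_to n p A"
    using x
  proof (induction n arbitrary: x)
    case 0
    then have "x \<in> carrier ?R" by (simp only: R.ideal_power_0)
    then show ?case by (auto elim!: local_ring_carrierE)
  next
    case (Suc n)
    from Suc.prems show ?case
      unfolding R.ideal_power_Suc
    proof (induction rule: ideal_prod.induct)
      case (prod i j)
      obtain A B where A: "i = fraction_class F p A B" "(A, B) \<in> fractions_at p" "vanishes_to n p A"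
        using Suc.IH prod by blast
      obtain C D where C: "j = fraction_class F p C D" "(C, D) \<in> fractions_at p" "eval_at C p = 0"
        using prod by (auto simp: local_max_ideal_def)
      have "vanishes_to (Suc n) p (A * C)"
        using vanishes_to_mult[of n p A 1 C] A C by simp
      then show ?case
        using A C local_ring_mult fractions_at_mult by metis
    next
      case (sum s t)
      then obtain A B C D where A: "s = fraction_class F p A B" "(A, B) \<in> fractions_at p"
          "vanishes_to (Suc n) p A"
        and C: "t = fraction_class F p C D" "(C, D) \<in> fractions_at p" "vanishes_to (Suc n) p C"
        by blast
      have "vanishes_to (Suc n) p (A * D + C * B)"
        using vanishes_to_mult[of "Suc n" p A 0 D] vanishes_to_mult[of "Suc n" p C 0 B] A C
        by (intro vanishes_to_add) simp_all
      then show ?case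
        using local_ring_add[OF A(2) C(2)] fractions_at_add[OF A(2) C(2)] A(1) C(1) by metis
    qed
  qed
  then show thesis using that by blast
qed


section \<open>The Hessian at an ordinary node\<close>

abbreviation hessian :: "'k::comm_ring_1 ternary \<Rightarrow> (3 \<Rightarrow> 'k) \<Rightarrow> 3 \<Rightarrow> 3 \<Rightarrow> 'k" where
  "hessian F p i j \<equiv> eval_at (partial_deriv i (partial_deriv j F)) p"

abbreviation gradient :: "'k::comm_ring_1 ternary \<Rightarrow> (3 \<Rightarrow> 'k) \<Rightarrow> 3 \<Rightarrow> 'k" where
  "gradient F p i \<equiv> eval_at (partial_deriv i F) p"

text \<open>
  Let \<open>a = A/B\<close> and \<open>b = C/D\<close> generate the maximal ideal modulo its cube, with \<open>a b\<close> in the cube.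
  Since \<open>F\<close> and its gradient vanish at the point, an equation in the local ring can be
  differentiated: once to see that the gradients \<open>\<alpha>\<close> of \<open>A\<close> and \<open>\<gamma>\<close> of \<open>C\<close> span those of all forms
  that vanish there, and twice to see that \<open>\<alpha> \<gamma>\<^sup>T + \<gamma> \<alpha>\<^sup>T\<close> is a multiple of the Hessian.  Its principal
  minors are minus the squares of the entries of \<open>\<alpha> \<times> \<gamma>\<close>; this works in characteristic 2 as well.
\<close>

theorem ordinary_node_hessian:
  fixes F :: "'k::field ternary"
  assumes node: "ordinary_node F p" and pa: "p a \<noteq> 0"
  shows "hessian F p (a + 1) (a + 1) * hessian F p (a + 2) (a + 2) - hessian F p (a + 1) (a + 2) ^ 2 \<noteq> 0"
proof -
  let ?R = "local_ring F p" and ?I = "local_max_ideal F p"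
  have F0: "eval_at F p = 0" and F1: "gradient F p i = 0" for i
    using node by (auto simp: ordinary_node_def singular_point_def proj_zeros_def)
  interpret R: cring ?R by (rule local_ring_cring)
  have I: "ideal ?I ?R" by (rule local_max_ideal_ideal[OF F0])
  have one_I: "\<one>\<^bsub>?R\<^esub> \<notin> ?I"
    unfolding local_ring_one using local_max_ideal_iff[OF F0 fractions_at_one] by simp
  have units: "\<exists>v\<in>carrier ?R. v \<otimes>\<^bsub>?R\<^esub> u = \<one>\<^bsub>?R\<^esub>" if u: "u \<in> carrier ?R" "u \<notin> ?I" for u
  proof -
    obtain A B where A: "u = fraction_class F p A B" "(A, B) \<in> fractions_at p"
      using u(1) by (rule local_ring_carrierE)
    then have "eval_at A p \<noteq> 0" using u(2) local_max_ideal_iff[OF F0] by blast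
    then have B: "(B, A) \<in> fractions_at p" using A(2) by (auto simp: fractions_at_def)
    have "fraction_class F p B A \<otimes>\<^bsub>?R\<^esub> u = fraction_class F p (B * A) (A * B)"
      unfolding A(1) by (rule local_ring_mult[OF B A(2)])
    also have "\<dots> = \<one>\<^bsub>?R\<^esub>"
      unfolding local_ring_one
      by (rule fraction_class_eqI[OF fractions_at_mult[OF B A(2)] fractions_at_one]) (simp add: mult.commute)
    finally show ?thesis using local_ring_carrierI[OF B] by blast
  qed
  have iso: "adic_completion ?R ?I \<simeq> (node_ring :: 'k fps fps set ring)"
    using node by (simp add: ordinary_node_def completed_local_ring_def)
  obtain x y :: "'k fps fps set" where xy: "x \<in> carrier node_ring" "y \<in> carrier node_ring"
      "x \<otimes>\<^bsub>node_ring\<^esub> y = \<zero>\<^bsub>node_ring\<^esub>" "x \<noteq> \<zero>\<^bsub>node_ring\<^esub>" "y \<noteq> \<zero>\<^bsub>node_ring\<^esub>"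
      "\<forall>z\<in>carrier node_ring. (\<exists>w\<in>carrier node_ring. z \<otimes>\<^bsub>node_ring\<^esub> w = \<one>\<^bsub>node_ring\<^esub>) \<or>
      (\<exists>f\<in>carrier node_ring. \<exists>g\<in>carrier node_ring. z = x \<otimes>\<^bsub>node_ring\<^esub> f \<oplus>\<^bsub>node_ring\<^esub> y \<otimes>\<^bsub>node_ring\<^esub> g)"
    using node_ring_properties(2) by (elim bexE conjE)
  have "\<exists>a\<in>?I. \<exists>b\<in>?I. a \<otimes>\<^bsub>?R\<^esub> b \<in> ?I [^]\<^bsub>ideals_set ?R\<^esub> (3::nat) \<and>
      (\<forall>c\<in>?I. \<exists>f\<in>carrier ?R. \<exists>g\<in>carrier ?R. \<exists>r\<in>?I [^]\<^bsub>ideals_set ?R\<^esub> (3::nat).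
         c = (a \<otimes>\<^bsub>?R\<^esub> f \<oplus>\<^bsub>?R\<^esub> b \<otimes>\<^bsub>?R\<^esub> g) \<oplus>\<^bsub>?R\<^esub> r)"
    by (rule completion_node_elements[OF local_ring_cring I one_I units node_ring_properties(1) iso
          xy(1-5) bspec[OF xy(6)]])
  then obtain a' b' where ab: "a' \<in> ?I" "b' \<in> ?I"
      "a' \<otimes>\<^bsub>?R\<^esub> b' \<in> ?I [^]\<^bsub>ideals_set ?R\<^esub> (3::nat)"
    and gen: "\<forall>c\<in>?I. \<exists>f\<in>carrier ?R. \<exists>g\<in>carrier ?R. \<exists>r\<in>?I [^]\<^bsub>ideals_set ?R\<^esub> (3::nat).
       c = (a' \<otimes>\<^bsub>?R\<^esub> f \<oplus>\<^bsub>?R\<^esub> b' \<otimes>\<^bsub>?R\<^esub> g) \<oplus>\<^bsub>?R\<^esub> r"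
    by (elim bexE conjE)
  obtain A B where A: "a' = fraction_class F p A B" "(A, B) \<in> fractions_at p" "eval_at A p = 0"
    using ab(1) by (auto simp: local_max_ideal_def)
  obtain C D where C: "b' = fraction_class F p C D" "(C, D) \<in> fractions_at p" "eval_at C p = 0"
    using ab(2) by (auto simp: local_max_ideal_def)
  have BD: "eval_at B p \<noteq> 0" "eval_at D p \<noteq> 0" using A(2) C(2) by (auto simp: fractions_at_def)

  have hess: "\<exists>w. \<forall>i j. gradient A p i * gradient C p j + gradient A p j * gradient C p i =
      w * hessian F p i j"
  proof -
    obtain M L where M: "a' \<otimes>\<^bsub>?R\<^esub> b' = fraction_class F p M L" "(M, L) \<in> fractions_at p" "vanishes_to 3 p M"
      using local_max_ideal_power_vanishes[OF F0 ab(3)] by blast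
    have L: "eval_at L p \<noteq> 0" using M(2) by (auto simp: fractions_at_def)
    have M': "eval_at M p = 0" "gradient M p i = 0" "hessian M p i j = 0" for i j
      using M(3) by (simp_all add: numeral_3_eq_3)
    have "((A * C, B * D), (M, L)) \<in> fraction_rel F p"
      using M(1) local_ring_mult[OF A(2) C(2)] fraction_class_eq_iff[OF fractions_at_mult[OF A(2) C(2)] M(2)]
      by (simp add: A C)
    then obtain E W where E: "eval_at E p \<noteq> 0" "E * (A * C * L - M * (B * D)) = F * W"
      by (elim fraction_relE dvdE) blast
    have "eval_at E p * eval_at L p * (gradient A p i * gradient C p j + gradient A p j * gradient C p i) =
        eval_at W p * hessian F p i j" for i j
      using arg_cong[OF E(2), of "\<lambda>H. hessian H p i j"] F0 F1 A(3) C(3) M'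
      by (simp add: partial_deriv_mult partial_deriv_add partial_deriv_diff eval_at.hom_add
          eval_at.hom_mult eval_at.hom_minus algebra_simps)
    then have "gradient A p i * gradient C p j + gradient A p j * gradient C p i =
        (eval_at W p / (eval_at E p * eval_at L p)) * hessian F p i j" for i j
      using E(1) L by (simp add: field_simps)
    then show ?thesis by blast
  qed

  have span: "\<exists>s t. \<forall>i. gradient H p i = s * gradient A p i + t * gradient C p i"
    if H: "homogeneous 1 H" "eval_at H p = 0" for H
  proof -
    have c: "(H, variable a) \<in> fractions_at p" by (rule fractions_atI[OF H(1)]) (simp_all add: pa)
    then have "fraction_class F p H (variable a) \<in> ?I" using local_max_ideal_iff[OF F0] H(2) by blast
    from bspec[OF gen this] obtain f g r where fgr: "f \<in> carrier ?R" "g \<in> carrier ?R"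
        "r \<in> ?I [^]\<^bsub>ideals_set ?R\<^esub> (3::nat)"
        "fraction_class F p H (variable a) = (a' \<otimes>\<^bsub>?R\<^esub> f \<oplus>\<^bsub>?R\<^esub> b' \<otimes>\<^bsub>?R\<^esub> g) \<oplus>\<^bsub>?R\<^esub> r" by blast
    obtain U V where U: "f = fraction_class F p U V" "(U, V) \<in> fractions_at p"
      using fgr(1) by (rule local_ring_carrierE)
    obtain U' V' where U': "g = fraction_class F p U' V'" "(U', V') \<in> fractions_at p"
      using fgr(2) by (rule local_ring_carrierE)
    obtain M L where M: "r = fraction_class F p M L" "(M, L) \<in> fractions_at p" "vanishes_to 3 p M"
      using local_max_ideal_power_vanishes[OF F0 fgr(3)] by blast
    have nz: "eval_at V p \<noteq> 0" "eval_at V' p \<noteq> 0" "eval_at L p \<noteq> 0"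
      using U(2) U'(2) M(2) by (auto simp: fractions_at_def)
    have M': "eval_at M p = 0" "gradient M p i = 0" for i
      using M(3) by (simp_all add: numeral_3_eq_3)
    define Y where "Y = (A * U * (D * V') + C * U' * (B * V)) * L + M * (B * V * (D * V'))"
    define Z where "Z = B * V * (D * V') * L"
    note fr = fractions_at_mult[OF A(2) U(2)] fractions_at_mult[OF C(2) U'(2)]
    have YZ: "(Y, Z) \<in> fractions_at p"
      unfolding Y_def Z_def by (rule fractions_at_add[OF fractions_at_add[OF fr] M(2)])
    have "fraction_class F p H (variable a) = fraction_class F p Y Z"
      unfolding fgr(4) A(1) C(1) U(1) U'(1) M(1) Y_def Z_def
      by (simp only: local_ring_mult[OF A(2) U(2)] local_ring_mult[OF C(2) U'(2)] local_ring_add[OF fr]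
          local_ring_add[OF fractions_at_add[OF fr] M(2)])
    then have "((H, variable a), (Y, Z)) \<in> fraction_rel F p"
      using fraction_class_eq_iff[OF c YZ] by blast
    then obtain E W where E: "eval_at E p \<noteq> 0" "E * (H * Z - Y * variable a) = F * W"
      by (elim fraction_relE dvdE) blast
    have Y0: "eval_at Y p = 0"
      by (simp add: Y_def eval_at.hom_add eval_at.hom_mult A(3) C(3) M')
    have "gradient H p i * eval_at Z p = gradient Y p i * p a" for i
    proof -
      have "eval_at E p * (gradient H p i * eval_at Z p - gradient Y p i * p a) = 0"
        using arg_cong[OF E(2), of "\<lambda>H. gradient H p i"] F0 F1 H(2) Y0
        by (simp add: partial_deriv_mult partial_deriv_diff eval_at.hom_add
            eval_at.hom_mult eval_at.hom_minus algebra_simps)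
      then show ?thesis using E(1) by simp
    qed
    moreover have "gradient Y p i = eval_at (U * D * V' * L) p * gradient A p i +
        eval_at (U' * B * V * L) p * gradient C p i" for i
      by (simp add: Y_def partial_deriv_mult partial_deriv_add eval_at.hom_add
          eval_at.hom_mult A(3) C(3) M' algebra_simps)
    moreover have "eval_at Z p \<noteq> 0" using BD nz by (simp add: Z_def eval_at.hom_mult)
    ultimately have "gradient H p i = (eval_at (U * D * V' * L) p * p a / eval_at Z p) * gradient A p i +
        (eval_at (U' * B * V * L) p * p a / eval_at Z p) * gradient C p i" for i
      by (simp add: field_simps)
    then show ?thesis by blast
  qed

  define b c where "b = a + 1" and "c = a + 2"
  have abc: "a \<noteq> b" "a \<noteq> c" "b \<noteq> c" using distinct_3[of a] by (auto simp: b_def c_def)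
  define line where "line j = scalar (p a) * variable j - scalar (p j) * variable a" for j
  have "homogeneous 1 (line j)" "eval_at (line j) p = 0" for j
    unfolding line_def
    by (intro homogeneous_diff homogeneous_scalar_mult homogeneous_variable)
       (simp add: eval_at.hom_minus eval_at.hom_mult)
  then have line_span: "\<exists>s t. \<forall>i. gradient (line j) p i = s * gradient A p i + t * gradient C p i" for j
    by (rule span)
  have line_grad: "gradient (line j) p i = (if i = j then p a else 0) - (if i = a then p j else 0)"
    for i j
    by (simp add: line_def partial_deriv_diff partial_deriv_mult partial_deriv_variable
        eval_at.hom_minus eval_at.hom_mult eval_at.hom_add)
  obtain s t where "\<forall>i. gradient (line b) p i = s * gradient A p i + t * gradient C p i"
    using line_span[of b] by blast
  from this[rule_format, of b] this[rule_format, of c]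
  have st: "s * gradient A p b + t * gradient C p b = p a" "s * gradient A p c + t * gradient C p c = 0"
    using abc by (simp_all add: line_grad)
  obtain s' t' where "\<forall>i. gradient (line c) p i = s' * gradient A p i + t' * gradient C p i"
    using line_span[of c] by blast
  from this[rule_format, of b] this[rule_format, of c]
  have st': "s' * gradient A p b + t' * gradient C p b = 0" "s' * gradient A p c + t' * gradient C p c = p a"
    using abc by (simp_all add: line_grad)
  \<comment> \<open>This entry of \<open>\<alpha> \<times> \<gamma>\<close> is non-zero because the gradients of the two lines through \<open>p\<close> are independent.\<close>
  define k where "k = gradient A p b * gradient C p c - gradient A p c * gradient C p b"
  have "(s * t' - t * s') * k = (s * gradient A p b + t * gradient C p b) * (s' * gradient A p c + t' * gradient C p c) -
      (s * gradient A p c + t * gradient C p c) * (s' * gradient A p b + t' * gradient C p b)"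
    by (simp add: k_def algebra_simps)
  then have "k \<noteq> 0" using pa by (auto simp: st st')
  obtain w where w: "\<And>i j. gradient A p i * gradient C p j + gradient A p j * gradient C p i = w * hessian F p i j"
    using hess by blast
  have "w ^ 2 * (hessian F p b b * hessian F p c c - hessian F p b c ^ 2) =
      (w * hessian F p b b) * (w * hessian F p c c) - (w * hessian F p b c) ^ 2"
    by (simp add: power2_eq_square algebra_simps)
  also have "\<dots> = - (k ^ 2)"
    unfolding w[symmetric] k_def by (simp add: power2_eq_square algebra_simps)
  finally show ?thesis using \<open>k \<noteq> 0\<close> by (auto simp: b_def c_def)
qed


section \<open>Relations between the partial derivatives of a nodal curve\<close>

definition span_ideal :: "(3 \<Rightarrow> 'k::comm_ring_1 ternary) \<Rightarrow> 'k ternary set" where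
  "span_ideal f = {\<Sum>i\<in>UNIV. M i * f i |M. True}"

lemma span_idealI: "(\<Sum>i\<in>UNIV. M i * f i) \<in> span_ideal f"
  by (auto simp: span_ideal_def)

lemma component_combination:
  assumes "\<And>i. homogeneous k (f i)"
  shows "component (n + k) (\<Sum>i\<in>UNIV. M i * f i) = (\<Sum>i\<in>UNIV. component n (M i) * f i)"
  by (simp add: component_sum component_mult[OF assms])

lemma homogeneous_ideal_span:
  assumes f: "\<And>i. homogeneous k (f i)"
  shows "homogeneous_ideal (span_ideal f)"
  unfolding homogeneous_ideal_def
proof (intro conjI ballI allI)
  show "0 \<in> span_ideal f" using span_idealI[of "\<lambda>_. 0" f] by simp
next
  fix x y assume "x \<in> span_ideal f" "y \<in> span_ideal f"
  then obtain M M' where "x = (\<Sum>i\<in>UNIV. M i * f i)" "y = (\<Sum>i\<in>UNIV. M' i * f i)"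
    by (auto simp: span_ideal_def)
  then have "x + y = (\<Sum>i\<in>UNIV. (M i + M' i) * f i)" by (simp add: sum.distrib algebra_simps)
  then show "x + y \<in> span_ideal f" by (simp only: span_idealI)
next
  fix x r assume "x \<in> span_ideal f"
  then obtain M where "x = (\<Sum>i\<in>UNIV. M i * f i)" by (auto simp: span_ideal_def)
  then have "r * x = (\<Sum>i\<in>UNIV. (r * M i) * f i)" by (simp add: sum_distrib_left mult.assoc)
  then show "r * x \<in> span_ideal f" by (simp only: span_idealI)
next
  fix x n assume "x \<in> span_ideal f"
  then obtain M where x: "x = (\<Sum>i\<in>UNIV. M i * f i)" by (auto simp: span_ideal_def)
  have "component n x = (\<Sum>i\<in>UNIV. (if k \<le> n then component (n - k) (M i) else 0) * f i)"
    unfolding x component_sum component_mult[OF f] by (intro sum.cong) auto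
  then show "component n x \<in> span_ideal f" by (simp only: span_idealI)
qed

lemma span_ideal_generator: "f i \<in> span_ideal f"
proof -
  have "(\<Sum>j\<in>UNIV. (if j = i then 1 else 0) * f j) = (\<Sum>j\<in>UNIV. if j = i then f j else 0)"
    by (intro sum.cong) auto
  then show ?thesis using span_idealI[of "\<lambda>j. if j = i then 1 else 0" f] by simp
qed

lemma add_3: "i + 1 + 1 = i + 2" "i + 1 + 2 = i" "i + 2 + 1 = i" "i + 2 + 2 = i + 1" for i :: 3
  by (simp_all add: add.assoc)

text \<open>
  Indices are taken modulo 3, so this is the cross product \<open>\<omega> = x \<times> G\<close>: the coefficients of the
  1-form that arises from \<open>dx\<^sub>0 \<and> dx\<^sub>1 \<and> dx\<^sub>2\<close> by contraction with \<open>G\<close> and with the Euler field.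
\<close>

definition moment :: "(3 \<Rightarrow> 'k::comm_ring_1 ternary) \<Rightarrow> 3 \<Rightarrow> 'k ternary" where
  "moment G i = variable (i + 1) * G (i + 2) - variable (i + 2) * G (i + 1)"

lemma homogeneous_moment:
  assumes "\<And>i. homogeneous e (G i)"
  shows "homogeneous (Suc e) (moment G i)"
  using homogeneous_mult[OF homogeneous_variable(1) assms]
  by (auto simp: moment_def intro!: homogeneous_diff)

lemma variable_moment: "(\<Sum>i\<in>UNIV. variable i * moment G i) = 0"
  unfolding sum_3[of _ 0] moment_def add_3 by (simp add: algebra_simps)

locale nodal_curve =
  fixes F :: "'k::alg_closed_field ternary" and d :: nat
  assumes d: "of_nat d \<noteq> (0 :: 'k)"
    and F_nonzero: "F \<noteq> 0" and F_hom: "homogeneous d F"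
    and node: "\<And>p. singular_point F p \<Longrightarrow> ordinary_node F p"
begin

lemma d_pos: "d > 0"
  using d by (cases d) auto

lemma d_scalar: "of_nat d = scalar (of_nat d :: 'k)"
  by simp

lemma d_mult_cancel: "of_nat d * A = 0 \<Longrightarrow> A = (0 :: 'k ternary)"
  using d by (simp add: single_of_nat[symmetric] del: single_of_nat)
     (metis Poly_Mapping.single_zero inj_single injD)

lemma F_nonunit: "\<not> F dvd 1"
  using form_unit_iff[OF F_hom F_nonzero] d_pos by simp

lemma euler: "(\<Sum>i\<in>UNIV. variable i * partial_deriv i F) = of_nat d * F"
  by (rule euler_formula[OF F_hom])

lemma partial_hom: "homogeneous (d - 1) (partial_deriv i F)"
  by (rule homogeneous_partial_deriv[OF F_hom])

lemma singular_pointI: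
  assumes "p \<noteq> (\<lambda>_. 0)" "\<And>i. gradient F p i = 0"
  shows "singular_point F p"
proof -
  have "eval_at (of_nat d * F) p = 0"
    unfolding euler[symmetric] by (simp add: eval_at.hom_sum eval_at.hom_mult assms(2))
  then have "eval_at F p = 0" using d by (simp add: eval_at.hom_mult eval_at.hom_of_nat)
  then show ?thesis using assms by (simp add: singular_point_def proj_zeros_def)
qed

lemma singular_hessian:
  assumes "singular_point F p" "p a \<noteq> 0"
  shows "hessian F p (a + 1) (a + 1) * hessian F p (a + 2) (a + 2) - hessian F p (a + 1) (a + 2) ^ 2 \<noteq> 0"
  using ordinary_node_hessian[OF node[OF assms(1)] assms(2)] .

lemma hessian_sym: "hessian F p i j = hessian F p j i"
  by (subst partial_deriv_commute) (rule refl)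

text \<open>
  If all partial derivatives were multiples \<open>P A\<^sub>i\<close> of a prime \<open>P\<close>, then every zero of
  \<open>P\<close> would be singular with the Hessian \<open>(\<partial>\<^sub>i P A\<^sub>j)\<close> of rank at most 1.
\<close>

lemma prime_not_dvd_all_partials:
  assumes P: "prime_elem P"
  shows "\<exists>i. \<not> P dvd partial_deriv i F"
proof (rule ccontr)
  assume "\<not> ?thesis"
  then have "\<forall>i. \<exists>A. partial_deriv i F = P * A" by (simp add: dvd_def)
  from choice[OF this] obtain A where A: "\<And>i. partial_deriv i F = P * A i" by blast
  have "\<not> P dvd 1" using P by (rule prime_elem_not_unit)
  then obtain q where q: "q \<noteq> (\<lambda>_. 0)" "eval_at P q = 0" using curve_nullstellensatz[OF P] by blast
  have "singular_point F q" by (rule singular_pointI[OF q(1)]) (simp add: A eval_at.hom_mult q(2))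
  moreover obtain a where "q a \<noteq> 0" using q(1) by auto
  moreover have h: "hessian F q i j = gradient P q i * eval_at (A j) q" for i j
    by (simp add: A partial_deriv_mult eval_at.hom_add eval_at.hom_mult q(2))
  ultimately have "hessian F q (a + 1) (a + 1) * hessian F q (a + 2) (a + 2) -
      hessian F q (a + 1) (a + 2) * hessian F q (a + 2) (a + 1) \<noteq> 0"
    using singular_hessian[of q a] hessian_sym[of "a + 2" "a + 1" q] by (simp add: power2_eq_square)
  then show False by (simp add: h)
qed

lemma squarefree: "prime_elem P \<Longrightarrow> \<not> P * P dvd F"
proof
  assume P: "prime_elem P" and "P * P dvd F"
  from this(2) obtain B where B: "F = P * P * B" by (rule dvdE)
  have "partial_deriv i F = P * (2 * partial_deriv i P * B + P * partial_deriv i B)" for i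
    unfolding B by (simp add: partial_deriv_mult algebra_simps)
  then have "P dvd partial_deriv i F" for i by (metis dvd_triv_left)
  then show False using prime_not_dvd_all_partials[OF P] by simp
qed

lemma prime_factors_coprime:
  assumes "F = A * B" "prime_elem P" "P dvd A"
  shows "\<not> P dvd B"
  using squarefree[OF assms(2)] mult_dvd_mono[OF assms(3), of P B] assms(1) by auto

lemma prime_not_dvd_variable:
  fixes P :: "'k ternary"
  assumes P: "prime_elem P"
  shows "\<exists>a. \<not> P dvd variable a"
proof -
  obtain q where q: "q \<noteq> (\<lambda>_. 0)" "eval_at P q = 0"
    using curve_nullstellensatz[OF P prime_elem_not_unit[OF P]] by blast
  then obtain a where "q a \<noteq> 0" by auto
  have "\<not> P dvd variable a"
  proof
    assume "P dvd variable a"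
    then obtain B where "variable a = P * B" by (rule dvdE)
    from arg_cong[OF this, of "\<lambda>H. eval_at H q"] show False
      using q(2) \<open>q a \<noteq> 0\<close> by (simp add: eval_at.hom_mult)
  qed
  then show ?thesis by (rule exI)
qed


subsection \<open>The moment at the nodes\<close>

text \<open>
  The vector \<open>p\<^sub>a g - g\<^sub>a p\<close> lies in the kernel and has \<open>a\<close>-th coordinate 0; the minor formed by the
  other two rows and columns does not vanish, so the vector is 0.
\<close>

lemma hessian_kernel:
  assumes sing: "singular_point F p" and pa: "p a \<noteq> 0"
    and p: "\<And>j. (\<Sum>i\<in>UNIV. p i * hessian F p j i) = 0"
    and g: "\<And>j. (\<Sum>i\<in>UNIV. g i * hessian F p j i) = 0"
  shows "p a * g i = g a * p i"
proof -
  define b c where "b = a + 1" and "c = a + 2"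
  define r where "r i = p a * g i - g a * p i" for i
  have "(\<Sum>i\<in>UNIV. r i * hessian F p j i) = 0" for j
  proof -
    have "(\<Sum>i\<in>UNIV. r i * hessian F p j i) =
        p a * (\<Sum>i\<in>UNIV. g i * hessian F p j i) - g a * (\<Sum>i\<in>UNIV. p i * hessian F p j i)"
      by (simp add: r_def sum_distrib_left sum_subtractf algebra_simps)
    then show ?thesis by (simp add: p g)
  qed
  moreover have "r a = 0" by (simp add: r_def)
  ultimately have r: "r b * hessian F p j b + r c * hessian F p j c = 0" for j
    by (simp add: sum_3[of _ a] b_def c_def)
  define m where "m = hessian F p b b * hessian F p c c - hessian F p b c ^ 2"
  have "m \<noteq> 0" using singular_hessian[OF sing pa] by (simp add: m_def b_def c_def)
  have "r b * m = hessian F p c c * (r b * hessian F p b b + r c * hessian F p b c) -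
      hessian F p b c * (r b * hessian F p c b + r c * hessian F p c c)"
    unfolding m_def hessian_sym[of c b p] by (simp add: power2_eq_square algebra_simps)
  then have "r b = 0" using \<open>m \<noteq> 0\<close> by (simp add: r)
  have "r c * m = hessian F p b b * (r b * hessian F p c b + r c * hessian F p c c) -
      hessian F p b c * (r b * hessian F p b b + r c * hessian F p b c)"
    unfolding m_def hessian_sym[of c b p] by (simp add: power2_eq_square algebra_simps)
  then have "r c = 0" using \<open>m \<noteq> 0\<close> by (simp add: r)
  have "r i = 0" using exhaust_3[of i a] \<open>r a = 0\<close> \<open>r b = 0\<close> \<open>r c = 0\<close> by (auto simp: b_def c_def)
  then show ?thesis by (simp add: r_def)
qed

text \<open>
  Differentiating the relation and Euler's formula at a node \<open>p\<close> shows that \<open>G(p)\<close> and \<open>p\<close> lie in the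
  kernel of the Hessian, which has dimension 1.
\<close>

lemma moment_vanishes:
  assumes rel: "homogeneous_relation F e G" and sing: "singular_point F p"
  shows "eval_at (moment G i) p = 0"
proof -
  have F1: "gradient F p i = 0" for i using sing by (simp add: singular_point_def)
  have p0: "p \<noteq> (\<lambda>_. 0)" using sing by (simp add: singular_point_def proj_zeros_def)
  then obtain a where pa: "p a \<noteq> 0" by auto
  have diff: "(\<Sum>i\<in>UNIV. eval_at (A i) p * hessian F p j i) =
      eval_at (partial_deriv j (\<Sum>i\<in>UNIV. A i * partial_deriv i F)) p" for A j
    by (simp add: partial_deriv_sum partial_deriv_mult eval_at.hom_sum eval_at.hom_add eval_at.hom_mult F1)
  have "(\<Sum>i\<in>UNIV. eval_at (G i) p * hessian F p j i) = 0" for j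
    unfolding diff using rel by (simp add: homogeneous_relation_def)
  moreover have "(\<Sum>i\<in>UNIV. p i * hessian F p j i) = 0" for j
  proof -
    have "(\<Sum>i\<in>UNIV. p i * hessian F p j i) = eval_at (partial_deriv j (of_nat d * F)) p"
      using diff[of variable j] by (simp add: euler)
    also have "\<dots> = 0"
      unfolding d_scalar by (simp add: partial_deriv_mult F1 eval_at.hom_mult del: single_of_nat)
    finally show ?thesis .
  qed
  ultimately have G: "p a * eval_at (G i) p = eval_at (G a) p * p i" for i
    by (intro hessian_kernel[OF sing pa])
  have "p a * eval_at (moment G i) p =
      p (i + 1) * (p a * eval_at (G (i + 2)) p) - p (i + 2) * (p a * eval_at (G (i + 1)) p)"
    by (simp add: moment_def eval_at.hom_minus eval_at.hom_mult algebra_simps)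
  also have "\<dots> = 0" unfolding G by (simp add: algebra_simps)
  finally have "p a * eval_at (moment G i) p = 0" .
  then show ?thesis using pa by simp
qed

abbreviation jacobian_ideal :: "'k ternary set" where
  "jacobian_ideal \<equiv> span_ideal (\<lambda>i. partial_deriv i F)"

lemma partial_in_jacobian_ideal: "partial_deriv i F \<in> jacobian_ideal"
  by (rule span_ideal_generator)

lemma jacobian_ideal: "homogeneous_ideal jacobian_ideal"
  by (rule homogeneous_ideal_span[OF partial_hom])

text \<open>
  The ideal of a point \<open>p\<close> is generated by two linear forms.  Two partial derivatives are expressed
  in them by a matrix whose determinant at \<open>p\<close> is, up to a unit, a minor of the Hessian, so by
  Cramer's rule the partial derivatives generate the ideal of a node locally.
\<close>

lemma jacobian_ideal_at_node:
  assumes sing: "singular_point F p"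
  shows "\<exists>D. eval_at D p \<noteq> 0 \<and>
    (\<forall>n H. homogeneous n H \<longrightarrow> eval_at H p = 0 \<longrightarrow> D * H \<in> jacobian_ideal)"
proof -
  have F1: "gradient F p i = 0" for i using sing by (simp add: singular_point_def)
  have p0: "p \<noteq> (\<lambda>_. 0)" using sing by (simp add: singular_point_def proj_zeros_def)
  then obtain a where pa: "p a \<noteq> 0" by auto
  define b c where "b = a + 1" and "c = a + 2"
  have abc: "a \<noteq> b" "a \<noteq> c" "b \<noteq> c" using distinct_3[of a] by (auto simp: b_def c_def)
  define line where "line j = scalar (p a) * variable j - scalar (p j) * variable a" for j
  have line_hom: "homogeneous 1 (line j)" for j
    unfolding line_def by (intro homogeneous_diff homogeneous_scalar_mult homogeneous_variable)
  have line_a: "line a = 0" by (simp add: line_def)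
  have line_p: "eval_at (line j) p = 0" for j
    by (simp add: line_def eval_at.hom_minus eval_at.hom_mult)
  have line_grad: "gradient (line j) p i = (if i = j then p a else 0) - (if i = a then p j else 0)" for i j
    by (simp add: line_def partial_deriv_diff partial_deriv_mult partial_deriv_variable
        eval_at.hom_minus eval_at.hom_mult eval_at.hom_add)
  have line_ideal: "homogeneous_ideal (span_ideal line)" by (rule homogeneous_ideal_span[OF line_hom])
  have gen: "\<exists>A B. H = A * line b + B * line c" if H: "homogeneous n H" "eval_at H p = 0" for n H
  proof -
    define l where "l = scalar (inverse (p a)) * variable a"
    have "variable i - scalar (p i) * l \<in> span_ideal line" for i
    proof -
      have "variable i - scalar (p i) * l = scalar (inverse (p a)) * line i"
        using pa scalar_cancel[of "p a" "variable i"] by (simp add: line_def l_def algebra_simps)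
      then show ?thesis using homogeneous_idealD(3)[OF line_ideal span_ideal_generator] by simp
    qed
    then have "H - scalar (eval_at H p) * l ^ n \<in> span_ideal line"
      by (rule form_congruent_value[OF line_ideal _ H(1)])
    then obtain M where "H = (\<Sum>j\<in>UNIV. M j * line j)" using H(2) by (auto simp: span_ideal_def)
    then have "H = M b * line b + M c * line c" by (simp add: sum_3[of _ a] line_a b_def c_def)
    then show ?thesis by blast
  qed
  obtain A B where AB: "partial_deriv b F = A * line b + B * line c" using gen[OF partial_hom F1] by blast
  obtain A' B' where AB': "partial_deriv c F = A' * line b + B' * line c" using gen[OF partial_hom F1] by blast
  have hess: "hessian F p b b = eval_at A p * p a" "hessian F p c b = eval_at B p * p a"
      "hessian F p b c = eval_at A' p * p a" "hessian F p c c = eval_at B' p * p a"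
    unfolding AB AB' using abc
    by (simp_all add: partial_deriv_add partial_deriv_mult eval_at.hom_add eval_at.hom_mult line_p line_grad)
  define D where "D = A * B' - A' * B"
  have "p a ^ 2 * eval_at D p = hessian F p b b * hessian F p c c - hessian F p b c * hessian F p c b"
    unfolding hess D_def by (simp add: eval_at.hom_minus eval_at.hom_mult power2_eq_square algebra_simps)
  also have "\<dots> \<noteq> 0"
    using singular_hessian[OF sing pa] unfolding hessian_sym[of c b p] b_def[symmetric] c_def[symmetric]
    by (simp add: power2_eq_square)
  finally have "eval_at D p \<noteq> 0" by auto
  moreover have "D * H \<in> jacobian_ideal" if H: "homogeneous n H" "eval_at H p = 0" for n H
  proof -
    obtain U V where "H = U * line b + V * line c" using gen[OF H] by blast
    then have "D * H = (U * B' - V * A') * partial_deriv b F + (V * A - U * B) * partial_deriv c F"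
      unfolding AB AB' D_def by (simp add: algebra_simps)
    also have "\<dots> \<in> jacobian_ideal"
      by (intro homogeneous_idealD(2,3)[OF jacobian_ideal] partial_in_jacobian_ideal)
    finally show ?thesis .
  qed
  ultimately show ?thesis by blast
qed

text \<open>
  The moment vanishes at the nodes, hence lies locally in the Jacobian ideal; by the projective
  Nullstellensatz all forms of some degree multiply it into the Jacobian ideal.
\<close>

lemma moment_in_jacobian_ideal:
  assumes rel: "homogeneous_relation F e G"
  shows "\<exists>n. \<forall>E. homogeneous n E \<longrightarrow> (\<forall>k. E * moment G k \<in> jacobian_ideal)"
proof -
  have G: "homogeneous e (G i)" for i using rel by (simp add: homogeneous_relation_def)
  define Q where "Q = {E. \<forall>k. E * moment G k \<in> jacobian_ideal}"
  note D = homogeneous_idealD[OF jacobian_ideal]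
  have "homogeneous_ideal Q"
    unfolding homogeneous_ideal_def
  proof (intro conjI ballI allI)
    show "0 \<in> Q" using D(1) by (simp add: Q_def)
    show "x + y \<in> Q" if "x \<in> Q" "y \<in> Q" for x y
      using that D(2) by (auto simp: Q_def distrib_right)
    show "r * x \<in> Q" if "x \<in> Q" for x r
      using that D(3) by (auto simp: Q_def mult.assoc)
    show "component n x \<in> Q" if "x \<in> Q" for x n
      using that D(4)[of "x * moment G _" "n + Suc e"]
      by (auto simp: Q_def component_mult[OF homogeneous_moment[OF G]])
  qed
  moreover have "\<exists>f\<in>Q. eval_at f p \<noteq> 0" if p: "p \<noteq> (\<lambda>_. 0)" for p
  proof (cases "\<exists>i. gradient F p i \<noteq> 0")
    case True
    moreover have "partial_deriv i F \<in> Q" for i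
      using D(3)[OF partial_in_jacobian_ideal[of i]] by (simp add: Q_def mult.commute[of "partial_deriv i F"])
    ultimately show ?thesis by blast
  next
    case False
    then have sing: "singular_point F p" using p by (intro singular_pointI) auto
    obtain E where E: "eval_at E p \<noteq> 0"
        "\<And>n H. homogeneous n H \<Longrightarrow> eval_at H p = 0 \<Longrightarrow> E * H \<in> jacobian_ideal"
      using jacobian_ideal_at_node[OF sing] by blast
    have "E \<in> Q"
      using E(2)[OF homogeneous_moment[OF G] moment_vanishes[OF rel sing]] by (simp add: Q_def)
    then show ?thesis using E(1) by blast
  qed
  ultimately obtain n where "contains_degree n Q" using projective_nullstellensatz by metis
  then show ?thesis by (auto simp: contains_degree_def Q_def)
qed


subsection \<open>The residue of a relation is constant on every component\<close>

lemma moment_cross: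
  assumes "homogeneous_relation F e G"
  shows "moment G i * partial_deriv (i + 1) F - moment G (i + 1) * partial_deriv i F = of_nat d * F * G (i + 2)"
proof -
  have rel: "G i * partial_deriv i F + G (i + 1) * partial_deriv (i + 1) F + G (i + 2) * partial_deriv (i + 2) F = 0"
    using assms by (simp add: homogeneous_relation_def sum_3[of _ i])
  have eu: "variable i * partial_deriv i F + variable (i + 1) * partial_deriv (i + 1) F +
      variable (i + 2) * partial_deriv (i + 2) F = of_nat d * F"
    using euler by (simp add: sum_3[of _ i])
  have "moment G i * partial_deriv (i + 1) F - moment G (i + 1) * partial_deriv i F =
      G (i + 2) * (variable i * partial_deriv i F + variable (i + 1) * partial_deriv (i + 1) F +
        variable (i + 2) * partial_deriv (i + 2) F) -
      variable (i + 2) * (G i * partial_deriv i F + G (i + 1) * partial_deriv (i + 1) F +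
        G (i + 2) * partial_deriv (i + 2) F)"
    unfolding moment_def add_3 by (simp only: algebra_simps)
  then show ?thesis by (simp only: rel eu) (simp add: algebra_simps)
qed

lemma moment_parallel:
  assumes "homogeneous_relation F e G"
  shows "F dvd moment G i * partial_deriv j F - moment G j * partial_deriv i F"
proof -
  have succ: "F dvd moment G i * partial_deriv (i + 1) F - moment G (i + 1) * partial_deriv i F" for i
    unfolding moment_cross[OF assms] by simp
  consider "j = i" | "j = i + 1" | "j = i + 2" using exhaust_3 by blast
  then show ?thesis
  proof cases
    case 3
    have "F dvd - (moment G j * partial_deriv (j + 1) F - moment G (j + 1) * partial_deriv j F)"
      using succ by (simp only: dvd_minus_iff)
    also have "j + 1 = i" by (simp add: 3 add_3)
    finally show ?thesis by simp
  qed (use succ in simp_all)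
qed

lemma moment_zero_imp_zero:
  assumes "homogeneous_relation F e G" "\<And>k. moment G k = 0"
  shows "G i = 0"
proof -
  have "of_nat d * (F * G (i + 1 + 2)) = 0"
    using moment_cross[OF assms(1), of "i + 1"] by (simp add: assms(2) mult.assoc)
  then have "F * G (i + 1 + 2) = 0" by (rule d_mult_cancel)
  then show ?thesis using F_nonzero by (simp add: add_3)
qed

text \<open>
  The quotient \<open>\<rho> = \<omega>\<^sub>i/F\<^sub>i\<close> (the residue of \<open>\<omega>/F\<close>) has degree 0 and does not depend on \<open>i\<close> modulo
  \<open>P\<close>.  Multiplication by \<open>\<rho>\<close> maps the space of all \<open>\<Sum> M\<^sub>i F\<^sub>i\<close> with \<open>M\<^sub>i\<close> of a fixed large degree to
  itself modulo \<open>P\<close>, so iterating it on a vector \<open>h\<^sub>0\<close> produces a linear dependence.  This is a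
  binary form in \<open>(F\<^sub>j, \<omega>\<^sub>j)\<close> divisible by \<open>P\<close>, hence \<open>\<rho>\<close> is constant.
\<close>

theorem residue_constant:
  assumes rel: "homogeneous_relation F e G" and e: "e + 2 = d"
    and P: "prime_elem P" "P dvd F"
  shows "\<exists>c. \<forall>k. P dvd moment G k - scalar c * partial_deriv k F"
proof -
  have G: "homogeneous e (G i)" for i using rel by (simp add: homogeneous_relation_def)
  have "Suc e = d - 1" using e by simp
  then have W: "homogeneous (d - 1) (moment G i)" for i using homogeneous_moment[OF G] by simp
  obtain n where n: "\<And>E k. homogeneous n E \<Longrightarrow> E * moment G k \<in> jacobian_ideal"
    using moment_in_jacobian_ideal[OF rel] by blast
  have step: "\<exists>M'. (\<forall>i. homogeneous n (M' i)) \<and>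
      (\<Sum>i\<in>UNIV. M i * moment G i) = (\<Sum>i\<in>UNIV. M' i * partial_deriv i F)"
    if M: "\<forall>i. homogeneous n (M i)" for M
  proof -
    have "(\<Sum>i\<in>UNIV. M i * moment G i) \<in> jacobian_ideal"
      using n M by (intro ideal_sum_mem[OF jacobian_ideal]) blast
    then obtain A where "(\<Sum>i\<in>UNIV. M i * moment G i) = (\<Sum>i\<in>UNIV. A i * partial_deriv i F)"
      by (auto simp: span_ideal_def)
    note A = this
    have comp: "component n (M i) = M i" for i using M homogeneous_iff_component by blast
    from arg_cong[OF A, of "component (n + (d - 1))"]
    have "(\<Sum>i\<in>UNIV. M i * moment G i) = (\<Sum>i\<in>UNIV. component n (A i) * partial_deriv i F)"
      unfolding component_combination[OF W] component_combination[OF partial_hom] comp .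
    then show ?thesis
      by (intro exI[of _ "\<lambda>i. component n (A i)"]) (simp add: homogeneous_component)
  qed
  obtain a where a: "\<not> P dvd variable a" using prime_not_dvd_variable[OF P(1)] by blast
  obtain j where j: "\<not> P dvd partial_deriv j F" using prime_not_dvd_all_partials[OF P(1)] by blast
  define M0 :: "3 \<Rightarrow> 'k ternary" where "M0 i = (if i = j then variable a ^ n else 0)" for i
  have "homogeneous n (variable a ^ n)" using homogeneous_power[OF homogeneous_variable(1), of n a] by simp
  then have M0: "\<forall>i. homogeneous n (M0 i)" by (simp add: M0_def)
  define s where "s M = (SOME M'. (\<forall>i. homogeneous n (M' i)) \<and>
      (\<Sum>i\<in>UNIV. M i * moment G i) = (\<Sum>i\<in>UNIV. M' i * partial_deriv i F))" for M
  have s: "(\<forall>i. homogeneous n (s M i)) \<and>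
      (\<Sum>i\<in>UNIV. M i * moment G i) = (\<Sum>i\<in>UNIV. s M i * partial_deriv i F)"
    if "\<forall>i. homogeneous n (M i)" for M
    unfolding s_def by (rule someI_ex[OF step[OF that]])
  define M where "M m = (s ^^ m) M0" for m
  have M: "\<forall>i. homogeneous n (M m i)" for m
    by (induction m) (simp_all add: M_def M0 s)
  define h where "h m = (\<Sum>i\<in>UNIV. M m i * partial_deriv i F)" for m
  have h_Suc: "h (Suc m) = (\<Sum>i\<in>UNIV. M m i * moment G i)" for m
    using s[OF M[of m]] by (simp add: h_def M_def)
  have h_hom: "homogeneous (n + (d - 1)) (h m)" for m
    unfolding h_def using M partial_hom by (intro homogeneous_sum homogeneous_mult) auto
  have "h 0 = variable a ^ n * partial_deriv j F"
  proof -
    have "h 0 = (\<Sum>i\<in>UNIV. if i = j then variable a ^ n * partial_deriv i F else 0)"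
      unfolding h_def M_def M0_def by (intro sum.cong) auto
    then show ?thesis by simp
  qed
  then have h0: "\<not> P dvd h 0"
    using a j by (auto dest: prime_elem_dvd_multD[OF P(1)] prime_elem_dvd_power[OF P(1)])
  have quot: "P dvd partial_deriv j F * h (Suc m) - moment G j * h m" for m
  proof -
    have "partial_deriv j F * h (Suc m) - moment G j * h m =
        (\<Sum>i\<in>UNIV. M m i * (moment G i * partial_deriv j F - moment G j * partial_deriv i F))"
      unfolding h_Suc unfolding h_def[of m] by (simp add: sum_distrib_left sum_subtractf algebra_simps)
    also have "F dvd \<dots>" by (intro dvd_sum dvd_mult moment_parallel[OF rel])
    finally show ?thesis using P(2) dvd_trans by metis
  qed
  have power: "P dvd partial_deriv j F ^ m * h m - moment G j ^ m * h 0" for m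
  proof (induction m)
    case (Suc m)
    have "partial_deriv j F ^ Suc m * h (Suc m) - moment G j ^ Suc m * h 0 =
        partial_deriv j F ^ m * (partial_deriv j F * h (Suc m) - moment G j * h m) +
        moment G j * (partial_deriv j F ^ m * h m - moment G j ^ m * h 0)"
      by (simp add: algebra_simps)
    also have "P dvd \<dots>" by (intro dvd_add dvd_mult quot Suc)
    finally show ?case .
  qed simp
  define E where "E = card {m :: 3 \<Rightarrow>\<^sub>0 nat. monomial_degree m = n + (d - 1)}"
  have "card {m :: 3 \<Rightarrow>\<^sub>0 nat. monomial_degree m = n + (d - 1)} < card {..E}" by (simp add: E_def)
  then obtain c where c: "\<exists>m\<in>{..E}. c m \<noteq> 0" "(\<Sum>m\<le>E. scalar (c m) * h m) = 0"
    by (rule dependent_forms[OF finite_atMost _ h_hom])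
  define f where "f = (\<Sum>m\<le>E. monom (c m) m)"
  have coeff_f: "coeff f m = (if m \<le> E then c m else 0)" for m by (simp add: f_def coeff_sum)
  have f: "f \<noteq> 0" "degree f \<le> E"
    using c coeff_f by (auto intro!: degree_le) (metis coeff_0)
  have "homogenized E f (partial_deriv j F) (moment G j) * h 0 =
      (\<Sum>m\<le>E. - (scalar (c m) * partial_deriv j F ^ (E - m) *
        (partial_deriv j F ^ m * h m - moment G j ^ m * h 0))) +
      partial_deriv j F ^ E * (\<Sum>m\<le>E. scalar (c m) * h m)"
  proof -
    have "partial_deriv j F ^ E = partial_deriv j F ^ (E - m) * partial_deriv j F ^ m" if "m \<le> E" for m
      using that by (simp flip: power_add)
    then show ?thesis
      unfolding homogenized_def sum_distrib_left sum_distrib_right sum.distrib[symmetric]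
      by (intro sum.cong) (simp_all add: coeff_f algebra_simps)
  qed
  also have "\<dots> = (\<Sum>m\<le>E. - (scalar (c m) * partial_deriv j F ^ (E - m) *
        (partial_deriv j F ^ m * h m - moment G j ^ m * h 0)))"
    by (simp add: c(2))
  also have "P dvd \<dots>" unfolding sum_negf dvd_minus_iff by (intro dvd_sum dvd_mult power)
  finally have "P dvd homogenized E f (partial_deriv j F) (moment G j)"
    using h0 prime_elem_dvd_multD[OF P(1)] by metis
  then have "\<exists>c. moment G j - scalar c * partial_deriv j F \<in> {x. P dvd x}"
    by (intro binary_form_in_prime[of "{x. P dvd x}" "\<lambda>_. True", OF _ _ _ _ _ _ f])
       (use j prime_elem_dvd_multD[OF P(1)] in \<open>auto intro: dvd_mult\<close>)
  then obtain c where c: "P dvd moment G j - scalar c * partial_deriv j F" by blast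
  have "P dvd moment G k - scalar c * partial_deriv k F" for k
  proof -
    have "partial_deriv j F * (moment G k - scalar c * partial_deriv k F) =
        (moment G k * partial_deriv j F - moment G j * partial_deriv k F) +
        partial_deriv k F * (moment G j - scalar c * partial_deriv j F)"
      by (simp add: algebra_simps)
    also have "P dvd \<dots>"
      using dvd_trans[OF P(2) moment_parallel[OF rel]] c by (intro dvd_add dvd_mult)
    finally show ?thesis using j prime_elem_dvd_multD[OF P(1)] by metis
  qed
  then show ?thesis by blast
qed

end


context nodal_curve begin

subsection \<open>Degrees of relations\<close>

text \<open>
  For irreducible \<open>F\<close> the congruence \<open>\<omega> \<equiv> c dF\<close> modulo \<open>F\<close> is an equality for degree reasons;
  pairing with the Euler field gives \<open>0 = c d F\<close>.
\<close>

lemma irreducible_no_relation: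
  assumes rel: "homogeneous_relation F e G" and e: "e + 2 = d" and F: "prime_elem F"
  shows "G i = 0"
proof -
  have G: "homogeneous e (G i)" for i using rel by (simp add: homogeneous_relation_def)
  have W: "homogeneous (d - 1) (moment G i)" for i
  proof -
    have "d - 1 = Suc e" using e by simp
    then show ?thesis using homogeneous_moment[OF G] by simp
  qed
  obtain c where c: "\<And>k. F dvd moment G k - scalar c * partial_deriv k F"
    using residue_constant[OF rel e F dvd_refl] by blast
  have eq: "moment G k = scalar c * partial_deriv k F" for k
  proof -
    have "homogeneous (d - 1) (moment G k - scalar c * partial_deriv k F)"
      by (intro homogeneous_diff homogeneous_scalar_mult W partial_hom)
    then have "moment G k - scalar c * partial_deriv k F = 0"
      by (rule homogeneous_dvd_small_degree[OF c _ F_hom]) (use d_pos in simp)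
    then show ?thesis by simp
  qed
  have "scalar c * (of_nat d * F) = (\<Sum>k\<in>UNIV. variable k * moment G k)"
    unfolding euler[symmetric] eq by (simp add: sum_distrib_left mult.left_commute)
  then have "of_nat d * (scalar c * F) = 0" by (simp add: variable_moment mult.left_commute)
  then have "scalar c * F = 0" by (rule d_mult_cancel)
  then have "scalar c = 0" using F_nonzero by simp
  then have "moment G k = 0" for k by (simp add: eq)
  then show ?thesis by (rule moment_zero_imp_zero[OF rel])
qed

text \<open>
  For \<open>e < d - 2\<close> the residue has negative degree \<open>- j\<close>, so its products with the \<open>x\<^sub>a\<^sup>j\<close> are constants
  \<open>c\<^sub>a\<close>.  If one of them were non-zero, the ratios of the coordinates would be constant on the zero
  set of \<open>P\<close>, so that \<open>P\<close> would divide two independent linear forms.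
\<close>

lemma small_degree_residue_zero:
  assumes rel: "homogeneous_relation F e G" and e: "e + 2 < d"
    and P: "prime_elem P" "P dvd F"
  shows "P dvd moment G k"
proof -
  have G: "homogeneous e (G i)" for i using rel by (simp add: homogeneous_relation_def)
  define j where "j = d - 2 - e"
  have "j > 0" "j + e + 2 = d" using e by (simp_all add: j_def)
  have rel': "homogeneous_relation F (j + e) (\<lambda>i. variable a ^ j * G i)" for a
  proof -
    have "homogeneous (j * 1 + e) (variable a ^ j * G i)" for i
      by (intro homogeneous_mult homogeneous_power homogeneous_variable G)
    moreover have "(\<Sum>i\<in>UNIV. variable a ^ j * G i * partial_deriv i F) =
        variable a ^ j * (\<Sum>i\<in>UNIV. G i * partial_deriv i F)"
      by (simp add: sum_distrib_left mult.assoc)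
    ultimately show ?thesis using rel by (simp add: homogeneous_relation_def)
  qed
  have moment': "moment (\<lambda>i. variable a ^ j * G i) k = variable a ^ j * moment G k" for a k
    by (simp add: moment_def algebra_simps)
  have "\<exists>c. \<forall>k. P dvd variable a ^ j * moment G k - scalar c * partial_deriv k F" for a
    using residue_constant[OF rel' _ P, of a] \<open>j + e + 2 = d\<close> by (simp add: moment')
  then obtain c where c: "\<And>a k. P dvd variable a ^ j * moment G k - scalar (c a) * partial_deriv k F"
    by metis
  have "c a = 0" for a
  proof (rule ccontr)
    assume ca: "c a \<noteq> 0"
    obtain i where i: "\<not> P dvd partial_deriv i F" using prime_not_dvd_all_partials[OF P(1)] by blast
    have ratio: "P dvd scalar (c a) * variable b ^ j - scalar (c b) * variable a ^ j" for b
    proof -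
      have "(scalar (c a) * variable b ^ j - scalar (c b) * variable a ^ j) * partial_deriv i F =
          variable a ^ j * (variable b ^ j * moment G i - scalar (c b) * partial_deriv i F) -
          variable b ^ j * (variable a ^ j * moment G i - scalar (c a) * partial_deriv i F)"
        by (simp add: algebra_simps)
      also have "P dvd \<dots>" by (intro dvd_diff dvd_mult c)
      finally show ?thesis using i prime_elem_dvd_multD[OF P(1)] by metis
    qed
    have unit: "\<not> P dvd scalar (c a)"
      using scalar_unit[OF ca] prime_elem_not_unit[OF P(1)] dvd_trans by metis
    have Pa: "\<not> P dvd variable a"
    proof
      assume Pa: "P dvd variable a"
      have "P dvd variable b" for b
      proof -
        have "P dvd scalar (c b) * variable a ^ j"
          using Pa \<open>j > 0\<close> by (intro dvd_mult) (metis dvd_power dvd_trans gr_implies_not0)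
        then have "P dvd (scalar (c a) * variable b ^ j - scalar (c b) * variable a ^ j) + scalar (c b) * variable a ^ j"
          using ratio by (intro dvd_add)
        then have "P dvd scalar (c a) * variable b ^ j" by simp
        then show ?thesis
          using unit prime_elem_dvd_multD[OF P(1)] prime_elem_dvd_power[OF P(1)] by metis
      qed
      then show False using prime_not_dvd_variable[OF P(1)] by simp
    qed
    have "\<exists>l. P dvd variable b - scalar l * variable a" for b
    proof -
      define f where "f = monom (c a) j - [:c b:]"
      have "coeff f j = c a" using \<open>j > 0\<close> by (simp add: f_def coeff_pCons split: nat.split)
      then have f: "f \<noteq> 0" using ca by auto
      have "degree f \<le> j" unfolding f_def by (intro degree_diff_le degree_monom_le) simp
      moreover have "homogenized j f (variable a) (variable b) =
          scalar (c a) * variable b ^ j - scalar (c b) * variable a ^ j"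
      proof -
        have "homogenized j f (variable a) (variable b) =
            (\<Sum>n\<le>j. (if n = j then scalar (c a) * variable b ^ j else 0) -
              (if n = 0 then scalar (c b) * variable a ^ j else 0))"
          unfolding homogenized_def using \<open>j > 0\<close>
          by (intro sum.cong) (auto simp: f_def coeff_pCons single_diff single_uminus split: nat.split)
        then show ?thesis by (simp add: sum_subtractf)
      qed
      ultimately have "\<exists>l. variable b - scalar l * variable a \<in> {x. P dvd x}"
        using ratio
        by (intro binary_form_in_prime[of "{x. P dvd x}" "\<lambda>_. True", OF _ _ _ _ _ _ f])
           (use Pa prime_elem_dvd_multD[OF P(1)] in \<open>auto intro: dvd_mult\<close>)
      then show ?thesis by simp
    qed
    then obtain l where l: "\<And>b. P dvd variable b - scalar (l b) * variable a" by metis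
    define u where "u b = variable b - scalar (l b) * variable a" for b
    have u_hom: "homogeneous 1 (u b)" for b
      unfolding u_def by (intro homogeneous_diff homogeneous_scalar_mult homogeneous_variable)
    define unit_point where "unit_point b i = (if i = b then 1 else (0 :: 'k))" for b i :: 3
    have u_eval: "eval_at (u b) (unit_point b') = (if b = b' then 1 else 0)" if "b' \<noteq> a" for b b'
      using that by (simp add: u_def unit_point_def eval_at.hom_minus eval_at.hom_mult)
    have multiple: "\<exists>s. u b = scalar s * P" if "b \<noteq> a" for b
    proof -
      have "u b \<noteq> 0" using u_eval[OF that, of b] by auto
      then obtain n B where B: "n \<le> 1" "homogeneous n P" "homogeneous (1 - n) B" "u b = P * B"
        using homogeneous_dvd[OF l[of b, folded u_def] u_hom] by blast
      have "n \<noteq> 0"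
        using form_unit_iff[OF B(2)] prime_elem_not_unit[OF P(1)] prime_elem_not_zeroI[OF P(1)] by metis
      then have "homogeneous 0 B" using B by simp
      then show ?thesis using homogeneous_0_scalar B(4) by (metis mult.commute)
    qed
    obtain s s' where s: "u (a + 1) = scalar s * P" "u (a + 2) = scalar s' * P"
      using multiple distinct_3[of a] by metis
    then have "scalar s' * u (a + 1) = scalar s * u (a + 2)" by simp
    then have *: "s' * eval_at (u (a + 1)) q = s * eval_at (u (a + 2)) q" for q
      by (metis eval_at.hom_mult eval_at_scalar)
    have "s' = 0" using *[of "unit_point (a + 1)"] distinct_3[of a] by (simp add: u_eval)
    then have "u (a + 2) = 0" using s by simp
    then show False using u_eval[of "a + 2" "a + 2"] distinct_3[of a] by simp
  qed
  then have "P dvd variable a ^ j * moment G k" for a using c[of a k] by simp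
  moreover obtain a where "\<not> P dvd variable a" using prime_not_dvd_variable[OF P(1)] by blast
  ultimately show ?thesis
    using prime_elem_dvd_multD[OF P(1)] prime_elem_dvd_power[OF P(1)] by metis
qed

lemma small_degree_no_relation:
  assumes rel: "homogeneous_relation F e G" and e: "e + 2 < d"
  shows "G i = 0"
proof -
  have G: "homogeneous e (G i)" for i using rel by (simp add: homogeneous_relation_def)
  have "F dvd moment G k" for k
    by (rule squarefree_dvdI[OF F_nonzero squarefree small_degree_residue_zero[OF rel e]])
  then have "moment G k = 0" for k
    by (rule homogeneous_dvd_small_degree[OF _ homogeneous_moment[OF G] F_hom]) (use e in simp)
  then show ?thesis by (rule moment_zero_imp_zero[OF rel])
qed


subsection \<open>Reducible curves\<close>

lemma not_prime_factors:
  assumes "\<not> prime_elem F"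
  obtains F1 F2 where "F = F1 * F2" "\<not> F1 dvd 1" "\<not> F2 dvd 1"
proof -
  obtain Ps where Ps: "Ps \<noteq> {#}" "\<And>P. P \<in># Ps \<Longrightarrow> prime_elem P" "prod_mset Ps = F"
    using prime_factorization_ternary[OF F_nonzero F_nonunit] by metis
  obtain P Qs where P: "Ps = add_mset P Qs" using Ps(1) by (metis multiset_cases)
  have "Qs \<noteq> {#}" using P Ps(2,3) assms by auto
  then obtain P' Rs where P': "Qs = add_mset P' Rs" by (metis multiset_cases)
  have "F = P * (P' * prod_mset Rs)" using P P' Ps(3) by simp
  moreover have "\<not> P dvd 1" using Ps(2)[of P] P by (intro prime_elem_not_unit) simp
  moreover have "\<not> P' * prod_mset Rs dvd 1"
  proof
    assume "P' * prod_mset Rs dvd 1"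
    then have "P' dvd 1" by (rule dvd_mult_left)
    moreover have "prime_elem P'" using Ps(2)[of P'] P P' by simp
    ultimately show False using prime_elem_not_unit by metis
  qed
  ultimately show thesis by (rule that)
qed

lemma factor_has_prime:
  assumes "F = A * B" "\<not> A dvd 1"
  obtains P where "prime_elem P" "P dvd A"
proof -
  have "A \<noteq> 0" using assms F_nonzero by auto
  then obtain Ps where Ps: "Ps \<noteq> {#}" "\<And>P. P \<in># Ps \<Longrightarrow> prime_elem P" "prod_mset Ps = A"
    using prime_factorization_ternary[OF _ assms(2)] by metis
  obtain P Qs where "Ps = add_mset P Qs" using Ps(1) by (metis multiset_cases)
  then have "prime_elem P" "P dvd A" using Ps by auto
  then show thesis by (rule that)
qed

lemma reducible_curve_iff: "reducible_curve F \<longleftrightarrow> \<not> prime_elem F"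
proof
  assume "reducible_curve F"
  then obtain Z1 Z2 T1 T2 where Z: "curve_points F = Z1 \<union> Z2" "Z1 \<noteq> curve_points F" "Z2 \<noteq> curve_points F"
      "Z1 = proj_zeros T1" "Z2 = proj_zeros T2"
    unfolding reducible_curve_def proj_closed_def by metis
  have outside: "\<exists>H\<in>T. \<not> F dvd H" if "proj_zeros T \<subseteq> curve_points F" "proj_zeros T \<noteq> curve_points F" for T
  proof -
    from that obtain q where q: "q \<in> curve_points F" "q \<notin> proj_zeros T" by blast
    then obtain H where H: "H \<in> T" "eval_at H q \<noteq> 0" by (auto simp: proj_zeros_def)
    have "\<not> F dvd H"
    proof
      assume "F dvd H"
      then obtain A where "H = F * A" by (rule dvdE)
      then show False using H(2) q(1) by (simp add: eval_at.hom_mult proj_zeros_def)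
    qed
    then show ?thesis using H(1) by blast
  qed
  obtain H1 where H1: "H1 \<in> T1" "\<not> F dvd H1" using outside[of T1] Z by blast
  obtain H2 where H2: "H2 \<in> T2" "\<not> F dvd H2" using outside[of T2] Z by blast
  show "\<not> prime_elem F"
  proof
    assume F: "prime_elem F"
    then have "\<not> F dvd H1 * H2" using H1 H2 prime_elem_dvd_multD by metis
    then obtain q where q: "q \<noteq> (\<lambda>_. 0)" "eval_at F q = 0" "eval_at (H1 * H2) q \<noteq> 0"
      using curve_nullstellensatz[OF F] by metis
    then have "q \<in> Z1 \<union> Z2" using Z(1) by (auto simp: proj_zeros_def)
    then show False using q(3) H1 H2 Z(4,5) by (auto simp: proj_zeros_def eval_at.hom_mult)
  qed
next
  assume "\<not> prime_elem F"
  then obtain F1 F2 where F12: "F = F1 * F2" "\<not> F1 dvd 1" "\<not> F2 dvd 1" by (rule not_prime_factors)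
  have F21: "F = F2 * F1" using F12(1) by (simp add: mult.commute)
  have proper: "curve_points A \<noteq> curve_points F" if F: "F = B * A" "\<not> B dvd 1" for A B
  proof -
    obtain P where P: "prime_elem P" "P dvd B" by (rule factor_has_prime[OF F])
    obtain q where q: "q \<noteq> (\<lambda>_. 0)" "eval_at P q = 0" "eval_at A q \<noteq> 0"
      by (rule curve_nullstellensatz[OF P(1) prime_factors_coprime[OF F(1) P]])
    obtain C where "B = P * C" using P(2) by (rule dvdE)
    then have "eval_at F q = 0" using q(2) by (simp add: F(1) eval_at.hom_mult)
    then have "q \<in> curve_points F" "q \<notin> curve_points A" using q by (auto simp: proj_zeros_def)
    then show ?thesis by blast
  qed
  have closed: "proj_closed (curve_points A)" if A: "F = A * B" for A B
  proof -
    obtain n where "homogeneous n A" using homogeneous_factor[of d A B] F_hom F_nonzero A by auto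
    then show ?thesis unfolding proj_closed_def by (intro exI[of _ "{A}"]) auto
  qed
  have "curve_points F = curve_points F1 \<union> curve_points F2"
    by (auto simp: proj_zeros_def F12(1) eval_at.hom_mult)
  then show "reducible_curve F"
    unfolding reducible_curve_def
    using closed[OF F12(1)] closed[OF F21] proper[OF F21 F12(3)] proper[OF F12(1,2)] by metis
qed

text \<open>
  By Euler's formula, parallel gradients give \<open>d\<^sub>2 F\<^sub>2 \<partial>\<^sub>j F\<^sub>1 = d\<^sub>1 F\<^sub>1 \<partial>\<^sub>j F\<^sub>2\<close>.  As \<open>F\<^sub>1\<close> and \<open>F\<^sub>2\<close> are
  coprime, \<open>F\<^sub>1\<close> divides its own partial derivatives, which therefore vanish for degree reasons.
  Then \<open>F\<^sub>1\<close> divides all partial derivatives of \<open>F\<close>, against the Hessian condition.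
\<close>

lemma parallel_gradients_factor:
  assumes F12: "F = F1 * F2" "\<not> F1 dvd 1" and hom: "homogeneous d1 F1" "homogeneous d2 F2"
    and d2: "of_nat d2 \<noteq> (0 :: 'k)"
    and par: "\<And>i j. partial_deriv i F1 * partial_deriv j F2 = partial_deriv j F1 * partial_deriv i F2"
  shows False
proof -
  have nz: "F1 \<noteq> 0" "F2 \<noteq> 0" using F12(1) F_nonzero by auto
  have d1: "d1 > 0" using form_unit_iff[OF hom(1) nz(1)] F12(2) by auto
  have coprime: "P dvd F2 \<Longrightarrow> \<not> P dvd F1" if "prime_elem P" for P
    using prime_factors_coprime[OF F12(1) that] by blast
  have "partial_deriv j F1 = 0" for j
  proof -
    have "of_nat d2 * F2 * partial_deriv j F1 =
        (\<Sum>i\<in>UNIV. variable i * (partial_deriv j F1 * partial_deriv i F2))"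
      unfolding euler_formula[OF hom(2), symmetric] by (simp add: sum_distrib_left sum_distrib_right mult_ac)
    also have "\<dots> = (\<Sum>i\<in>UNIV. variable i * (partial_deriv i F1 * partial_deriv j F2))"
      by (simp add: par[of j])
    also have "\<dots> = of_nat d1 * F1 * partial_deriv j F2"
      unfolding euler_formula[OF hom(1), symmetric] by (simp add: sum_distrib_left sum_distrib_right mult_ac)
    finally have eq: "of_nat d2 * F2 * partial_deriv j F1 = of_nat d1 * F1 * partial_deriv j F2" .
    have "F1 dvd partial_deriv j F1"
    proof (rule squarefree_dvdI[OF nz(1)])
      show "\<not> P * P dvd F1" if "prime_elem P" for P
        using squarefree[OF that] F12(1) by (metis dvd_mult2)
    next
      fix P assume P: "prime_elem P" "P dvd F1"
      have "P dvd scalar (of_nat d2) * (F2 * partial_deriv j F1)"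
        using eq P(2) by (simp add: mult.assoc)
      moreover have "\<not> P dvd scalar (of_nat d2)"
        using scalar_unit[OF d2] prime_elem_not_unit[OF P(1)] dvd_trans by metis
      ultimately have "P dvd F2 * partial_deriv j F1" using prime_elem_dvd_multD[OF P(1)] by metis
      then show "P dvd partial_deriv j F1" using prime_elem_dvd_multD[OF P(1)] coprime[OF P(1)] P(2) by metis
    qed
    then show ?thesis
      by (rule homogeneous_dvd_small_degree[OF _ homogeneous_partial_deriv[OF hom(1)] hom(1)]) (use d1 in simp)
  qed
  then have "partial_deriv j F = F1 * partial_deriv j F2" for j
    by (simp add: F12(1) partial_deriv_mult)
  moreover obtain P where P: "prime_elem P" "P dvd F1" by (rule factor_has_prime[OF F12])
  ultimately show False using prime_not_dvd_all_partials[OF P(1)] dvd_mult2[OF P(2)] by simp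
qed

text \<open>
  A factorization \<open>F = F\<^sub>1 F\<^sub>2\<close> gives the relation \<open>G = \<nabla>F\<^sub>1 \<times> \<nabla>F\<^sub>2\<close>, which is orthogonal to
  \<open>\<nabla>F = F\<^sub>2 \<nabla>F\<^sub>1 + F\<^sub>1 \<nabla>F\<^sub>2\<close>.
\<close>

lemma reducible_relation:
  assumes "\<not> prime_elem F"
  shows "\<exists>e G. homogeneous_relation F e G \<and> (\<exists>i. G i \<noteq> 0) \<and> e + 2 = d"
proof -
  obtain F1 F2 where F12: "F = F1 * F2" "\<not> F1 dvd 1" "\<not> F2 dvd 1"
    using not_prime_factors[OF assms] by blast
  have F21: "F = F2 * F1" using F12(1) by (simp add: mult.commute)
  obtain d1 where d1: "homogeneous d1 F1" using homogeneous_factor[of d F1 F2] F_hom F_nonzero F12 by auto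
  obtain d2 where d2: "homogeneous d2 F2" using homogeneous_factor[of d F2 F1] F_hom F_nonzero F21 by auto
  have nz: "F1 \<noteq> 0" "F2 \<noteq> 0" using F12(1) F_nonzero by auto
  have pos: "d1 > 0" "d2 > 0"
    using form_unit_iff[OF d1 nz(1)] form_unit_iff[OF d2 nz(2)] F12 by auto
  have d12: "d = d1 + d2"
    using homogeneous_degree_unique[OF F_hom _ F_nonzero] homogeneous_mult[OF d1 d2] F12(1) by simp
  define G where "G i = partial_deriv (i + 1) F1 * partial_deriv (i + 2) F2 -
    partial_deriv (i + 2) F1 * partial_deriv (i + 1) F2" for i
  have "homogeneous ((d1 - 1) + (d2 - 1)) (G i)" for i
    unfolding G_def by (intro homogeneous_diff homogeneous_mult homogeneous_partial_deriv d1 d2)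
  moreover have "(\<Sum>i\<in>UNIV. G i * partial_deriv i F) = 0"
    unfolding F12(1) sum_3[of _ 0] G_def partial_deriv_mult add_3 by (simp add: algebra_simps)
  ultimately have "homogeneous_relation F ((d1 - 1) + (d2 - 1)) G"
    by (simp add: homogeneous_relation_def)
  moreover have "\<exists>i. G i \<noteq> 0"
  proof (rule ccontr)
    assume "\<not> ?thesis"
    then have G0: "G i = 0" for i by blast
    have par: "partial_deriv i F1 * partial_deriv j F2 = partial_deriv j F1 * partial_deriv i F2" for i j
    proof -
      have 1: "partial_deriv (i + 1) F1 * partial_deriv (i + 2) F2 = partial_deriv (i + 2) F1 * partial_deriv (i + 1) F2" for i
        using G0[of i] by (simp add: G_def)
      consider "j = i" | "j = i + 1" | "j = i + 2" using exhaust_3 by blast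
      then show ?thesis
        using 1[of "i + 2"] 1[of "i + 1"] by cases (simp_all add: add_3)
    qed
    have "of_nat d1 \<noteq> (0::'k) \<or> of_nat d2 \<noteq> (0::'k)" using d d12 by auto
    then show False
    proof
      assume "of_nat d2 \<noteq> (0::'k)"
      then show False by (rule parallel_gradients_factor[OF F12(1,2) d1 d2 _ par])
    next
      assume "of_nat d1 \<noteq> (0::'k)"
      moreover have "partial_deriv i F2 * partial_deriv j F1 = partial_deriv j F2 * partial_deriv i F1" for i j
        using par[of j i] by (simp add: mult.commute)
      ultimately show False by (rule parallel_gradients_factor[OF F21 F12(3) d2 d1])
    qed
  qed
  moreover have "(d1 - 1) + (d2 - 1) + 2 = d" using pos d12 by simp
  ultimately show ?thesis by blast
qed

end

theorem corollary5p1: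
  fixes F :: "'k::alg_closed_field ternary" and d :: nat
  assumes "\<not> CHAR('k) dvd d"
    and "F \<noteq> 0" and "homogeneous d F"
    and "reduced_curve F"
    and "\<And>p. singular_point F p \<Longrightarrow> ordinary_node F p"
  shows "(\<forall>e G. homogeneous_relation F e G \<longrightarrow> (\<forall>i. G i \<noteq> 0 \<longrightarrow> int e \<ge> int d - 2)) \<and>
         ((\<exists>e G. homogeneous_relation F e G \<and> (\<exists>i. G i \<noteq> 0 \<and> int e = int d - 2))
            \<longleftrightarrow> reducible_curve F)"
proof -
  interpret nodal_curve F d
    using assms(1,2,3,5) by (intro nodal_curve.intro) (simp_all only: of_nat_eq_0_iff_char_dvd not_False_eq_True)
  show ?thesis
  proof (intro conjI allI impI iffI)
    fix e G i assume rel: "homogeneous_relation F e G" and "G i \<noteq> 0"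
    then have "\<not> e + 2 < d" using small_degree_no_relation[OF rel] by blast
    then show "int e \<ge> int d - 2" by linarith
  next
    assume "\<exists>e G. homogeneous_relation F e G \<and> (\<exists>i. G i \<noteq> 0 \<and> int e = int d - 2)"
    then obtain e G i where rel: "homogeneous_relation F e G" and G: "G i \<noteq> 0" and "int e = int d - 2"
      by blast
    from this(3) have "e + 2 = d" by linarith
    then have "\<not> prime_elem F" using irreducible_no_relation[OF rel] G by metis
    then show "reducible_curve F" by (simp add: reducible_curve_iff)
  next
    assume "reducible_curve F"
    then have "\<not> prime_elem F" by (simp add: reducible_curve_iff)
    from reducible_relation[OF this] obtain e G i
      where rel: "homogeneous_relation F e G" and G: "G i \<noteq> 0" and "e + 2 = d" by (elim exE conjE)
    from this(3) have "int e = int d - 2" by linarith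
    with rel G show "\<exists>e G. homogeneous_relation F e G \<and> (\<exists>i. G i \<noteq> 0 \<and> int e = int d - 2)" by metis
  qed
qed

end
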